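(* Let $\mathcal{H}$ be a hereditary $3$-graph property. The following are equivalent. (1) $\mathcal{H}$ is $\mathrm{vdisc}_3$-homogeneous. (2) There is $k\geq1$ such that $\mathrm{Trip}(\mathcal{H})$ omits $\overline{U}(k)$. (3) There is a hereditary $3$-graph property $\mathcal{H}'$ of bounded slicewise $\mathrm{VC}$-dimension (i.e. there is $k$ with $\mathrm{SVC}(H')\leq k$ for all $H'\in\mathcal{H}'$) such that $\mathcal{H}\sim\mathcal{H}'$.
   Context: For distinct $x,y,z$ write $xyz=\{x,y,z\}$; $[n]=\{1,\dots,n\}$; $K_3[X,Y,Z]=\{xyz:x\in X,y\in Y,z\in Z\text{ pairwise distinct}\}$. A $3$-graph is a pair $H=(V,F)$ with $F\subseteq\binom V3$. A hereditary $3$-graph property is a class of finite $3$-graphs closed under isomorphism and induced sub-$3$-graphs. An equipartition is a partition whose parts differ in size by at most $1$. Given $H=(V,F)$, $\mathrm{Trip}(H)$ is the $3$-partite $3$-graph with vertex set $\{x_v:v\in V\}\cup\{y_v:v\in V\}\cup\{z_v:v\in V\}$ (three disjoint copies of $V$) and edge set $\{x_vy_{v'}z_{v''}:vv'v''\in F\}$. $\mathrm{Trip}(\mathcal{H})$ omits a $3$-graph $\Gamma$ if for no $H\in\mathcal{H}$ is $\Gamma$ isomorphic to an induced sub-$3$-graph of $\mathrm{Trip}(H)$. $\overline{U}(k)$ is the $3$-partite $3$-graph with vertex set $\{a_1,\dots,a_k\}\cup\{b_S:S\subseteq[k]\}\cup\{c_1,\dots,c_k\}$ and edge set $\{a_ib_Sc_j:j\in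 S\}$. $\mathrm{SVC}(H)$, the slicewise $\mathrm{VC}$-dimension of $H=(V,F)$, is the largest $k$ for which there are $a,c_1,\dots,c_k\in V$ and $b_S\in V$ for each $S\subseteq[k]$ such that $\{a,c_i,b_S\}\in F$ if and only if $i\in S$. Two $3$-graphs $(V,F),(V,F')$ on the same vertex set are $\delta$-close if $|F\Delta F'|\leq\delta|V|^3$. $\mathcal{H}$ is close to $\mathcal{H}'$ if for all $\delta>0$ there is $N$ such that every $G\in\mathcal{H}$ on at least $N$ vertices is $\delta$-close to some element of $\mathcal{H}'$ with the same vertex set. $\mathcal{H}\sim\mathcal{H}'$ means that $\mathcal{H}$ is close to $\mathcal{H}'$ and $\mathcal{H}'$ is close to $\mathcal{H}$. A $3$-partite $3$-graph $(U\cup V\cup W,F)$ with $|F|=d|U||V||W|$ has $\mathrm{vdisc}_3(\epsilon)$ if for all $U'\subseteq U$, $V'\subseteq V$, $W'\subseteq W$, $\big||F\cap K_3[U',V',W']|-d|U'||V'||W'|\big|\leq\epsilon|U||V||W|$. For $H=(V,F)$ and a partition $\mathcal{P}=\{V_1,\dots,V_t\}$ of $V$: $\mathcal{P}$ is a $\mathrm{vdisc}_3(\epsilon)$-regular partition for $H$ if it is an equipartition and for all but at most $\epsilon\binom t3$ of the $ijk\in\binom{[t]}{3}$, $(V_i\cup V_j\cup V_k,F\cap K_3[V_i,V_j,V_k])$ has $\mathrm{vdisc}_3(\epsilon)$; $\mathcal{P}$ is $\mu$-homogeneous with respect to $H$ if at least $(1-\mu)\binom{|V|}{3}$ triples $xyz\in\binom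 V3$ lie in $K_3[V_i,V_j,V_k]$ for some three distinct parts with $|F\cap K_3[V_i,V_j,V_k]|/|K_3[V_i,V_j,V_k]|\in[0,\mu)\cup(1-\mu,1]$. $\mathcal{H}$ is $\mathrm{vdisc}_3$-homogeneous if for all $\epsilon>0$ and $t_0\geq1$ there are $T$ and $N$ such that for every $H=(V,F)\in\mathcal{H}$ with $|V|\geq N$ there is a partition of $V$ into $t$ parts, $t_0\leq t\leq T$, which is $\mathrm{vdisc}_3(\epsilon)$-regular and $\epsilon$-homogeneous with respect to $H$. *)

theory Defs
  imports Complex_Main "HOL-Library.Ramsey" "HOL-Library.Disjoint_Sets"
begin

section \<open>3-graphs\<close>

text \<open>A 3-graph is a pair of a vertex set \<open>V\<close> and an edge set \<open>F \<subseteq> [V]\<^bsup>3\<^esup>\<close>.\<close>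

type_synonym 'a graph3 = "'a set \<times> 'a set set"

abbreviation verts :: "'a graph3 \<Rightarrow> 'a set" where "verts \<equiv> fst"
abbreviation edges :: "'a graph3 \<Rightarrow> 'a set set" where "edges \<equiv> snd"

definition is_graph3 :: "'a graph3 \<Rightarrow> bool" where
  "is_graph3 G \<longleftrightarrow> edges G \<subseteq> [verts G]\<^bsup>3\<^esup>"

definition induced :: "'a graph3 \<Rightarrow> 'a set \<Rightarrow> 'a graph3" where
  "induced G W = (W, {e \<in> edges G. e \<subseteq> W})"

definition iso3 :: "'a graph3 \<Rightarrow> 'b graph3 \<Rightarrow> bool" where
  "iso3 G G' \<longleftrightarrow> (\<exists>f. bij_betw f (verts G) (verts G') \<and> (\<lambda>e. f ` e) ` edges G = edges G')"

text \<open>A class of finite 3-graphs closed under isomorphism is represented by its members whose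
  vertex set is a finite set of natural numbers; every finite 3-graph is isomorphic to one of
  these.\<close>

definition hereditary :: "nat graph3 set \<Rightarrow> bool" where
  "hereditary \<H> \<longleftrightarrow>
     (\<forall>G\<in>\<H>. finite (verts G) \<and> is_graph3 G) \<and>
     (\<forall>G\<in>\<H>. \<forall>G'. is_graph3 G' \<and> iso3 G G' \<longrightarrow> G' \<in> \<H>) \<and>
     (\<forall>G\<in>\<H>. \<forall>W\<subseteq>verts G. induced G W \<in> \<H>)"

definition K3 :: "'a set \<Rightarrow> 'a set \<Rightarrow> 'a set \<Rightarrow> 'a set set" where
  "K3 X Y Z = {{x, y, z} | x y z. x \<in> X \<and> y \<in> Y \<and> z \<in> Z \<and> x \<noteq> y \<and> x \<noteq> z \<and> y \<noteq> z}"


section \<open>The tripartite graphs Trip(H) and U-bar(k)\<close>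

datatype 'a trip_vertex = TX 'a | TY 'a | TZ 'a

definition Trip :: "'a graph3 \<Rightarrow> 'a trip_vertex graph3" where
  "Trip H = (TX ` verts H \<union> TY ` verts H \<union> TZ ` verts H,
             {{TX u, TY v, TZ w} | u v w. {u, v, w} \<in> edges H})"

text \<open>The isomorphism is one of 3-graphs; it need not respect the three vertex classes.\<close>

definition Trip_omits :: "nat graph3 set \<Rightarrow> 'b graph3 \<Rightarrow> bool" where
  "Trip_omits \<H> \<Gamma> \<longleftrightarrow> \<not> (\<exists>H\<in>\<H>. \<exists>W\<subseteq>verts (Trip H). iso3 \<Gamma> (induced (Trip H) W))"

datatype ubar_vertex = UA nat | UB "nat set" | UC nat

definition Ubar :: "nat \<Rightarrow> ubar_vertex graph3" where
  "Ubar k = (UA ` {1..k} \<union> UB ` Pow {1..k} \<union> UC ` {1..k},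
             {{UA i, UB S, UC j} | i S j. i \<in> {1..k} \<and> S \<subseteq> {1..k} \<and> j \<in> S})"


section \<open>Slicewise VC-dimension\<close>

definition slice_shatters :: "'a graph3 \<Rightarrow> nat \<Rightarrow> bool" where
  "slice_shatters H k \<longleftrightarrow>
     (\<exists>a\<in>verts H. \<exists>(c :: nat \<Rightarrow> 'a) (b :: nat set \<Rightarrow> 'a).
        (\<forall>i\<in>{1..k}. c i \<in> verts H) \<and> (\<forall>S\<subseteq>{1..k}. b S \<in> verts H) \<and>
        (\<forall>i\<in>{1..k}. \<forall>S\<subseteq>{1..k}. {a, c i, b S} \<in> edges H \<longleftrightarrow> i \<in> S))"

text \<open>For finite \<open>H\<close> the supremum is a maximum by the next lemma, except that the 3-graph
  without vertices, for which no \<open>k\<close> qualifies, gets the value \<open>0\<close>.\<close>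

definition SVC :: "'a graph3 \<Rightarrow> nat" where
  "SVC H = Sup {k. slice_shatters H k}"

lemma slice_shatters_le_card:
  assumes "finite (verts H)" and "slice_shatters H k"
  shows "k \<le> card (verts H)"
proof -
  obtain a c b where c: "\<forall>i\<in>{1..k}. c i \<in> verts H"
    and e: "\<forall>i\<in>{1..k}. \<forall>S\<subseteq>{1..k}. {a, c i, b S} \<in> edges H \<longleftrightarrow> i \<in> S"
    using assms(2) unfolding slice_shatters_def by blast
  have "inj_on c {1..k}"
  proof (rule inj_onI)
    fix i j assume ij: "i \<in> {1..k}" "j \<in> {1..k}" "c i = c j"
    then have "{i} \<subseteq> {1..k}" by blast
    with e ij show "i = j" by (metis singletonD singletonI)
  qed
  then have "card {1..k} \<le> card (verts H)"
    using c assms(1) by (intro card_inj_on_le) auto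
  then show ?thesis by simp
qed


section \<open>Closeness\<close>

definition delta_close :: "real \<Rightarrow> 'a graph3 \<Rightarrow> 'a graph3 \<Rightarrow> bool" where
  "delta_close \<delta> G G' \<longleftrightarrow> verts G = verts G' \<and>
     real (card (sym_diff (edges G) (edges G'))) \<le> \<delta> * real (card (verts G)) ^ 3"

definition close_to :: "nat graph3 set \<Rightarrow> nat graph3 set \<Rightarrow> bool" where
  "close_to \<H> \<H>' \<longleftrightarrow>
     (\<forall>\<delta>>0. \<exists>N. \<forall>G\<in>\<H>. card (verts G) \<ge> N \<longrightarrow> (\<exists>G'\<in>\<H>'. delta_close \<delta> G G'))"

definition prop_sim :: "nat graph3 set \<Rightarrow> nat graph3 set \<Rightarrow> bool" where
  "prop_sim \<H> \<H>' \<longleftrightarrow> close_to \<H> \<H>' \<and> close_to \<H>' \<H>"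


section \<open>Regular and homogeneous partitions\<close>

text \<open>\<open>vdisc3 \<epsilon> U V W F\<close> concerns the 3-partite 3-graph on \<open>U \<union> V \<union> W\<close> with edge set \<open>F\<close>; the
  density \<open>d\<close> is determined by \<open>|F| = d|U||V||W|\<close>. The condition is symmetric in the three vertex
  classes, so it may be applied to an unordered triple of parts.\<close>

definition vdisc3 :: "real \<Rightarrow> 'a set \<Rightarrow> 'a set \<Rightarrow> 'a set \<Rightarrow> 'a set set \<Rightarrow> bool" where
  "vdisc3 \<epsilon> U V W F \<longleftrightarrow>
     (let d = real (card F) / (real (card U) * real (card V) * real (card W)) in
      \<forall>U' V' W'. U' \<subseteq> U \<and> V' \<subseteq> V \<and> W' \<subseteq> W \<longrightarrow>
        \<bar>real (card (F \<inter> K3 U' V' W')) - d * real (card U') * real (card V') * real (card W')\<bar>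
          \<le> \<epsilon> * real (card U) * real (card V) * real (card W))"

lemma K3_commute: "K3 X Y Z = K3 Y X Z" "K3 X Y Z = K3 X Z Y"
proof -
  have 1: "K3 X Y Z \<subseteq> K3 Y X Z" for X Y Z :: "'a set"
    unfolding K3_def by (smt (verit) insert_commute mem_Collect_eq subsetI)
  have 2: "K3 X Y Z \<subseteq> K3 X Z Y" for X Y Z :: "'a set"
    unfolding K3_def by (smt (verit) insert_commute mem_Collect_eq subsetI)
  show "K3 X Y Z = K3 Y X Z" "K3 X Y Z = K3 X Z Y" using 1 2 by blast+
qed

lemma vdisc3_commute: "vdisc3 \<epsilon> U V W F = vdisc3 \<epsilon> V U W F" "vdisc3 \<epsilon> U V W F = vdisc3 \<epsilon> U W V F"
proof -
  have 1: "vdisc3 \<epsilon> V U W F" if h: "vdisc3 \<epsilon> U V W F" for U V W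
    unfolding vdisc3_def Let_def
  proof (intro allI impI, goal_cases)
    case (1 V' U' W')
    then show ?case
      using h[unfolded vdisc3_def Let_def, rule_format, of U' V' W'] K3_commute(1)[of V' U' W']
      by (simp add: mult.commute mult.left_commute)
  qed
  have 2: "vdisc3 \<epsilon> U W V F" if h: "vdisc3 \<epsilon> U V W F" for U V W
    unfolding vdisc3_def Let_def
  proof (intro allI impI, goal_cases)
    case (1 U' W' V')
    then show ?case
      using h[unfolded vdisc3_def Let_def, rule_format, of U' V' W'] K3_commute(2)[of U' W' V']
      by (simp add: mult.commute mult.left_commute)
  qed
  show "vdisc3 \<epsilon> U V W F = vdisc3 \<epsilon> V U W F" using 1 by blast
  show "vdisc3 \<epsilon> U V W F = vdisc3 \<epsilon> U W V F" using 2 by blast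
qed

text \<open>A partition is the set of its (non-empty) parts.\<close>

definition equipartition :: "'a set \<Rightarrow> 'a set set \<Rightarrow> bool" where
  "equipartition V P \<longleftrightarrow> partition_on V P \<and> (\<forall>A\<in>P. \<forall>B\<in>P. card A \<le> card B + 1)"

definition vdisc3_regular :: "real \<Rightarrow> 'a graph3 \<Rightarrow> 'a set set \<Rightarrow> bool" where
  "vdisc3_regular \<epsilon> H P \<longleftrightarrow> equipartition (verts H) P \<and>
     real (card {T \<in> [P]\<^bsup>3\<^esup>. \<exists>A B C. T = {A, B, C} \<and> \<not> vdisc3 \<epsilon> A B C (edges H \<inter> K3 A B C)})
       \<le> \<epsilon> * real (card P choose 3)"

definition homogeneous3 :: "real \<Rightarrow> 'a graph3 \<Rightarrow> 'a set set \<Rightarrow> bool" where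
  "homogeneous3 \<mu> H P \<longleftrightarrow>
     real (card {e \<in> [verts H]\<^bsup>3\<^esup>. \<exists>A\<in>P. \<exists>B\<in>P. \<exists>C\<in>P. A \<noteq> B \<and> A \<noteq> C \<and> B \<noteq> C \<and> e \<in> K3 A B C \<and>
              real (card (edges H \<inter> K3 A B C)) / real (card (K3 A B C)) \<in> {0..<\<mu>} \<union> {1 - \<mu><..1}})
       \<ge> (1 - \<mu>) * real (card (verts H) choose 3)"

definition vdisc3_homogeneous :: "nat graph3 set \<Rightarrow> bool" where
  "vdisc3_homogeneous \<H> \<longleftrightarrow>
     (\<forall>\<epsilon>>0. \<forall>t\<^sub>0\<ge>1. \<exists>T N. \<forall>H\<in>\<H>. card (verts H) \<ge> N \<longrightarrow>
        (\<exists>P. t\<^sub>0 \<le> card P \<and> card P \<le> T \<and> vdisc3_regular \<epsilon> H P \<and> homogeneous3 \<epsilon> H P))"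

end

theory Submission
  imports Defs
begin

text \<open>
  If \<open>Trip(\<H>)\<close> omits \<open>\<U>(k)\<close>, then in a large member of \<open>\<H>\<close> almost every slice
  \<open>{(x, y). xyz \<in> F}\<close> is covered, up to small error, by boundedly many neighbourhoods: otherwise a
  positive proportion of samples shows (by Sauer--Shelah) a shattered set for many \<open>z\<close> at once. So the
  indicator function of \<open>F\<close> is \<open>L\<^sup>1\<close>-close to a sum of boundedly many products \<open>u(x,z) v(y,z)\<close>, and
  likewise in the other two directions. Take a weakly regular partition for all the \<open>u\<close> and \<open>v\<close>.
  Pairing \<open>F\<close> with its approximation in a different direction, the triangle counting estimate allows to
  replace first \<open>u\<close> and then \<open>v\<close> by their averages over the cells, so \<open>F\<close> is close to a step function of
  the partition. This makes an equitable refinement homogeneous, and homogeneity of a triple of parts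
  implies \<open>vdisc\<^sub>3\<close>.

  Conversely, \<open>\<U>(k)\<close> for large \<open>k\<close> contains the 3-graph \<open>{a b c. R(b,c)}\<close> with \<open>R\<close> a Hadamard matrix,
  which by Lindsey's inequality has density near \<open>1/2\<close> on every large box.

  For \<open>\<H>'\<close> take the 3-graphs whose induced density in arbitrarily large members of \<open>\<H>\<close> is bounded
  below. To see that \<open>\<H>\<close> is close to \<open>\<H>'\<close>, take \<open>G\<close> and a much larger \<open>G'\<close> in \<open>\<H>\<close> that follow the same
  step pattern. The pullback of \<open>G'\<close> along a random label-preserving map from \<open>G\<close> is close to \<open>G\<close>, and it
  lies in \<open>\<H>'\<close> with high probability, since each of the finitely many 3-graphs on the vertices of \<open>G\<close>
  outside \<open>\<H>'\<close> has vanishing density in \<open>G'\<close>.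
\<close>

section \<open>The configuration behind the tripartite graphs\<close>

text \<open>The obstacle is that weak regularity controls differences only in cut norm, whereas
  homogeneity is an L1 statement. Two facts bridge the gap. The edge indicator is {0,1}-valued, so
  an L1 distance from it expands into terms linear in the difference. And it may be exchanged for an
  approximation which, with one variable fixed, is a bounded sum of products of functions of one
  variable each: exactly what the cut norm tests. The fixed variable has to be one on which the
  averaged factor does not depend, and this is why several directions are combined. Step patterns
  (\<open>approximable\<close>) are the hub of all implications. They pass to any property close to
  one that has them, which carries bounded slicewise VC-dimension of \<H>' back to \<H>. With
  boundedly many parts there are finitely many patterns, so one of them recurs in arbitrarily large
  members; hence \<open>G\<close> can be fixed before the densities that have to be small are
  chosen. For the converse, the number of parts is bounded before the Hadamard matrix is chosen, so
  the saving in Lindsey's inequality can be made to beat the number of boxes.\<close>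

definition ubar_config :: "'a graph3 \<Rightarrow> nat \<Rightarrow> bool" where
  "ubar_config G k \<longleftrightarrow> (\<exists>(a :: nat \<Rightarrow> 'a) (b :: nat set \<Rightarrow> 'a) (c :: nat \<Rightarrow> 'a).
     inj_on a {1..k} \<and> a ` {1..k} \<subseteq> verts G \<and> b ` Pow {1..k} \<subseteq> verts G \<and> c ` {1..k} \<subseteq> verts G \<and>
     (\<forall>i\<in>{1..k}. \<forall>S\<subseteq>{1..k}. \<forall>j\<in>{1..k}. {a i, b S, c j} \<in> edges G \<longleftrightarrow> j \<in> S))"

text \<open>Tested against one fixed \<open>a i\<close>, the edges through \<open>b S\<close>
  recover \<open>S\<close>, and singletons separate the \<open>c j\<close>. The edge pattern does
  not depend on \<open>i\<close>, so it cannot separate the \<open>a i\<close>; hence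
  \<open>ubar_config\<close> demands injectivity of \<open>a\<close> alone. It does not demand that
  the three families be disjoint, because \<open>Trip\<close> places them in disjoint
  copies.\<close>

lemma ubar_config_inj:
  fixes k :: nat
  assumes "k \<ge> 1"
    and e: "\<forall>i\<in>{1..k}. \<forall>S\<subseteq>{1..k}. \<forall>j\<in>{1..k}. {a i, b S, c j} \<in> E \<longleftrightarrow> j \<in> S"
  shows "inj_on b (Pow {1..k})" and "inj_on c {1..k}"
proof -
  have 1: "1 \<in> {1..k}" using assms(1) by simp
  show "inj_on b (Pow {1..k})"
  proof (rule inj_onI)
    fix S T assume "S \<in> Pow {1..k}" "T \<in> Pow {1..k}" "b S = b T"
    then have "j \<in> S \<longleftrightarrow> j \<in> T" if "j \<in> {1..k}" for j
      using e[rule_format, OF 1, of S j] e[rule_format, OF 1, of T j] that by auto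
    with \<open>S \<in> _\<close> \<open>T \<in> _\<close> show "S = T" by blast
  qed
  show "inj_on c {1..k}"
  proof (rule inj_onI)
    fix i j assume ij: "i \<in> {1..k}" "j \<in> {1..k}" "c i = c j"
    then have "{i} \<subseteq> {1..k}" by blast
    with ij e[rule_format, OF 1, of "{i}" i] e[rule_format, OF 1, of "{i}" j] show "i = j" by auto
  qed
qed

text \<open>Each family goes to its own copy of the vertex set. An edge of \<open>Trip H\<close>
  inside the image takes one vertex from each copy, so it automatically has the form
  \<open>a i\<close>, \<open>b S\<close>, \<open>c j\<close>.\<close>

lemma ubar_config_imp_not_omits:
  assumes "k \<ge> 1" "H \<in> \<H>" "ubar_config H k"
  shows "\<not> Trip_omits \<H> (Ubar k)"
proof -
  obtain a b c where inja: "inj_on a {1..k}" and V: "a ` {1..k} \<subseteq> verts H" "b ` Pow {1..k} \<subseteq> verts H" "c ` {1..k} \<subseteq> verts H"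
    and e: "\<forall>i\<in>{1..k}. \<forall>S\<subseteq>{1..k}. \<forall>j\<in>{1..k}. {a i, b S, c j} \<in> edges H \<longleftrightarrow> j \<in> S"
    using assms(3) unfolding ubar_config_def by (elim exE conjE) (rule that)
  note injs = ubar_config_inj[OF assms(1) e]
  define g where "g = (\<lambda>v. case v of UA i \<Rightarrow> TX (a i) | UB S \<Rightarrow> TY (b S) | UC j \<Rightarrow> TZ (c j))"
  define W where "W = g ` verts (Ubar k)"
  have W: "W = TX ` a ` {1..k} \<union> TY ` b ` Pow {1..k} \<union> TZ ` c ` {1..k}"
    by (simp add: W_def g_def Ubar_def image_Un image_image)
  have "W \<subseteq> verts (Trip H)" using V unfolding W Trip_def fst_conv by blast
  moreover have "inj_on g (verts (Ubar k))"
  proof (rule inj_onI)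
    fix u v assume uv: "u \<in> verts (Ubar k)" "v \<in> verts (Ubar k)" "g u = g v"
    show "u = v"
    proof (cases u)
      case u: (UA i)
      with uv obtain j where "v = UA j" by (cases v) (simp_all add: g_def)
      with u uv show ?thesis by (simp add: g_def Ubar_def image_iff inj_on_eq_iff[OF inja])
    next
      case u: (UB S)
      with uv obtain T where "v = UB T" by (cases v) (simp_all add: g_def)
      with u uv show ?thesis by (simp add: g_def Ubar_def image_iff inj_on_eq_iff[OF injs(1)])
    next
      case u: (UC i)
      with uv obtain j where "v = UC j" by (cases v) (simp_all add: g_def)
      with u uv show ?thesis by (simp add: g_def Ubar_def image_iff inj_on_eq_iff[OF injs(2)])
    qed
  qed
  then have "bij_betw g (verts (Ubar k)) W" by (simp add: bij_betw_def W_def)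
  moreover have "(\<lambda>e. g ` e) ` edges (Ubar k) = {e \<in> edges (Trip H). e \<subseteq> W}"
  proof (intro equalityI subsetI)
    fix X assume "X \<in> (\<lambda>e. g ` e) ` edges (Ubar k)"
    then obtain i S j where "X = g ` {UA i, UB S, UC j}" and ij: "i \<in> {1..k}" "S \<subseteq> {1..k}" "j \<in> S"
      unfolding Ubar_def snd_conv by blast
    then have X: "X = {TX (a i), TY (b S), TZ (c j)}" by (simp add: g_def)
    have "{a i, b S, c j} \<in> edges H" using e ij by blast
    then have "X \<in> edges (Trip H)" unfolding X Trip_def snd_conv by blast
    moreover have "X \<subseteq> W" unfolding X W using ij by blast
    ultimately show "X \<in> {e \<in> edges (Trip H). e \<subseteq> W}" by blast
  next
    fix X assume "X \<in> {e \<in> edges (Trip H). e \<subseteq> W}"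
    then obtain u v w where X: "X = {TX u, TY v, TZ w}" "{u, v, w} \<in> edges H" "X \<subseteq> W"
      unfolding Trip_def snd_conv by blast
    then have "TX u \<in> W" "TY v \<in> W" "TZ w \<in> W" by simp_all
    then obtain i S j where ij: "i \<in> {1..k}" "S \<subseteq> {1..k}" "j \<in> {1..k}" "u = a i" "v = b S" "w = c j"
      unfolding W by blast
    with e X(2) have "j \<in> S" by blast
    with ij have "{UA i, UB S, UC j} \<in> edges (Ubar k)" unfolding Ubar_def snd_conv by blast
    moreover have "X = g ` {UA i, UB S, UC j}" by (simp add: X ij g_def)
    ultimately show "X \<in> (\<lambda>e. g ` e) ` edges (Ubar k)" by blast
  qed
  ultimately have "iso3 (Ubar k) (induced (Trip H) W)"
    unfolding iso3_def induced_def fst_conv snd_conv by blast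
  with \<open>W \<subseteq> _\<close> assms(2) show ?thesis unfolding Trip_omits_def by blast
qed

fun trip_class :: "'a trip_vertex \<Rightarrow> nat" where
  "trip_class (TX u) = 0" | "trip_class (TY u) = 1" | "trip_class (TZ u) = 2"

fun trip_val :: "'a trip_vertex \<Rightarrow> 'a" where
  "trip_val (TX u) = u" | "trip_val (TY u) = u" | "trip_val (TZ u) = u"

text \<open>A form of adjacency that does not depend on the order of the vertices: an isomorphism
  from \<open>Ubar k\<close> may permute the classes, so it is not known in advance which image lies
  in which copy.\<close>

lemma Trip_edge_iff:
  "{p, q, r} \<in> edges (Trip H) \<longleftrightarrow>
     trip_class p \<noteq> trip_class q \<and> trip_class p \<noteq> trip_class r \<and> trip_class q \<noteq> trip_class r \<and>
     {trip_val p, trip_val q, trip_val r} \<in> edges H" (is "?L \<longleftrightarrow> ?R")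
proof
  assume ?L
  then obtain u v w where X: "{p, q, r} = {TX u, TY v, TZ w}" "{u, v, w} \<in> edges H"
    by (auto simp: Trip_def)
  have "trip_val ` {p, q, r} = {u, v, w}" "trip_class ` {p, q, r} = {0, 1, 2}"
    unfolding X(1) by simp_all
  then have *: "{trip_val p, trip_val q, trip_val r} = {u, v, w}"
    "{trip_class p, trip_class q, trip_class r} = {0, 1, 2}" by simp_all
  have "card {trip_class p, trip_class q, trip_class r} = 3" unfolding *(2) by simp
  then have "trip_class p \<noteq> trip_class q \<and> trip_class p \<noteq> trip_class r \<and> trip_class q \<noteq> trip_class r"
    by (auto simp: card_insert_if split: if_splits)
  with X(2) *(1) show ?R by simp
next
  assume R: ?R
  have main: "{p, q, r} \<in> edges (Trip H)"
    if h: "{trip_val p, trip_val q, trip_val r} \<in> edges H"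
      "trip_class p = 0" "trip_class q = 1" "trip_class r = 2" for p q r
  proof -
    obtain u v w where "p = TX u" "q = TY v" "r = TZ w"
      by (cases p; cases q; cases r) (use h in simp_all)
    then show ?thesis using that by (auto simp: Trip_def)
  qed
  have c: "{p, r, q} = {p, q, r}"
    "{q, p, r} = {p, q, r}"
    "{q, r, p} = {p, q, r}"
    "{r, p, q} = {p, q, r}"
    "{r, q, p} = {p, q, r}"
    "{trip_val p, trip_val r, trip_val q} = {trip_val p, trip_val q, trip_val r}"
    "{trip_val q, trip_val p, trip_val r} = {trip_val p, trip_val q, trip_val r}"
    "{trip_val q, trip_val r, trip_val p} = {trip_val p, trip_val q, trip_val r}"
    "{trip_val r, trip_val p, trip_val q} = {trip_val p, trip_val q, trip_val r}"
    "{trip_val r, trip_val q, trip_val p} = {trip_val p, trip_val q, trip_val r}"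
    by auto
  have less: "trip_class s = 0 \<or> trip_class s = 1 \<or> trip_class s = 2" for s :: "'a trip_vertex"
    by (cases s) simp_all
  show ?L
    using R less[of p] less[of q] less[of r] main[of p q r]
      main[of p r q, unfolded c]
      main[of q p r, unfolded c]
      main[of q r p, unfolded c]
      main[of r p q, unfolded c]
      main[of r q p, unfolded c]
    by argo
qed

lemma trip_eqI: "trip_class p = trip_class q \<Longrightarrow> trip_val p = trip_val q \<Longrightarrow> p = q"
  by (cases p; cases q) auto

lemma three_classes:
  fixes a b c :: nat
  assumes "a < 3" "b < 3" "c < 3" "d < 3" "a \<noteq> b" "a \<noteq> c" "b \<noteq> c" "d \<noteq> b" "d \<noteq> c"
  shows "d = a"
  using assms unfolding numeral_3_eq_3 less_Suc_eq by auto

lemma trip_class_less: "trip_class p < 3" by (cases p) auto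

text \<open>The vertex \<open>UB {}\<close> is isolated, so an isomorphism may place it in any of the three classes;
  passing from \<open>Suc k\<close> to \<open>k\<close> avoids it.\<close>

lemma not_omits_imp_ubar_config:
  assumes "\<not> Trip_omits \<H> (Ubar (Suc k))"
  obtains H where "H \<in> \<H>" "ubar_config H k"
proof -
  let ?K = "Suc k" and ?full = "{1..Suc k}"
  obtain H W g where H: "H \<in> \<H>" and W: "W \<subseteq> verts (Trip H)"
    and g: "bij_betw g (verts (Ubar ?K)) W"
    and ge: "(\<lambda>e. g ` e) ` edges (Ubar ?K) = {e \<in> edges (Trip H). e \<subseteq> W}"
    using assms by (auto simp: Trip_omits_def iso3_def induced_def)
  have inj: "inj_on g (verts (Ubar ?K))" and gW: "g ` verts (Ubar ?K) = W"
    using g by (auto simp: bij_betw_def)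
  have E: "{g (UA i), g (UB S), g (UC j)} \<in> edges (Trip H) \<longleftrightarrow> j \<in> S"
    if ijS: "i \<in> ?full" "S \<subseteq> ?full" "j \<in> ?full" for i j S
  proof -
    have v: "{UA i, UB S, UC j} \<subseteq> verts (Ubar ?K)" using ijS by (auto simp: Ubar_def)
    then have "g ` {UA i, UB S, UC j} \<subseteq> W" using gW by blast
    then have "{g (UA i), g (UB S), g (UC j)} \<in> edges (Trip H) \<longleftrightarrow>
       g ` {UA i, UB S, UC j} \<in> (\<lambda>e. g ` e) ` edges (Ubar ?K)"
      unfolding ge by simp
    also have "\<dots> \<longleftrightarrow> {UA i, UB S, UC j} \<in> edges (Ubar ?K)"
    proof -
      have "edges (Ubar ?K) \<subseteq> Pow (verts (Ubar ?K))" by (auto simp: Ubar_def)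
      then show ?thesis using v by (intro inj_on_image_mem_iff[OF inj_on_image_Pow[OF inj]]) auto
    qed
    also have "\<dots> \<longleftrightarrow> j \<in> S" using ijS by (auto simp: Ubar_def doubleton_eq_iff insert_eq_iff)
    finally show ?thesis .
  qed
  have V: "trip_val (g u) \<in> verts H" if "u \<in> verts (Ubar ?K)" for u
    using that gW W by (cases "g u") (force simp: Trip_def)+
  \<comment> \<open>\<open>UB ?full\<close> lies on an edge with every pair \<open>UA i\<close>,
    \<open>UC j\<close>. Since an edge meets each copy once and there are three copies, all
    \<open>UA i\<close> share one class and all \<open>UC j\<close> share another.\<close>
  define A B C where "A = trip_class (g (UA 1))" and "B = trip_class (g (UB ?full))"
    and "C = trip_class (g (UC 1))"
  have AC: "trip_class (g (UA i)) \<noteq> trip_class (g (UB ?full))"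
    "trip_class (g (UA i)) \<noteq> trip_class (g (UC j))"
    "trip_class (g (UB ?full)) \<noteq> trip_class (g (UC j))"
    if "i \<in> ?full" "j \<in> ?full" for i j
    using E[of i ?full j] that by (auto simp: Trip_edge_iff)
  have one: "1 \<in> ?full" by simp
  have A: "trip_class (g (UA i)) = A" if "i \<in> ?full" for i
    unfolding A_def
    by (rule three_classes[of _ B C]) (use AC[OF that one] AC[OF one one] in
        \<open>auto simp: trip_class_less B_def C_def\<close>)
  have C: "trip_class (g (UC i)) = C" if "i \<in> ?full" for i
    unfolding C_def
    by (rule three_classes[of _ B A]) (use AC[OF one that] AC[OF one one] in
        \<open>auto simp: trip_class_less A_def B_def\<close>)
  have ABC: "A \<noteq> B" "A \<noteq> C" "B \<noteq> C" using AC[OF one one] by (auto simp: A_def B_def C_def)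
  have B: "trip_class (g (UB S)) = B" if "S \<subseteq> ?full" "j \<in> S" for S j
  proof (rule three_classes[of _ A C])
    have "{g (UA 1), g (UB S), g (UC j)} \<in> edges (Trip H)" using E[of 1 S j] that by auto
    then show "trip_class (g (UB S)) \<noteq> A" "trip_class (g (UB S)) \<noteq> C"
      using that C[of j] by (auto simp: Trip_edge_iff A_def)
  qed (use ABC in \<open>auto simp: trip_class_less A_def B_def C_def\<close>)
  \<comment> \<open>Adding \<open>?K\<close> to \<open>S\<close> makes the set nonempty, so that the
    class of its vertex is known, and leaves its trace on \<open>{1..k}\<close> unchanged.\<close>
  have val: "{trip_val (g (UA i)), trip_val (g (UB (insert ?K S))), trip_val (g (UC j))} \<in> edges H \<longleftrightarrow> j \<in> S"
    if "i \<in> {1..k}" "S \<subseteq> {1..k}" "j \<in> {1..k}" for i S j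
  proof -
    have S: "insert ?K S \<subseteq> ?full" using that by auto
    have ij: "i \<in> ?full" "j \<in> ?full" "j \<noteq> ?K" using that by auto
    have "j \<in> S \<longleftrightarrow> {g (UA i), g (UB (insert ?K S)), g (UC j)} \<in> edges (Trip H)"
      using E[OF ij(1) S ij(2)] ij(3) by simp
    also have "\<dots> \<longleftrightarrow> {trip_val (g (UA i)), trip_val (g (UB (insert ?K S))), trip_val (g (UC j))} \<in> edges H"
      using A[OF ij(1)] C[OF ij(2)] B[OF S, of ?K] ABC by (simp add: Trip_edge_iff)
    finally show ?thesis by simp
  qed
  have "inj_on (\<lambda>i. trip_val (g (UA i))) {1..k}"
  proof (rule inj_onI)
    fix i j assume ij: "i \<in> {1..k}" "j \<in> {1..k}" "trip_val (g (UA i)) = trip_val (g (UA j))"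
    then have "g (UA i) = g (UA j)" using A by (intro trip_eqI) auto
    moreover have "UA i \<in> verts (Ubar ?K)" "UA j \<in> verts (Ubar ?K)"
      using ij by (auto simp: Ubar_def)
    ultimately show "i = j" using inj by (metis inj_onD ubar_vertex.inject(1))
  qed
  moreover have "(\<lambda>i. trip_val (g (UA i))) ` {1..k} \<subseteq> verts H"
    "(\<lambda>S. trip_val (g (UB (insert ?K S)))) ` Pow {1..k} \<subseteq> verts H"
    "(\<lambda>i. trip_val (g (UC i))) ` {1..k} \<subseteq> verts H"
    by (auto intro!: V simp: Ubar_def) (force intro!: imageI)+
  ultimately have "ubar_config H k"
    unfolding ubar_config_def using val
    by (intro exI[of _ "\<lambda>i. trip_val (g (UA i))"] exI[of _ "\<lambda>S. trip_val (g (UB (insert ?K S)))"]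
        exI[of _ "\<lambda>i. trip_val (g (UC i))"] conjI) auto
  with H that show thesis by blast
qed

section \<open>Configurations and slicewise shattering\<close>

lemma ubar_config_imp_slice_shatters:
  assumes "k \<ge> 1" "ubar_config H k"
  shows "slice_shatters H k"
proof -
  obtain a b c where V: "a ` {1..k} \<subseteq> verts H" "b ` Pow {1..k} \<subseteq> verts H" "c ` {1..k} \<subseteq> verts H"
    and e: "\<forall>i\<in>{1..k}. \<forall>S\<subseteq>{1..k}. \<forall>j\<in>{1..k}. {a i, b S, c j} \<in> edges H \<longleftrightarrow> j \<in> S"
    using assms(2) unfolding ubar_config_def by (elim exE conjE) (rule that)
  have 1: "1 \<in> {1..k}" using assms(1) by simp
  have "\<forall>i\<in>{1..k}. \<forall>S\<subseteq>{1..k}. {a 1, c i, b S} \<in> edges H \<longleftrightarrow> i \<in> S"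
  proof (intro ballI allI impI)
    fix i S assume "i \<in> {1..k}" "S \<subseteq> {1..k}"
    with e 1 have "{a 1, b S, c i} \<in> edges H \<longleftrightarrow> i \<in> S" by blast
    then show "{a 1, c i, b S} \<in> edges H \<longleftrightarrow> i \<in> S" by (simp add: insert_commute)
  qed
  moreover have "a 1 \<in> verts H" using V 1 by blast
  moreover have "\<forall>i\<in>{1..k}. c i \<in> verts H" "\<forall>S\<subseteq>{1..k}. b S \<in> verts H" using V by blast+
  ultimately show ?thesis unfolding slice_shatters_def by (intro bexI exI conjI)
qed

text \<open>On naturals \<open>Sup\<close> is informative only for bounded sets, and finiteness of
  \<open>H\<close> provides the bound. If nothing is shattered, the supremum is 0 and both sides
  hold.\<close>

lemma SVC_le_iff:
  assumes "finite (verts H)"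
  shows "SVC H \<le> k \<longleftrightarrow> (\<forall>l. slice_shatters H l \<longrightarrow> l \<le> k)"
proof -
  let ?X = "{l. slice_shatters H l}"
  have "bdd_above ?X"
    using slice_shatters_le_card[OF assms] unfolding bdd_above_def by blast
  then show ?thesis
    unfolding SVC_def
    by (cases "?X = {}") (auto simp: cSup_le_iff Sup_nat_empty simp del: Collect_empty_eq)
qed

section \<open>Covering slices by few neighbourhoods\<close>

definition shatters :: "'a set set \<Rightarrow> 'a set \<Rightarrow> bool" where
  "shatters \<A> B \<longleftrightarrow> (\<forall>S\<subseteq>B. \<exists>A\<in>\<A>. A \<inter> B = S)"

lemma shatters_mono: "shatters \<A> B \<Longrightarrow> \<A> \<subseteq> \<A>' \<Longrightarrow> shatters \<A>' B"
  unfolding shatters_def by (meson subsetD)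

lemma shattersD: "shatters \<A> B \<Longrightarrow> S \<subseteq> B \<Longrightarrow> \<exists>A\<in>\<A>. A \<inter> B = S"
  by (simp add: shatters_def)

lemma shattersI: "(\<And>S. S \<subseteq> B \<Longrightarrow> \<exists>A\<in>\<A>. A \<inter> B = S) \<Longrightarrow> shatters \<A> B"
  by (simp add: shatters_def)

text \<open>Pajor's form of the Sauer--Shelah lemma. Split the family by membership of
  \<open>x\<close>. A set shattered by either half is shattered by the whole family, and a set
  \<open>B\<close> shattered by both halves yields \<open>insert x B\<close> as well, so nothing is
  lost when the two counts are added.\<close>

lemma card_le_card_shattered:
  assumes "finite X" "\<A> \<subseteq> Pow X"
  shows "card \<A> \<le> card {B \<in> Pow X. shatters \<A> B}"
  using assms
proof (induction X arbitrary: \<A> rule: finite_induct)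
  case empty
  show ?case
  proof (cases "\<A> = {}")
    case False
    with empty have "\<A> = {{}}" by auto
    then have "{B \<in> Pow {}. shatters \<A> B} = {{}}" by (auto simp: shatters_def)
    with \<open>\<A> = {{}}\<close> show ?thesis by simp
  qed simp
next
  case (insert x X)
  define A0 where "A0 = {A \<in> \<A>. x \<notin> A}"
  define A1 where "A1 = (\<lambda>A. A - {x}) ` {A \<in> \<A>. x \<in> A}"
  define S0 where "S0 = {B \<in> Pow X. shatters A0 B}"
  define S1 where "S1 = {B \<in> Pow X. shatters A1 B}"
  have sub: "A0 \<subseteq> Pow X" "A1 \<subseteq> Pow X" using insert.prems by (auto simp: A0_def A1_def)
  have fin: "finite S0" "finite S1" using insert.hyps by (auto simp: S0_def S1_def)
  have "finite \<A>" using insert.prems insert.hyps by (meson finite.insertI finite_Pow_iff finite_subset)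
  have "card \<A> = card (A0 \<union> {A \<in> \<A>. x \<in> A})" by (rule arg_cong[where f = card]) (auto simp: A0_def)
  also have "\<dots> = card A0 + card {A \<in> \<A>. x \<in> A}"
    using \<open>finite \<A>\<close> by (intro card_Un_disjoint) (auto simp: A0_def)
  also have "card {A \<in> \<A>. x \<in> A} = card A1"
    unfolding A1_def by (rule card_image[symmetric]) (auto simp: inj_on_def)
  also have "card A0 + card A1 \<le> card S0 + card S1"
    using insert.IH[OF sub(1)] insert.IH[OF sub(2)] by (simp add: S0_def S1_def)
  also have "\<dots> = card (S0 \<union> S1) + card (S0 \<inter> S1)"
    using fin by (rule card_Un_Int)
  also have "card (S0 \<inter> S1) = card (insert x ` (S0 \<inter> S1))"
  proof (rule card_image[symmetric], rule inj_onI)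
    fix B C assume *: "B \<in> S0 \<inter> S1" "C \<in> S0 \<inter> S1" "insert x B = insert x C"
    then have "x \<notin> B" "x \<notin> C" using insert.hyps by (auto simp: S0_def)
    with * show "B = C" by (metis insert_ident)
  qed
  also have "card (S0 \<union> S1) + card (insert x ` (S0 \<inter> S1)) = card (S0 \<union> S1 \<union> insert x ` (S0 \<inter> S1))"
    using fin insert.hyps by (intro card_Un_disjoint[symmetric]) (auto simp: S0_def S1_def)
  also have "\<dots> \<le> card {B \<in> Pow (insert x X). shatters \<A> B}"
  proof (rule card_mono)
    show "finite {B \<in> Pow (insert x X). shatters \<A> B}" using insert.hyps by auto
    have 0: "B \<in> {B \<in> Pow (insert x X). shatters \<A> B}" if "B \<in> S0" for B
    proof -
      have B: "shatters A0 B" "B \<subseteq> X" using that by (auto simp: S0_def)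
      have "A0 \<subseteq> \<A>" by (auto simp: A0_def)
      with B(1) have "shatters \<A> B" by (rule shatters_mono)
      with B(2) show ?thesis by (simp add: subset_insertI2)
    qed
    have A1: "\<exists>A\<in>\<A>. x \<in> A \<and> A \<inter> B = S" if BS: "B \<in> S1" "S \<subseteq> B" for B S
    proof -
      have B: "shatters A1 B" "B \<subseteq> X" using BS by (auto simp: S1_def)
      then obtain A where "A \<in> A1" "A \<inter> B = S" using shattersD[OF B(1) BS(2)] by blast
      then obtain A' where "A' \<in> \<A>" "x \<in> A'" "A = A' - {x}" unfolding A1_def by blast
      moreover have "x \<notin> B" using B insert.hyps by blast
      ultimately show ?thesis using \<open>A \<inter> B = S\<close> by blast
    qed
    have 1: "B \<in> {B \<in> Pow (insert x X). shatters \<A> B}" if "B \<in> S1" for B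
    proof -
      have "B \<subseteq> X" using that by (auto simp: S1_def)
      moreover have "shatters \<A> B" by (rule shattersI) (use A1[OF that] in blast)
      ultimately show ?thesis by (simp add: subset_insertI2)
    qed
    have 2: "insert x B \<in> {B \<in> Pow (insert x X). shatters \<A> B}" if B: "B \<in> S0 \<inter> S1" for B
    proof -
      have BX: "B \<subseteq> X" and sh0: "shatters A0 B" using B by (auto simp: S0_def)
      have xB: "x \<notin> B" using BX insert.hyps by blast
      have "\<exists>A\<in>\<A>. A \<inter> insert x B = S" if S: "S \<subseteq> insert x B" for S
      proof (cases "x \<in> S")
        case True
        have "S - {x} \<subseteq> B" using S by blast
        then obtain A where "A \<in> \<A>" "x \<in> A" "A \<inter> B = S - {x}" using A1[of B "S - {x}"] B by blast
        then have "A \<inter> insert x B = S" using True by blast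
        with \<open>A \<in> \<A>\<close> show ?thesis by blast
      next
        case False
        then have "S \<subseteq> B" using S by blast
        then obtain A where "A \<in> A0" "A \<inter> B = S" using shattersD[OF sh0] by blast
        then have "A \<in> \<A>" "A \<inter> insert x B = S" unfolding A0_def by auto
        then show ?thesis by blast
      qed
      then have "shatters \<A> (insert x B)" by (rule shattersI)
      with BX show ?thesis by auto
    qed
    show "S0 \<union> S1 \<union> insert x ` (S0 \<inter> S1) \<subseteq> {B \<in> Pow (insert x X). shatters \<A> B}"
      using 0 1 2 by blast
  qed
  finally show ?case .
qed

text \<open>A set with fewer than \<open>k\<close> elements is a list of length \<open>k\<close>
  over \<open>{..K}\<close>, padded with the blank symbol \<open>K\<close>.\<close>

lemma card_small_subsets_le: "card {B. B \<subseteq> {..<K :: nat} \<and> card B < k} \<le> (K + 1) ^ k"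
proof -
  let ?L = "{zs. set zs \<subseteq> {..K} \<and> length zs = k}"
  have "{B. B \<subseteq> {..<K} \<and> card B < k} \<subseteq> (\<lambda>zs. set zs - {K}) ` ?L"
  proof
    fix B assume "B \<in> {B. B \<subseteq> {..<K} \<and> card B < k}"
    then have B: "B \<subseteq> {..<K}" "card B < k" by auto
    then obtain zs where zs: "set zs = B" "distinct zs"
      using finite_distinct_list[of B] finite_subset[of B "{..<K}"] by auto
    then have "length zs < k" using B(2) distinct_card by fastforce
    then have "zs @ replicate (k - length zs) K \<in> ?L" "set (zs @ replicate (k - length zs) K) - {K} = B"
      using zs B(1) by auto
    then show "B \<in> (\<lambda>zs. set zs - {K}) ` ?L" by blast
  qed
  then have "card {B. B \<subseteq> {..<K} \<and> card B < k} \<le> card ?L"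
    by (rule surj_card_le[rotated]) (simp add: finite_lists_length_eq)
  also have "card ?L = (K + 1) ^ k" by (subst card_lists_length_eq) auto
  finally show ?thesis .
qed

text \<open>Greedy packing: as long as at most \<open>m\<close> points are chosen they fail to
  cover, so more than \<open>r\<close> points are far from all of them. Lists are counted instead of
  sets because each extension then multiplies the count by at least \<open>r\<close>. The same
  \<open>r\<close> serves as distance and as number of exceptions; both will be
  \<open>\<delta> * n\<close>.\<close>

lemma separated_lists_card_ge:
  fixes D :: "'a \<Rightarrow> 'a \<Rightarrow> nat" and r :: real
  assumes "finite V" "r \<ge> 0"
    and no_cover: "\<And>X. X \<subseteq> V \<Longrightarrow> card X \<le> m \<Longrightarrow> r < card {x \<in> V. \<forall>x'\<in>X. r < D x x'}"
  shows "L \<le> Suc m \<Longrightarrow> r ^ L \<le> card {xs. set xs \<subseteq> V \<and> length xs = L \<and> sorted_wrt (\<lambda>x x'. r < D x x') xs}"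
proof (induction L)
  case 0
  have "{xs. set xs \<subseteq> V \<and> length xs = 0 \<and> sorted_wrt (\<lambda>x x'. r < D x x') xs} = {[]}" by auto
  then show ?case by simp
next
  case (Suc L)
  let ?S = "\<lambda>L. {xs. set xs \<subseteq> V \<and> length xs = L \<and> sorted_wrt (\<lambda>x x'. r < D x x') xs}"
  let ?far = "\<lambda>xs. {x \<in> V. \<forall>x'\<in>set xs. r < D x x'}"
  have fin: "finite (?S L)" for L
    by (rule finite_subset[OF _ finite_lists_length_eq[OF assms(1), of L]]) auto
  have eq: "(\<lambda>(xs, x). x # xs) ` (SIGMA xs:?S L. ?far xs) = ?S (Suc L)"
  proof (intro equalityI subsetI)
    fix ys assume "ys \<in> ?S (Suc L)"
    then obtain x xs where "ys = x # xs" by (cases ys) auto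
    with \<open>ys \<in> _\<close> have "(xs, x) \<in> (SIGMA xs:?S L. ?far xs)" by auto
    with \<open>ys = _\<close> show "ys \<in> (\<lambda>(xs, x). x # xs) ` (SIGMA xs:?S L. ?far xs)" by force
  qed auto
  have "r ^ Suc L = r ^ L * r" by simp
  also have "\<dots> \<le> card (?S L) * r" using Suc assms(2) by (intro mult_right_mono) auto
  also have "\<dots> = (\<Sum>xs\<in>?S L. r)" by simp
  also have "\<dots> \<le> (\<Sum>xs\<in>?S L. real (card (?far xs)))"
  proof (rule sum_mono)
    fix xs assume "xs \<in> ?S L"
    then have "card (set xs) \<le> m" "set xs \<subseteq> V" using Suc.prems card_length[of xs] by auto
    then show "r \<le> card (?far xs)" using no_cover[of "set xs"] by linarith
  qed
  also have "\<dots> = card (SIGMA xs:?S L. ?far xs)"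
    using fin assms(1) by (subst card_SigmaI) auto
  also have "\<dots> = card (?S (Suc L))"
    unfolding eq[symmetric] by (subst card_image) (auto simp: inj_on_def)
  finally show ?case .
qed

text \<open>Union bound: \<open>K\<close> uniform samples all miss the difference set of a given
  pair of rows with probability at most \<open>(1 - \<delta>) ^ K\<close>, and there are at most
  \<open>M ^ 2\<close> pairs. So at least half of all sample lists separate every pair.\<close>

lemma distinguishing_lists_card_ge:
  fixes R :: "'a \<Rightarrow> 'a \<Rightarrow> bool" and \<delta> :: real
  assumes "finite V" "0 \<le> \<delta>" "\<delta> \<le> 1" "real M ^ 2 * (1 - \<delta>) ^ K \<le> 1 / 2"
    and xs: "length xs = M"
      "sorted_wrt (\<lambda>x x'. \<delta> * card V < card {y \<in> V. R x y \<noteq> R x' y}) xs"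
  shows "real (card V) ^ K / 2 \<le> card {ys. set ys \<subseteq> V \<and> length ys = K \<and>
           (\<forall>j<M. \<forall>i<j. \<exists>y\<in>set ys. R (xs ! i) y \<noteq> R (xs ! j) y)}"
proof -
  let ?n = "real (card V)"
  let ?L = "\<lambda>U. {ys. set ys \<subseteq> U \<and> length ys = K}"
  let ?same = "\<lambda>i j. {y \<in> V. R (xs ! i) y = R (xs ! j) y}"
  define Good where "Good = {ys. set ys \<subseteq> V \<and> length ys = K \<and>
           (\<forall>j<M. \<forall>i<j. \<exists>y\<in>set ys. R (xs ! i) y \<noteq> R (xs ! j) y)}"
  define I where "I = {(i, j). j < M \<and> i < j}"
  have I: "I \<subseteq> {..<M} \<times> {..<M}" by (auto simp: I_def)
  then have finI: "finite I" by (rule finite_subset) simp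
  have finL: "finite (?L U)" if "U \<subseteq> V" for U
    using finite_lists_length_eq[of U K] assms(1) that finite_subset by auto
  have cover: "?L V \<subseteq> Good \<union> (\<Union>(i, j)\<in>I. ?L (?same i j))"
    by (fastforce simp: Good_def I_def)
  have same: "card (?L (?same i j)) \<le> ((1 - \<delta>) * ?n) ^ K" if "(i, j) \<in> I" for i j
  proof -
    have "\<delta> * card V < card {y \<in> V. R (xs ! i) y \<noteq> R (xs ! j) y}"
      using that xs sorted_wrt_nth_less[OF xs(2), of i j] by (auto simp: I_def)
    moreover have "card V = card (?same i j) + card {y \<in> V. R (xs ! i) y \<noteq> R (xs ! j) y}"
      using assms(1) by (subst card_Un_disjoint[symmetric]) (auto intro: arg_cong[where f = card])
    ultimately have "real (card (?same i j)) \<le> (1 - \<delta>) * ?n" by (simp add: algebra_simps)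
    then have "real (card (?same i j)) ^ K \<le> ((1 - \<delta>) * ?n) ^ K" by (intro power_mono) auto
    then show ?thesis using assms(1) by (subst card_lists_length_eq) auto
  qed
  have "?n ^ K = card (?L V)" using assms(1) by (subst card_lists_length_eq) auto
  also have "card (?L V) \<le> card (Good \<union> (\<Union>(i, j)\<in>I. ?L (?same i j)))"
  proof (rule card_mono[OF _ cover])
    have "Good \<union> (\<Union>(i, j)\<in>I. ?L (?same i j)) \<subseteq> ?L V" by (auto simp: Good_def)
    then show "finite (Good \<union> (\<Union>(i, j)\<in>I. ?L (?same i j)))" using finL finite_subset by blast
  qed
  also have "\<dots> \<le> card Good + card (\<Union>(i, j)\<in>I. ?L (?same i j))" by (rule card_Un_le)
  also have "card (\<Union>(i, j)\<in>I. ?L (?same i j)) \<le> (\<Sum>(i, j)\<in>I. card (?L (?same i j)))"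
    using card_UN_le[OF finI, of "\<lambda>(i, j). ?L (?same i j)"] by (simp add: case_prod_unfold)
  finally have "?n ^ K \<le> card Good + (\<Sum>(i, j)\<in>I. real (card (?L (?same i j))))"
    by (simp add: case_prod_unfold)
  also have "(\<Sum>(i, j)\<in>I. real (card (?L (?same i j)))) \<le> (\<Sum>(i, j)\<in>I. ((1 - \<delta>) * ?n) ^ K)"
    using same by (intro sum_mono) auto
  also have "\<dots> = card I * ((1 - \<delta>) * ?n) ^ K" by (simp add: case_prod_unfold)
  also have "\<dots> \<le> real M ^ 2 * ((1 - \<delta>) * ?n) ^ K"
  proof (rule mult_right_mono)
    have "card I \<le> M ^ 2"
      using card_mono[OF _ I] by (simp add: card_cartesian_product power2_eq_square)
    then have "real (card I) \<le> real (M ^ 2)" by (simp only: of_nat_le_iff)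
    then show "real (card I) \<le> real M ^ 2" by simp
  qed (use assms(3) in auto)
  also have "\<dots> = real M ^ 2 * (1 - \<delta>) ^ K * ?n ^ K" by (simp add: power_mult_distrib)
  also have "\<dots> \<le> 1 / 2 * ?n ^ K" using assms(4) by (intro mult_right_mono) auto
  finally show ?thesis unfolding Good_def by simp
qed

text \<open>The \<open>M\<close> rows have distinct traces on the samples, hence shatter at least
  \<open>M\<close> index sets, more than there are sets with fewer than \<open>k\<close> elements.
  The witnesses are positions in the lists, not vertices: their number is bounded independently of
  the graph, so they can be made part of a sample over which one averages.\<close>

lemma shattered_indices:
  fixes R :: "'a \<Rightarrow> 'a \<Rightarrow> bool"
  assumes "length ys = K" "(K + 1) ^ k < M"
    and dist: "\<forall>j<M. \<forall>i<j. \<exists>y\<in>set ys. R (xs ! i) y \<noteq> R (xs ! j) y"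
  shows "\<exists>\<beta>\<in>Pow {1..k} \<rightarrow>\<^sub>E {..<M}. \<exists>\<gamma>\<in>{1..k} \<rightarrow>\<^sub>E {..<K}.
           \<forall>S\<subseteq>{1..k}. \<forall>j\<in>{1..k}. R (xs ! \<beta> S) (ys ! \<gamma> j) \<longleftrightarrow> j \<in> S"
proof -
  define A where "A = (\<lambda>i. {l \<in> {..<K}. R (xs ! i) (ys ! l)})"
  have A_neq: "A i \<noteq> A j" if "i < j" "j < M" for i j
  proof -
    from dist that obtain y where "y \<in> set ys" "R (xs ! i) y \<noteq> R (xs ! j) y" by blast
    then obtain l where "l < K" "R (xs ! i) (ys ! l) \<noteq> R (xs ! j) (ys ! l)"
      using assms(1) by (auto simp: in_set_conv_nth)
    then show ?thesis unfolding A_def by blast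
  qed
  have "inj_on A {..<M}"
    using A_neq by (intro inj_onI) (metis lessThan_iff linorder_neqE_nat)
  then have "M = card (A ` {..<M})" by (simp add: card_image)
  also have "\<dots> \<le> card {B \<in> Pow {..<K}. shatters (A ` {..<M}) B}"
    by (rule card_le_card_shattered) (auto simp: A_def)
  finally have "\<not> {B \<in> Pow {..<K}. shatters (A ` {..<M}) B} \<subseteq> {B. B \<subseteq> {..<K} \<and> card B < k}"
    using card_small_subsets_le[of K k] assms(2)
      card_mono[of "{B. B \<subseteq> {..<K} \<and> card B < k}" "{B \<in> Pow {..<K}. shatters (A ` {..<M}) B}"]
    by fastforce
  then obtain B where "B \<in> {B \<in> Pow {..<K}. shatters (A ` {..<M}) B}" "B \<notin> {B. B \<subseteq> {..<K} \<and> card B < k}"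
    by blast
  then have B: "B \<subseteq> {..<K}" "shatters (A ` {..<M}) B" "card B \<ge> k" by auto
  have "finite B" using B(1) finite_subset by blast
  then obtain \<gamma> where \<gamma>: "\<gamma> ` {1..k} \<subseteq> B" "inj_on \<gamma> {1..k}"
    using B(3) card_le_inj[of "{1..k}" B] by auto
  have "\<exists>i<M. A i \<inter> B = \<gamma> ` S" if "S \<subseteq> {1..k}" for S
  proof -
    have "\<gamma> ` S \<subseteq> B" using that \<gamma> by blast
    then show ?thesis using shattersD[OF B(2), of "\<gamma> ` S"] by auto
  qed
  then obtain \<beta> where \<beta>: "\<And>S. S \<subseteq> {1..k} \<Longrightarrow> \<beta> S < M \<and> A (\<beta> S) \<inter> B = \<gamma> ` S" by metis
  have "R (xs ! \<beta> S) (ys ! \<gamma> j) \<longleftrightarrow> j \<in> S" if S: "S \<subseteq> {1..k}" and j: "j \<in> {1..k}" for S j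
  proof -
    have "\<gamma> j \<in> B" using \<gamma>(1) j by blast
    moreover from this have "\<gamma> j < K" using B(1) by blast
    ultimately have "R (xs ! \<beta> S) (ys ! \<gamma> j) \<longleftrightarrow> \<gamma> j \<in> A (\<beta> S) \<inter> B" by (auto simp: A_def)
    also have "\<dots> \<longleftrightarrow> \<gamma> j \<in> \<gamma> ` S" using \<beta>[OF S] by simp
    also have "\<dots> \<longleftrightarrow> j \<in> S" using \<gamma>(2) j S by (rule inj_on_image_mem_iff)
    finally show ?thesis .
  qed
  moreover have "restrict \<beta> (Pow {1..k}) \<in> Pow {1..k} \<rightarrow>\<^sub>E {..<M}" using \<beta> by auto
  moreover have "restrict \<gamma> {1..k} \<in> {1..k} \<rightarrow>\<^sub>E {..<K}" using \<gamma>(1) B(1) by auto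
  ultimately show ?thesis
    by (intro bexI[of _ "restrict \<beta> (Pow {1..k})"] bexI[of _ "restrict \<gamma> {1..k}"]) auto
qed

section \<open>Averaging and the choice of the sample size\<close>

lemma sum_card_swap:
  assumes "finite Z" "finite W"
  shows "(\<Sum>w\<in>W. card {z \<in> Z. P z w}) = (\<Sum>z\<in>Z. card {w \<in> W. P z w})"
proof -
  have "(\<Sum>w\<in>W. card {z \<in> Z. P z w}) = (\<Sum>w\<in>W. \<Sum>z\<in>Z. if P z w then 1 else 0)"
    using assms by (simp add: sum.If_cases Int_def)
  also have "\<dots> = (\<Sum>z\<in>Z. \<Sum>w\<in>W. if P z w then 1 else 0)" by (rule sum.swap)
  also have "\<dots> = (\<Sum>z\<in>Z. card {w \<in> W. P z w})"
    using assms by (simp add: sum.If_cases Int_def)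
  finally show ?thesis .
qed

text \<open>Double counting of incidences. It picks one sample that works for many slices in
  \<open>slice_cover\<close>, and one partial embedding with many extensions in
  \<open>positive_part_not_slice_shatters\<close>.\<close>

lemma popular_element:
  fixes \<eta> :: real
  assumes "finite Z" "finite W" "W \<noteq> {}"
    and "\<And>z. z \<in> Z \<Longrightarrow> \<eta> * card W \<le> card {w \<in> W. P z w}"
  obtains w where "w \<in> W" "\<eta> * card Z \<le> card {z \<in> Z. P z w}"
proof (rule ccontr)
  assume "\<not> thesis"
  with that have "card {z \<in> Z. P z w} < \<eta> * card Z" if "w \<in> W" for w using \<open>w \<in> W\<close> by force
  then have "(\<Sum>w\<in>W. real (card {z \<in> Z. P z w})) < (\<Sum>w\<in>W. \<eta> * card Z)"
    using assms by (intro sum_strict_mono) auto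
  also have "\<dots> = (\<Sum>z\<in>Z. \<eta> * card W)" by simp
  also have "\<dots> \<le> (\<Sum>z\<in>Z. real (card {w \<in> W. P z w}))" using assms(4) by (rule sum_mono)
  also have "\<dots> = (\<Sum>w\<in>W. real (card {z \<in> Z. P z w}))"
    unfolding of_nat_sum[symmetric] sum_card_swap[OF assms(1,2)] ..
  finally show False by simp
qed

text \<open>The number of rows required for a shattered \<open>k\<close>-set grows polynomially in
  the number \<open>K\<close> of samples, while the probability that two rows are not separated
  decays exponentially. Both demands can therefore be met by one \<open>K\<close>.\<close>

lemma ex_sample_size:
  fixes \<delta> :: real
  assumes "0 < \<delta>" "\<delta> \<le> 1"
  shows "\<exists>K. real ((K + 1) ^ k + 1) ^ 2 * (1 - \<delta>) ^ K \<le> 1 / 2"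
proof -
  \<comment> \<open>Taking a \<open>p\<close>-th root of \<open>1 - \<delta>\<close> turns
    polynomial times exponential into the \<open>p\<close>-th power of
    \<open>(K + 1) * r ^ K\<close>, which tends to 0. The exponent dominates \<open>2 * k\<close>
    and is positive also for \<open>k = 0\<close>.\<close>
  define p where "p = 2 * k + 2"
  define r where "r = root p (1 - \<delta>)"
  have "p > 0" by (simp add: p_def)
  then have r: "0 \<le> r" "r < 1" "r ^ p = 1 - \<delta>"
    using assms by (auto simp: r_def)
  have "(\<lambda>K. of_nat K * r ^ K + r ^ K) \<longlonglongrightarrow> 0 + 0"
    using r by (intro tendsto_add powser_times_n_limit_0 LIMSEQ_power_zero) auto
  then have "(\<lambda>K. ((real K + 1) * r ^ K) ^ p) \<longlonglongrightarrow> 0 ^ p"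
    by (intro tendsto_power) (simp add: algebra_simps)
  then have "(\<lambda>K. ((real K + 1) * r ^ K) ^ p) \<longlonglongrightarrow> 0" using \<open>p > 0\<close> by (simp add: zero_power)
  then have "eventually (\<lambda>K. ((real K + 1) * r ^ K) ^ p < 1 / 8) sequentially"
    by (rule order_tendstoD) simp
  from eventually_happens'[OF sequentially_bot this]
  obtain K where K: "((real K + 1) * r ^ K) ^ p < 1 / 8" by blast
  have "(real K + 1) ^ k \<ge> 1" by (rule one_le_power) simp
  then have "((real K + 1) ^ k + 1) ^ 2 \<le> (2 * (real K + 1) ^ k) ^ 2" by (intro power_mono) auto
  also have "\<dots> = 4 * (real K + 1) ^ (2 * k)" by (simp add: power_mult_distrib power_mult[symmetric] mult.commute)
  also have "\<dots> \<le> 4 * (real K + 1) ^ p" unfolding p_def by (intro mult_left_mono power_increasing) auto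
  finally have "((real K + 1) ^ k + 1) ^ 2 * (1 - \<delta>) ^ K \<le> 4 * (real K + 1) ^ p * (1 - \<delta>) ^ K"
    using assms by (intro mult_right_mono) auto
  also have "\<dots> = 4 * ((real K + 1) * r ^ K) ^ p"
    by (simp add: r(3)[symmetric] power_mult_distrib power_mult[symmetric] mult.commute)
  finally have "((real K + 1) ^ k + 1) ^ 2 * (1 - \<delta>) ^ K \<le> 1 / 2" using K by linarith
  then show ?thesis by (intro exI[of _ K]) (simp add: add.commute)
qed

text \<open>If too many slices were not covered, each would shatter for a positive proportion of all
  samples \<open>(xs, ys)\<close>, hence many of them for the same sample.\<close>

lemma slice_cover:
  fixes \<delta> :: real
  assumes "0 < \<delta>" "\<delta> \<le> 1"
  shows "\<exists>m N. \<forall>G :: 'a graph3. finite (verts G) \<longrightarrow> \<not> ubar_config G k \<longrightarrow> N \<le> card (verts G) \<longrightarrow>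
    card {z \<in> verts G. \<forall>X. X \<subseteq> verts G \<longrightarrow> card X \<le> m \<longrightarrow> \<delta> * card (verts G) <
      card {x \<in> verts G. \<forall>x'\<in>X. \<delta> * card (verts G) <
         card {y \<in> verts G. ({x, y, z} \<in> edges G) \<noteq> ({x', y, z} \<in> edges G)}}} \<le> \<delta> * card (verts G)"
proof -
  obtain K where K: "real ((K + 1) ^ k + 1) ^ 2 * (1 - \<delta>) ^ K \<le> 1 / 2"
    using ex_sample_size[OF assms] by blast
  \<comment> \<open>Failure of all covers by \<open>m\<close> rows gives \<open>m + 1\<close>
    separated rows, one more than the bound on the number of sets of samples with fewer than
    \<open>k\<close> elements.\<close>
  define m where "m = (K + 1) ^ k"
  define B :: "(nat set \<Rightarrow> nat) set" where "B = (Pow {1..k} \<rightarrow>\<^sub>E {..<Suc m})"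
  define C :: "(nat \<Rightarrow> nat) set" where "C = ({1..k} \<rightarrow>\<^sub>E {..<K})"
  define c where "c = card (B \<times> C)"
  have finBC: "finite (B \<times> C)" unfolding B_def C_def by (intro finite_cartesian_product finite_PiE) auto
  \<comment> \<open>A bad \<open>z\<close> is witnessed by at least
    \<open>(\<delta> * n) ^ Suc m * n ^ K / 2\<close> of the \<open>n ^ Suc m * n ^ K * c\<close>
    elements of \<open>W\<close>; \<open>\<eta>\<close> is a lower bound for the quotient. The
    \<open>+ 1\<close> keeps the denominator positive when \<open>c = 0\<close>.\<close>
  define \<eta> where "\<eta> = \<delta> ^ Suc m / (2 * (real c + 1))"
  have "\<eta> > 0" using assms by (simp add: \<eta>_def add_nonneg_pos)
  \<comment> \<open>More than \<open>\<delta> * n\<close> bad slices leave at least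
    \<open>\<eta> * \<delta> * n\<close> of them at the popular sample. From this size on that is at
    least \<open>k\<close>, enough for the vertices \<open>a\<close>.\<close>
  define N where "N = Suc (nat \<lceil>real k / (\<eta> * \<delta>)\<rceil>)"
  show ?thesis
  proof (rule exI[of _ m], rule exI[of _ N], intro allI impI)
    fix G :: "'a graph3"
    assume fin: "finite (verts G)" and no: "\<not> ubar_config G k" and N: "N \<le> card (verts G)"
    define V where "V = verts G"
    define n where "n = real (card V)"
    define R where "R = (\<lambda>z x y. {x, y, z} \<in> edges G)"
    define D where "D = (\<lambda>z x x'. card {y \<in> V. R z x y \<noteq> R z x' y})"
    define Z where "Z = {z \<in> V. \<forall>X. X \<subseteq> V \<longrightarrow> card X \<le> m \<longrightarrow> \<delta> * n < card {x \<in> V. \<forall>x'\<in>X. \<delta> * n < D z x x'}}"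
    have finV: "finite V" "finite Z" using fin by (auto simp: V_def Z_def)
    have "real N \<le> n" "N > 0" using N by (auto simp: n_def V_def N_def)
    then have n0: "n > 0" by linarith
    have Vne: "V \<noteq> {}" using n0 by (auto simp: n_def)
    have "card Z \<le> \<delta> * n"
    proof (rule ccontr)
      assume "\<not> card Z \<le> \<delta> * n"
      then have Zbig: "\<delta> * n < card Z" by simp
      define XS where "XS = {xs. set xs \<subseteq> V \<and> length xs = Suc m}"
      define YS where "YS = {ys. set ys \<subseteq> V \<and> length ys = K}"
      define W where "W = (XS \<times> YS) \<times> (B \<times> C)"
      define P where "P = (\<lambda>z ((xs, ys), (\<beta>, \<gamma>)).
         \<forall>S\<subseteq>{1..k}. \<forall>j\<in>{1..k}. R z (xs ! \<beta> S) (ys ! \<gamma> j) \<longleftrightarrow> j \<in> S)"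
      have finXY: "finite XS" "finite YS"
        using finV(1) finite_lists_length_eq by (auto simp: XS_def YS_def)
      then have finW: "finite W" using finBC by (simp add: W_def)
      have cW: "card W = n ^ Suc m * n ^ K * c"
        using finV(1) card_lists_length_eq[of V "Suc m"] card_lists_length_eq[of V K]
        by (simp add: W_def XS_def YS_def n_def c_def card_cartesian_product)
      have lower: "0 < card {w \<in> W. P z w}" "\<eta> * card W \<le> card {w \<in> W. P z w}" if z: "z \<in> Z" for z
      proof -
        define Xs where "Xs = {xs. set xs \<subseteq> V \<and> length xs = Suc m \<and> sorted_wrt (\<lambda>x x'. \<delta> * n < D z x x') xs}"
        define Ys where "Ys = (\<lambda>xs. {ys. set ys \<subseteq> V \<and> length ys = K \<and>
           (\<forall>j<Suc m. \<forall>i<j. \<exists>y\<in>set ys. R z (xs ! i) y \<noteq> R z (xs ! j) y)})"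
        have Xs: "(\<delta> * n) ^ Suc m \<le> card Xs"
          unfolding Xs_def
          by (rule separated_lists_card_ge[where m = m]) (use z finV n0 assms in \<open>auto simp: Z_def\<close>)
        have Ys: "n ^ K / 2 \<le> card (Ys xs)" if "xs \<in> Xs" for xs
          unfolding Ys_def n_def
          by (rule distinguishing_lists_card_ge[where \<delta> = \<delta>])
            (use that finV assms K in \<open>auto simp: Xs_def D_def n_def m_def add.commute\<close>)
        have sub: "Xs \<subseteq> XS" "Ys xs \<subseteq> YS" for xs by (auto simp: Xs_def XS_def Ys_def YS_def)
        then have finXs: "finite Xs" "finite (Ys xs)" for xs using finXY finite_subset by blast+
        have "(SIGMA xs:Xs. Ys xs) \<subseteq> fst ` {w \<in> W. P z w}"
        proof
          fix v assume "v \<in> (SIGMA xs:Xs. Ys xs)"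
          then obtain xs ys where v: "v = (xs, ys)" "xs \<in> Xs" "ys \<in> Ys xs" by auto
          have "\<exists>\<beta>\<in>B. \<exists>\<gamma>\<in>C. \<forall>S\<subseteq>{1..k}. \<forall>j\<in>{1..k}. R z (xs ! \<beta> S) (ys ! \<gamma> j) \<longleftrightarrow> j \<in> S"
            unfolding B_def C_def
            by (rule shattered_indices) (use v in \<open>auto simp: Ys_def m_def\<close>)
          then obtain \<beta> \<gamma> where "\<beta> \<in> B" "\<gamma> \<in> C" "P z ((xs, ys), (\<beta>, \<gamma>))" unfolding P_def by auto
          then have "((xs, ys), (\<beta>, \<gamma>)) \<in> {w \<in> W. P z w}" using v sub by (auto simp: W_def)
          then show "v \<in> fst ` {w \<in> W. P z w}" using v by force
        qed
        then have "card (SIGMA xs:Xs. Ys xs) \<le> card {w \<in> W. P z w}"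
          using finW by (intro surj_card_le) auto
        moreover have "card (SIGMA xs:Xs. Ys xs) = (\<Sum>xs\<in>Xs. real (card (Ys xs)))"
          using finXs by (subst card_SigmaI) auto
        moreover have "(\<Sum>xs\<in>Xs. real (card (Ys xs))) \<ge> (\<Sum>xs\<in>Xs. n ^ K / 2)"
          using Ys by (rule sum_mono)
        moreover have "(\<Sum>xs\<in>Xs. n ^ K / 2) \<ge> (\<delta> * n) ^ Suc m * (n ^ K / 2)"
          using Xs n0 by (simp only: sum_constant) (intro mult_right_mono, auto)
        ultimately have "(\<delta> * n) ^ Suc m * (n ^ K / 2) \<le> card {w \<in> W. P z w}" by linarith
        moreover have "\<eta> * card W \<le> (\<delta> * n) ^ Suc m * (n ^ K / 2)"
        proof -
          have "\<eta> * card W = (\<delta> * n) ^ Suc m * (n ^ K / 2) * (c / (real c + 1))"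
            unfolding cW \<eta>_def power_mult_distrib by simp
          also have "\<dots> \<le> (\<delta> * n) ^ Suc m * (n ^ K / 2) * 1"
            using assms n0 by (intro mult_left_mono) (auto simp: divide_le_eq)
          finally show ?thesis by simp
        qed
        moreover have "0 < (\<delta> * n) ^ Suc m * (n ^ K / 2)" using assms n0 by simp
        ultimately show "0 < card {w \<in> W. P z w}" "\<eta> * card W \<le> card {w \<in> W. P z w}" by linarith+
      qed
      have Zne: "Z \<noteq> {}" using Zbig assms n0 by (auto simp: mult_less_0_iff)
      then have "W \<noteq> {}" using lower(1) by fastforce
      obtain w where w: "w \<in> W" "\<eta> * card Z \<le> card {z \<in> Z. P z w}"
        by (rule popular_element[where P = P, OF finV(2) finW \<open>W \<noteq> {}\<close> lower(2)])
      obtain xs ys \<beta> \<gamma> where w_eq: "w = ((xs, ys), (\<beta>, \<gamma>))" by (metis surj_pair)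
      define Z' where "Z' = {z \<in> Z. P z w}"
      have "real k / (\<eta> * \<delta>) \<le> n" using \<open>real N \<le> n\<close> unfolding N_def by linarith
      then have "real k \<le> \<eta> * (\<delta> * n)" using \<open>\<eta> > 0\<close> assms by (simp add: field_simps)
      also have "\<dots> \<le> \<eta> * card Z" using Zbig \<open>\<eta> > 0\<close> by simp
      finally have "k \<le> card Z'" using w(2) by (simp add: Z'_def)
      moreover have "finite Z'" using finV by (simp add: Z'_def)
      ultimately obtain a where a: "a ` {1..k} \<subseteq> Z'" "inj_on a {1..k}"
        using card_le_inj[of "{1..k}" Z'] by auto
      have len: "length xs = Suc m" "set xs \<subseteq> V" "length ys = K" "set ys \<subseteq> V" "\<beta> \<in> B" "\<gamma> \<in> C"
        using w(1) by (simp_all add: w_eq W_def XS_def YS_def)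
      have mem1: "xs ! \<beta> S \<in> V" if "S \<in> Pow {1..k}" for S
        using PiE_mem[OF len(5)[unfolded B_def] that] len(1,2) nth_mem by fastforce
      have mem2: "ys ! \<gamma> j \<in> V" if "j \<in> {1..k}" for j
        using PiE_mem[OF len(6)[unfolded C_def] that] len(3,4) nth_mem by fastforce
      have "ubar_config G k"
        unfolding ubar_config_def
      proof (intro exI conjI ballI allI impI)
        show "inj_on a {1..k}" by fact
        show "a ` {1..k} \<subseteq> verts G" using a(1) by (auto simp: Z'_def Z_def V_def)
        show "(\<lambda>S. xs ! \<beta> S) ` Pow {1..k} \<subseteq> verts G" using mem1 by (auto simp: V_def)
        show "(\<lambda>j. ys ! \<gamma> j) ` {1..k} \<subseteq> verts G" using mem2 by (auto simp: V_def)
        fix i S j assume ijS: "i \<in> {1..k}" "S \<subseteq> {1..k}" "j \<in> {1..k}"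
        then have "a i \<in> Z'" using a(1) by blast
        then have "P (a i) w" by (simp add: Z'_def)
        then have "R (a i) (xs ! \<beta> S) (ys ! \<gamma> j) \<longleftrightarrow> j \<in> S" using ijS unfolding P_def w_eq by auto
        then show "{a i, xs ! \<beta> S, ys ! \<gamma> j} \<in> edges G \<longleftrightarrow> j \<in> S"
          unfolding R_def using ijS by (simp add: insert_commute)
      qed
      with no show False by blast
    qed
    then show "card {z \<in> verts G. \<forall>X. X \<subseteq> verts G \<longrightarrow> card X \<le> m \<longrightarrow> \<delta> * card (verts G) <
      card {x \<in> verts G. \<forall>x'\<in>X. \<delta> * card (verts G) <
         card {y \<in> verts G. ({x, y, z} \<in> edges G) \<noteq> ({x', y, z} \<in> edges G)}}} \<le> \<delta> * card (verts G)"
      by (simp add: Z_def V_def n_def D_def R_def)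
  qed
qed

lemma sum_of_bool_eq_card: "finite A \<Longrightarrow> (\<Sum>x\<in>A. of_bool (P x) :: real) = card {x \<in> A. P x}"
  by (simp add: of_bool_def sum.If_cases Int_def)

text \<open>A covered row is replaced by a nearby row from \<open>X\<close>, at a cost of at most
  \<open>\<delta> * n\<close>; the at most \<open>\<delta> * n\<close> uncovered rows cost at most
  \<open>n\<close> each. The index range is \<open>Suc m\<close> because slots beyond
  \<open>card X\<close> are filled with a default vertex, so that an index exists even when
  \<open>X\<close> is empty.\<close>

lemma cover_imp_approximation:
  fixes R :: "'a \<Rightarrow> 'a \<Rightarrow> bool" and \<delta> :: real
  assumes "finite V" "V \<noteq> {}" "0 \<le> \<delta>" "X \<subseteq> V" "card X \<le> m"
    and ex: "card {x \<in> V. \<forall>x'\<in>X. \<delta> * card V < card {y \<in> V. R x y \<noteq> R x' y}} \<le> \<delta> * card V"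
  shows "\<exists>g h. (\<forall>i. g i \<in> V) \<and> (\<forall>x. h x < Suc m) \<and>
    (\<Sum>x\<in>V. \<Sum>y\<in>V. of_bool (R x y \<noteq> R (g (h x)) y)) \<le> 2 * \<delta> * real (card V) ^ 2"
proof -
  let ?n = "real (card V)"
  define Ex where "Ex = {x \<in> V. \<forall>x'\<in>X. \<delta> * card V < card {y \<in> V. R x y \<noteq> R x' y}}"
  obtain v where "v \<in> V" using assms(2) by blast
  have finX: "finite X" using assms(1,4) finite_subset by blast
  obtain g0 where g0: "bij_betw g0 {0..<card X} X" using ex_bij_betw_nat_finite[OF finX] by blast
  define g where "g = (\<lambda>i. if i < card X then g0 i else v)"
  have gV: "g i \<in> V" for i
    using g0 \<open>v \<in> V\<close> assms(4) by (auto simp: g_def bij_betw_def)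
  have "\<exists>i<Suc m. x \<in> V - Ex \<longrightarrow> card {y \<in> V. R x y \<noteq> R (g i) y} \<le> \<delta> * ?n" for x
  proof (cases "x \<in> V - Ex")
    case True
    then obtain x' where x': "x' \<in> X" "card {y \<in> V. R x y \<noteq> R x' y} \<le> \<delta> * ?n" by (force simp: Ex_def)
    moreover have "X = g0 ` {0..<card X}" using g0 by (simp add: bij_betw_def)
    ultimately obtain i where "i \<in> {0..<card X}" "x' = g0 i" by blast
    then have "i < Suc m" "g i = x'" using assms(5) by (auto simp: g_def)
    with x' show ?thesis by blast
  qed auto
  then obtain h where h: "\<And>x. h x < Suc m" "\<And>x. x \<in> V - Ex \<Longrightarrow> card {y \<in> V. R x y \<noteq> R (g (h x)) y} \<le> \<delta> * ?n"
    by metis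
  have "(\<Sum>x\<in>V. \<Sum>y\<in>V. of_bool (R x y \<noteq> R (g (h x)) y)) \<le> (\<Sum>x\<in>V. \<delta> * ?n + (if x \<in> Ex then ?n else 0))"
  proof (rule sum_mono)
    fix x assume "x \<in> V"
    have "card {y \<in> V. R x y \<noteq> R (g (h x)) y} \<le> card V" using assms(1) by (intro card_mono) auto
    moreover have "0 \<le> \<delta> * ?n" using assms(3) by simp
    ultimately show "(\<Sum>y\<in>V. of_bool (R x y \<noteq> R (g (h x)) y)) \<le> \<delta> * ?n + (if x \<in> Ex then ?n else 0)"
      using h(2)[of x] \<open>x \<in> V\<close> assms(1) by (auto simp: sum_of_bool_eq_card Int_def)
  qed
  also have "\<dots> = ?n * (\<delta> * ?n) + card Ex * ?n"
    using assms(1) by (simp add: sum.distrib sum.If_cases Ex_def Int_def)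
  also have "\<dots> \<le> ?n * (\<delta> * ?n) + \<delta> * ?n * ?n"
    using ex by (intro add_left_mono mult_right_mono) (auto simp: Ex_def)
  finally have "(\<Sum>x\<in>V. \<Sum>y\<in>V. of_bool (R x y \<noteq> R (g (h x)) y)) \<le> 2 * \<delta> * ?n ^ 2"
    by (simp add: power2_eq_square algebra_simps)
  with gV h(1) show ?thesis by blast
qed

text \<open>A coverable slice costs \<open>2 * \<delta> * n ^ 2\<close>; the at most
  \<open>\<delta> * n\<close> others are approximated arbitrarily and charged \<open>n ^ 2\<close>
  each. Since \<open>\<iota> z x\<close> takes at most \<open>M\<close> values, the approximant is a
  sum over \<open>j < M\<close> of the indicator of \<open>\<iota> z x = j\<close> times the
  indicator of \<open>{\<xi> z j, y, z}\<close> being an edge: products of a function of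
  \<open>(x, z)\<close> and a function of \<open>(y, z)\<close>.\<close>

lemma slice_approximation:
  fixes \<delta> :: real
  assumes "0 < \<delta>" "\<delta> \<le> 1"
  shows "\<exists>(M :: nat) N. \<forall>G :: 'a graph3. finite (verts G) \<longrightarrow> \<not> ubar_config G k \<longrightarrow> N \<le> card (verts G) \<longrightarrow>
    (\<exists>\<xi> \<iota>. (\<forall>z\<in>verts G. \<forall>i. \<xi> z i \<in> verts G) \<and> (\<forall>z\<in>verts G. \<forall>x. \<iota> z x < M) \<and>
      (\<Sum>z\<in>verts G. \<Sum>x\<in>verts G. \<Sum>y\<in>verts G.
         of_bool (({x, y, z} \<in> edges G) \<noteq> ({\<xi> z (\<iota> z x), y, z} \<in> edges G))) \<le> 3 * \<delta> * real (card (verts G)) ^ 3)"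
proof -
  obtain m N where mN: "\<And>G :: 'a graph3. finite (verts G) \<Longrightarrow> \<not> ubar_config G k \<Longrightarrow> N \<le> card (verts G) \<Longrightarrow>
    card {z \<in> verts G. \<forall>X. X \<subseteq> verts G \<longrightarrow> card X \<le> m \<longrightarrow> \<delta> * card (verts G) <
      card {x \<in> verts G. \<forall>x'\<in>X. \<delta> * card (verts G) <
         card {y \<in> verts G. ({x, y, z} \<in> edges G) \<noteq> ({x', y, z} \<in> edges G)}}} \<le> \<delta> * card (verts G)"
    using slice_cover[OF assms, of k] by blast
  show ?thesis
  proof (rule exI[of _ "Suc m"], rule exI[of _ N], intro allI impI)
    fix G :: "'a graph3"
    assume fin: "finite (verts G)" and no: "\<not> ubar_config G k" and N: "N \<le> card (verts G)"
    define V where "V = verts G"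
    define n where "n = real (card V)"
    define R where "R = (\<lambda>z x y. {x, y, z} \<in> edges G)"
    define Z where "Z = {z \<in> V. \<forall>X. X \<subseteq> V \<longrightarrow> card X \<le> m \<longrightarrow> \<delta> * n < card {x \<in> V. \<forall>x'\<in>X. \<delta> * n < card {y \<in> V. R z x y \<noteq> R z x' y}}}"
    have cZ: "card Z \<le> \<delta> * n" using mN[OF fin no N] by (simp add: Z_def V_def n_def R_def)
    have finV: "finite V" using fin by (simp add: V_def)
    define Q where "Q = (\<lambda>z g h. (\<forall>i :: nat. g i \<in> V) \<and> (\<forall>x. h x < Suc m) \<and>
       (\<Sum>x\<in>V. \<Sum>y\<in>V. of_bool (R z x y \<noteq> R z (g (h x)) y)) \<le> 2 * \<delta> * n ^ 2 + (if z \<in> Z then n ^ 2 else 0))"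
    have ex: "\<exists>g h. Q z g h" if z: "z \<in> V" for z
    proof (cases "z \<in> Z")
      case True
      have "(\<Sum>x\<in>V. \<Sum>y\<in>V. of_bool (R z x y \<noteq> R z z y)) \<le> (\<Sum>x\<in>V. \<Sum>y\<in>V. 1 :: real)"
        by (intro sum_mono) auto
      also have "\<dots> = n ^ 2" by (simp add: n_def power2_eq_square)
      also have "\<dots> \<le> 2 * \<delta> * n ^ 2 + n ^ 2" using assms by simp
      finally have "Q z (\<lambda>_. z) (\<lambda>_. 0)" using z True by (simp add: Q_def)
      then show ?thesis by blast
    next
      case False
      then obtain X where "X \<subseteq> V" "card X \<le> m"
        "card {x \<in> V. \<forall>x'\<in>X. \<delta> * n < card {y \<in> V. R z x y \<noteq> R z x' y}} \<le> \<delta> * n"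
        using z by (auto simp: Z_def not_less)
      then show ?thesis
        using cover_imp_approximation[of V \<delta> X m "R z"] z finV assms False unfolding n_def Q_def by auto
    qed
    then have "\<forall>z\<in>V. \<exists>g h. Q z g h" by blast
    from bchoice[OF this] obtain \<xi> where "\<forall>z\<in>V. \<exists>h. Q z (\<xi> z) h" by blast
    from bchoice[OF this] obtain \<iota> where Q: "\<forall>z\<in>V. Q z (\<xi> z) (\<iota> z)" by blast
    have \<xi>\<iota>: "z \<in> V \<Longrightarrow> \<xi> z i \<in> V" "z \<in> V \<Longrightarrow> \<iota> z x < Suc m"
      "z \<in> V \<Longrightarrow> (\<Sum>x\<in>V. \<Sum>y\<in>V. of_bool (R z x y \<noteq> R z (\<xi> z (\<iota> z x)) y)) \<le> 2 * \<delta> * n ^ 2 + (if z \<in> Z then n ^ 2 else 0)" for z i x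
      using Q unfolding Q_def by blast+
    have "(\<Sum>z\<in>V. \<Sum>x\<in>V. \<Sum>y\<in>V. of_bool (R z x y \<noteq> R z (\<xi> z (\<iota> z x)) y))
      \<le> (\<Sum>z\<in>V. 2 * \<delta> * n ^ 2 + (if z \<in> Z then n ^ 2 else 0))"
      using \<xi>\<iota>(3) by (rule sum_mono)
    also have "\<dots> = n * (2 * \<delta> * n ^ 2) + card Z * n ^ 2"
      using finV by (simp add: sum.distrib sum.If_cases Z_def Int_def n_def)
    also have "\<dots> \<le> n * (2 * \<delta> * n ^ 2) + \<delta> * n * n ^ 2"
      using cZ by (intro add_left_mono mult_right_mono) auto
    also have "\<dots> = 3 * \<delta> * n ^ 3" by (simp add: power2_eq_square power3_eq_cube)
    finally show "\<exists>\<xi> \<iota>. (\<forall>z\<in>verts G. \<forall>i. \<xi> z i \<in> verts G) \<and> (\<forall>z\<in>verts G. \<forall>x. \<iota> z x < Suc m) \<and>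
      (\<Sum>z\<in>verts G. \<Sum>x\<in>verts G. \<Sum>y\<in>verts G.
         of_bool (({x, y, z} \<in> edges G) \<noteq> ({\<xi> z (\<iota> z x), y, z} \<in> edges G))) \<le> 3 * \<delta> * real (card (verts G)) ^ 3"
      using \<xi>\<iota>(1,2) unfolding V_def n_def R_def by blast
  qed
qed

section \<open>Weak regularity\<close>

text \<open>Conditional expectation of \<open>w\<close> given the label, for the uniform measure on
  \<open>U\<close>. With \<open>U = V \<times> V\<close> and label \<open>map_prod p p\<close> the
  cells are the boxes of the partition \<open>p\<close>.\<close>

definition cell_avg :: "'u set \<Rightarrow> ('u \<Rightarrow> 'l) \<Rightarrow> ('u \<Rightarrow> real) \<Rightarrow> 'u \<Rightarrow> real" where
  "cell_avg U l w u = (\<Sum>u'\<in>{u' \<in> U. l u' = l u}. w u') / card {u' \<in> U. l u' = l u}"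

definition cell_const :: "'u set \<Rightarrow> ('u \<Rightarrow> 'l) \<Rightarrow> ('u \<Rightarrow> real) \<Rightarrow> bool" where
  "cell_const U l s \<longleftrightarrow> (\<forall>u\<in>U. \<forall>u'\<in>U. l u = l u' \<longrightarrow> s u = s u')"

lemma cell_constD: "cell_const U l s \<Longrightarrow> u \<in> U \<Longrightarrow> u' \<in> U \<Longrightarrow> l u = l u' \<Longrightarrow> s u = s u'"
  unfolding cell_const_def by blast

lemma cell_const_cell_avg: "cell_const U l (cell_avg U l w)"
  by (simp add: cell_const_def cell_avg_def)

lemma cell_avg_nonneg: "(\<And>u. u \<in> U \<Longrightarrow> 0 \<le> w u) \<Longrightarrow> 0 \<le> cell_avg U l w u"
  unfolding cell_avg_def by (intro divide_nonneg_nonneg sum_nonneg) auto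

lemma cell_avg_le_1:
  assumes "\<And>u. u \<in> U \<Longrightarrow> w u \<le> 1"
  shows "cell_avg U l w u \<le> 1"
proof -
  have "(\<Sum>u'\<in>{u' \<in> U. l u' = l u}. w u') \<le> (\<Sum>u'\<in>{u' \<in> U. l u' = l u}. 1)"
    using assms by (intro sum_mono) auto
  then show ?thesis unfolding cell_avg_def by (auto simp: divide_le_eq)
qed

lemma cell_avg_sum: "(\<Sum>j\<in>J. cell_avg U l (w j) u) = cell_avg U l (\<lambda>u. \<Sum>j\<in>J. w j u) u"
proof -
  have "(\<Sum>j\<in>J. cell_avg U l (w j) u) =
    (\<Sum>j\<in>J. \<Sum>u'\<in>{u' \<in> U. l u' = l u}. w j u') / card {u' \<in> U. l u' = l u}"
    by (simp add: cell_avg_def sum_divide_distrib)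
  also have "(\<Sum>j\<in>J. \<Sum>u'\<in>{u' \<in> U. l u' = l u}. w j u') = (\<Sum>u'\<in>{u' \<in> U. l u' = l u}. \<Sum>j\<in>J. w j u')"
    by (rule sum.swap)
  finally show ?thesis by (simp add: cell_avg_def)
qed

lemma cell_avg_one:
  assumes "finite U" "u \<in> U" "\<And>u. u \<in> U \<Longrightarrow> w u = 1"
  shows "cell_avg U l w u = 1"
proof -
  have "{u' \<in> U. l u' = l u} \<noteq> {}" using assms(2) by auto
  then have "card {u' \<in> U. l u' = l u} \<noteq> 0" using assms(1) by auto
  then show ?thesis using assms(3) by (simp add: cell_avg_def)
qed

text \<open>Averaging is the orthogonal projection onto the functions that are constant on
  cells.\<close>

lemma cell_avg_adjoint:
  assumes "finite U" "cell_const U l s"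
  shows "(\<Sum>u\<in>U. cell_avg U l w u * s u) = (\<Sum>u\<in>U. w u * s u)"
proof -
  have "(\<Sum>u\<in>{u \<in> U. l u = c}. cell_avg U l w u * s u) = (\<Sum>u\<in>{u \<in> U. l u = c}. w u * s u)"
    if "c \<in> l ` U" for c
  proof -
    let ?C = "{u \<in> U. l u = c}"
    obtain v where v: "v \<in> U" "l v = c" using \<open>c \<in> l ` U\<close> by blast
    have s: "s u = s v" if "u \<in> ?C" for u
      by (rule cell_constD[OF assms(2)]) (use that v in simp_all)
    have "card ?C \<noteq> 0" using v assms(1) by auto
    have "(\<Sum>u\<in>?C. cell_avg U l w u * s u) = (\<Sum>u\<in>?C. (\<Sum>u'\<in>?C. w u') / card ?C * s v)"
      using s by (intro sum.cong) (auto simp: cell_avg_def)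
    also have "\<dots> = (\<Sum>u'\<in>?C. w u') * s v" using \<open>card ?C \<noteq> 0\<close> by simp
    also have "\<dots> = (\<Sum>u\<in>?C. w u * s v)" by (rule sum_distrib_right)
    also have "\<dots> = (\<Sum>u\<in>?C. w u * s u)" using s by (intro sum.cong) auto
    finally show ?thesis .
  qed
  then show ?thesis
    by (subst (1 2) sum.image_gen[OF assms(1), of _ l]) (rule sum.cong, auto)
qed

text \<open>Squared L2 distance from the cell-constant functions. It replaces the usual energy of a
  partition: refining decreases it, and it is bounded below by 0.\<close>

definition cell_residual :: "'u set \<Rightarrow> ('u \<Rightarrow> 'l) \<Rightarrow> ('u \<Rightarrow> real) \<Rightarrow> real" where
  "cell_residual U l w = (\<Sum>u\<in>U. (w u - cell_avg U l w u) ^ 2)"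

text \<open>Pythagoras: the average is the best cell-constant approximation in L2. Upper bounds for
  the residual thus come from any convenient competitor \<open>s\<close>.\<close>

lemma cell_residual_le:
  assumes "finite U" "cell_const U l s"
  shows "cell_residual U l w \<le> (\<Sum>u\<in>U. (w u - s u) ^ 2)"
proof -
  let ?a = "cell_avg U l w"
  have c: "cell_const U l (\<lambda>u. ?a u - s u)"
    using assms(2) cell_const_cell_avg[of U l w] unfolding cell_const_def by metis
  have "(\<Sum>u\<in>U. (w u - s u) ^ 2) =
    (\<Sum>u\<in>U. (w u - ?a u) ^ 2 + 2 * (w u * (?a u - s u) - ?a u * (?a u - s u)) + (?a u - s u) ^ 2)"
    by (intro sum.cong) (auto simp: power2_eq_square algebra_simps)
  also have "\<dots> = (\<Sum>u\<in>U. (w u - ?a u) ^ 2) +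
      2 * ((\<Sum>u\<in>U. w u * (?a u - s u)) - (\<Sum>u\<in>U. ?a u * (?a u - s u))) + (\<Sum>u\<in>U. (?a u - s u) ^ 2)"
    by (simp add: sum.distrib sum_subtractf sum_distrib_left)
  also have "\<dots> = cell_residual U l w + (\<Sum>u\<in>U. (?a u - s u) ^ 2)"
    using cell_avg_adjoint[OF assms(1) c, of w] by (simp add: cell_residual_def)
  also have "\<dots> \<ge> cell_residual U l w" by (simp add: sum_nonneg)
  finally show ?thesis .
qed

text \<open>Weak regularity in the sense of Frieze and Kannan: \<open>w\<close> is close in cut norm
  to its average over the boxes of \<open>p\<close>.\<close>

abbreviation cut_regular :: "real \<Rightarrow> 'a set \<Rightarrow> ('a \<Rightarrow> 'l) \<Rightarrow> ('a \<times> 'a \<Rightarrow> real) \<Rightarrow> bool" where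
  "cut_regular \<epsilon> V p w \<equiv> \<forall>A B. A \<subseteq> V \<longrightarrow> B \<subseteq> V \<longrightarrow>
     \<bar>\<Sum>u\<in>A \<times> B. w u - cell_avg (V \<times> V) (map_prod p p) w u\<bar> \<le> \<epsilon> * real (card V) ^ 2"

text \<open>The competitor is the old average plus \<open>\<epsilon>\<close>, with the sign of the
  discrepancy, on the violating rectangle; the refinement makes it cell-constant. The cross term
  gains more than \<open>2 * \<epsilon> ^ 2 * n ^ 2\<close> and the square of the correction returns
  at most half of that.\<close>

lemma residual_decrease:
  fixes p :: "'a \<Rightarrow> nat" and \<epsilon> :: real
  assumes "finite V" "\<epsilon> > 0" "A \<subseteq> V" "B \<subseteq> V"
    and big: "\<epsilon> * real (card V) ^ 2 < \<bar>\<Sum>u\<in>A \<times> B. w u - cell_avg (V \<times> V) (map_prod p p) w u\<bar>"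
    and ref: "\<And>x y. p' x = p' y \<Longrightarrow> p x = p y \<and> (x \<in> A \<longleftrightarrow> y \<in> A) \<and> (x \<in> B \<longleftrightarrow> y \<in> B)"
  shows "cell_residual (V \<times> V) (map_prod p' p') w
     \<le> cell_residual (V \<times> V) (map_prod p p) w - \<epsilon> ^ 2 * real (card V) ^ 2"
proof -
  let ?U = "V \<times> V" and ?n = "real (card V)"
  let ?a = "cell_avg ?U (map_prod p p) w"
  define \<sigma> where "\<sigma> = sgn (\<Sum>u\<in>A \<times> B. w u - ?a u)"
  have fin: "finite ?U" using assms(1) by simp
  have AB: "A \<times> B \<subseteq> ?U" using assms(3,4) by auto
  define s where "s = (\<lambda>u. ?a u + \<sigma> * \<epsilon> * of_bool (u \<in> A \<times> B))"
  have "cell_const ?U (map_prod p' p') s"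
    unfolding cell_const_def
  proof (intro ballI impI)
    fix u u' assume u: "u \<in> ?U" "u' \<in> ?U" "map_prod p' p' u = map_prod p' p' u'"
    obtain x y x' y' where xy: "u = (x, y)" "u' = (x', y')" by (metis surj_pair)
    have "?a u = ?a u'"
      by (rule cell_constD[OF cell_const_cell_avg u(1,2)])
        (use u(3) ref[of x x'] ref[of y y'] in \<open>simp add: xy\<close>)
    moreover have "u \<in> A \<times> B \<longleftrightarrow> u' \<in> A \<times> B"
      using u ref[of x x'] ref[of y y'] by (simp add: xy)
    ultimately show "s u = s u'" by (simp add: s_def)
  qed
  then have "cell_residual ?U (map_prod p' p') w \<le> (\<Sum>u\<in>?U. (w u - s u) ^ 2)"
    by (rule cell_residual_le[OF fin])
  also have "\<dots> = (\<Sum>u\<in>?U. (w u - ?a u) ^ 2 - 2 * \<sigma> * \<epsilon> * (of_bool (u \<in> A \<times> B) * (w u - ?a u))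
      + (\<sigma> * \<epsilon>) ^ 2 * of_bool (u \<in> A \<times> B))"
    by (intro sum.cong) (auto simp: s_def power2_eq_square algebra_simps)
  also have "\<dots> = cell_residual ?U (map_prod p p) w
      - 2 * \<sigma> * \<epsilon> * (\<Sum>u\<in>?U. of_bool (u \<in> A \<times> B) * (w u - ?a u))
      + (\<sigma> * \<epsilon>) ^ 2 * (\<Sum>u\<in>?U. of_bool (u \<in> A \<times> B))"
    by (simp add: cell_residual_def sum.distrib sum_subtractf sum_distrib_left)
  finally have le: "cell_residual ?U (map_prod p' p') w \<le> cell_residual ?U (map_prod p p) w
      - 2 * \<sigma> * \<epsilon> * (\<Sum>u\<in>?U. of_bool (u \<in> A \<times> B) * (w u - ?a u))
      + (\<sigma> * \<epsilon>) ^ 2 * (\<Sum>u\<in>?U. of_bool (u \<in> A \<times> B))" .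
  have 1: "(\<Sum>u\<in>?U. of_bool (u \<in> A \<times> B) * (w u - ?a u)) = (\<Sum>u\<in>A \<times> B. w u - ?a u)"
    using fin AB by (intro sum.mono_neutral_cong_right) auto
  have "(\<Sum>u\<in>?U. of_bool (u \<in> A \<times> B) :: real) = (\<Sum>u\<in>A \<times> B. 1)"
    using fin AB by (intro sum.mono_neutral_cong_right) auto
  then have 2: "(\<Sum>u\<in>?U. of_bool (u \<in> A \<times> B) :: real) = card (A \<times> B)" by simp
  have "\<sigma> * (\<Sum>u\<in>A \<times> B. w u - ?a u) = \<bar>\<Sum>u\<in>A \<times> B. w u - ?a u\<bar>"
    unfolding \<sigma>_def by (subst mult.commute) (rule abs_sgn[symmetric])
  then have 3: "2 * \<sigma> * \<epsilon> * (\<Sum>u\<in>A \<times> B. w u - ?a u) = 2 * \<epsilon> * \<bar>\<Sum>u\<in>A \<times> B. w u - ?a u\<bar>"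
    by (simp add: mult.commute mult.left_commute)
  have 4: "2 * \<epsilon> * (\<epsilon> * ?n ^ 2) \<le> 2 * \<epsilon> * \<bar>\<Sum>u\<in>A \<times> B. w u - ?a u\<bar>"
    using big assms(2) by (intro mult_left_mono) auto
  have "\<sigma> ^ 2 \<le> 1" by (simp add: \<sigma>_def sgn_if)
  then have "(\<sigma> * \<epsilon>) ^ 2 \<le> \<epsilon> ^ 2" by (simp add: power_mult_distrib mult_left_le_one_le)
  moreover have "card (A \<times> B) \<le> card ?U" by (rule card_mono[OF fin AB])
  then have "real (card (A \<times> B)) \<le> real (card ?U)" by (simp only: of_nat_le_iff)
  then have "real (card (A \<times> B)) \<le> ?n ^ 2" by (simp add: card_cartesian_product power2_eq_square)
  ultimately have 5: "(\<sigma> * \<epsilon>) ^ 2 * card (A \<times> B) \<le> \<epsilon> ^ 2 * ?n ^ 2" by (intro mult_mono) auto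
  have "2 * \<epsilon> * (\<epsilon> * ?n ^ 2) = 2 * (\<epsilon> ^ 2 * ?n ^ 2)" by (simp add: power2_eq_square)
  with le[unfolded 1 2 3] 4 5 show ?thesis by linarith
qed

lemma residual_mono:
  fixes p p' :: "'a \<Rightarrow> nat"
  assumes "finite V" and ref: "\<And>x y. p' x = p' y \<Longrightarrow> p x = p y"
  shows "cell_residual (V \<times> V) (map_prod p' p') w \<le> cell_residual (V \<times> V) (map_prod p p) w"
proof -
  have "cell_const (V \<times> V) (map_prod p' p') (cell_avg (V \<times> V) (map_prod p p) w)"
    unfolding cell_const_def
  proof (intro ballI impI)
    fix u u' assume u: "u \<in> V \<times> V" "u' \<in> V \<times> V" "map_prod p' p' u = map_prod p' p' u'"
    obtain x y x' y' where xy: "u = (x, y)" "u' = (x', y')" by (metis surj_pair)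
    have "map_prod p p u = map_prod p p u'" using u(3) ref[of x x'] ref[of y y'] by (simp add: xy)
    with u(1,2) show "cell_avg (V \<times> V) (map_prod p p) w u = cell_avg (V \<times> V) (map_prod p p) w u'"
      by (rule cell_constD[OF cell_const_cell_avg])
  qed
  then have "cell_residual (V \<times> V) (map_prod p' p') w
      \<le> (\<Sum>u\<in>V \<times> V. (w u - cell_avg (V \<times> V) (map_prod p p) w u) ^ 2)"
    using assms(1) by (intro cell_residual_le) auto
  then show ?thesis by (simp only: cell_residual_def)
qed

text \<open>\<open>s\<close> bounds the total residual in units of
  \<open>\<epsilon> ^ 2 * n ^ 2\<close>. A violating rectangle for any \<open>w\<close> uses up one
  unit and splits each cell into at most four. Residuals are summed over the family, and refining
  does not increase the others, so one labelling serves all of \<W>.\<close>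

lemma weak_regularity_step:
  fixes p :: "'a \<Rightarrow> nat" and \<epsilon> :: real
  assumes "finite V" "finite \<W>" "\<epsilon> > 0"
  shows "(\<Sum>w\<in>\<W>. cell_residual (V \<times> V) (map_prod p p) w) \<le> real s * (\<epsilon> ^ 2 * real (card V) ^ 2)
     \<Longrightarrow> (\<forall>x\<in>V. p x < q)
     \<Longrightarrow> \<exists>p'. (\<forall>x\<in>V. p' x < q * 4 ^ s) \<and> (\<forall>w\<in>\<W>. cut_regular \<epsilon> V p' w)"
proof (induction s arbitrary: p q)
  case (0 p q)
  \<comment> \<open>With no budget left every residual vanishes, so each \<open>w\<close> equals its
    box average on \<open>V \<times> V\<close>.\<close>
  have "cut_regular \<epsilon> V p w" if w: "w \<in> \<W>" for w
  proof (intro allI impI)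
    fix A B assume AB: "A \<subseteq> V" "B \<subseteq> V"
    have "cell_residual (V \<times> V) (map_prod p p) w \<le> (\<Sum>w\<in>\<W>. cell_residual (V \<times> V) (map_prod p p) w)"
      using w assms(2) by (intro member_le_sum) (auto simp: cell_residual_def sum_nonneg)
    also have "\<dots> \<le> 0" using 0 by simp
    finally have "(\<Sum>u\<in>V \<times> V. (w u - cell_avg (V \<times> V) (map_prod p p) w u) ^ 2) = 0"
      unfolding cell_residual_def by (intro antisym sum_nonneg) auto
    then have z: "\<forall>u\<in>V \<times> V. (w u - cell_avg (V \<times> V) (map_prod p p) w u) ^ 2 = 0"
      using assms(1) by (subst (asm) sum_nonneg_eq_0_iff) auto
    have "(\<Sum>u\<in>A \<times> B. w u - cell_avg (V \<times> V) (map_prod p p) w u) = 0"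
    proof (rule sum.neutral, rule ballI)
      fix u assume "u \<in> A \<times> B"
      with AB have "u \<in> V \<times> V" by auto
      with z show "w u - cell_avg (V \<times> V) (map_prod p p) w u = 0" by auto
    qed
    then show "\<bar>\<Sum>u\<in>A \<times> B. w u - cell_avg (V \<times> V) (map_prod p p) w u\<bar> \<le> \<epsilon> * real (card V) ^ 2"
      using assms(3) by simp
  qed
  with 0 show ?case by auto
next
  case (Suc s p q)
  show ?case
  proof (cases "\<forall>w\<in>\<W>. cut_regular \<epsilon> V p w")
    case True
    have "q \<le> q * 4 ^ Suc s" by simp
    then have "\<forall>x\<in>V. p x < q * 4 ^ Suc s" using Suc.prems(2) by (meson less_le_trans)
    with True show ?thesis by blast
  next
    case False
    then obtain w where w: "w \<in> \<W>" and "\<not> cut_regular \<epsilon> V p w" by blast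
    then obtain A B where AB: "A \<subseteq> V" "B \<subseteq> V"
      and big: "\<epsilon> * real (card V) ^ 2 < \<bar>\<Sum>u\<in>A \<times> B. w u - cell_avg (V \<times> V) (map_prod p p) w u\<bar>"
      unfolding not_all not_imp not_le by blast
    \<comment> \<open>The label gets two binary digits appended, recording membership in
      \<open>A\<close> and in \<open>B\<close>.\<close>
    define p' where "p' = (\<lambda>x. 4 * p x + (if x \<in> A then 2 else 0) + (if x \<in> B then 1 else 0))"
    have "p x = p' x div 4" "x \<in> A \<longleftrightarrow> p' x div 2 mod 2 = 1" "x \<in> B \<longleftrightarrow> p' x mod 2 = 1" for x
      unfolding p'_def by (cases "x \<in> A"; cases "x \<in> B"; simp; presburger)+
    then have ref: "p x = p y \<and> (x \<in> A \<longleftrightarrow> y \<in> A) \<and> (x \<in> B \<longleftrightarrow> y \<in> B)" if "p' x = p' y" for x y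
      using that by simp
    let ?r = "\<lambda>p. cell_residual (V \<times> V) (map_prod p p)"
    have "(\<Sum>v\<in>\<W>. ?r p' v) = ?r p' w + (\<Sum>v\<in>\<W> - {w}. ?r p' v)"
      using assms(2) w by (simp add: sum.remove)
    also have "\<dots> \<le> (?r p w - \<epsilon> ^ 2 * real (card V) ^ 2) + (\<Sum>v\<in>\<W> - {w}. ?r p v)"
    proof (rule add_mono)
      show "?r p' w \<le> ?r p w - \<epsilon> ^ 2 * real (card V) ^ 2"
        by (rule residual_decrease[OF assms(1,3) AB big]) (use ref in blast)
      have "?r p' v \<le> ?r p v" for v
        by (rule residual_mono[OF assms(1)]) (use ref in blast)
      then show "(\<Sum>v\<in>\<W> - {w}. ?r p' v) \<le> (\<Sum>v\<in>\<W> - {w}. ?r p v)" by (rule sum_mono)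
    qed
    also have "\<dots> = (\<Sum>v\<in>\<W>. ?r p v) - \<epsilon> ^ 2 * real (card V) ^ 2"
      using assms(2) w by (simp add: sum.remove)
    also have "\<dots> \<le> real s * (\<epsilon> ^ 2 * real (card V) ^ 2)"
      using Suc.prems(1) by (simp add: algebra_simps)
    finally have "(\<Sum>v\<in>\<W>. ?r p' v) \<le> real s * (\<epsilon> ^ 2 * real (card V) ^ 2)" .
    moreover have "\<forall>x\<in>V. p' x < q * 4"
    proof
      fix x assume "x \<in> V"
      then have "p x < q" using Suc.prems(2) by blast
      then show "p' x < q * 4" by (simp add: p'_def)
    qed
    ultimately have "\<exists>p'. (\<forall>x\<in>V. p' x < q * 4 * 4 ^ s) \<and> (\<forall>w\<in>\<W>. cut_regular \<epsilon> V p' w)"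
      by (rule Suc.IH[of p' "q * 4"])
    then show ?thesis by (simp add: mult.assoc)
  qed
qed

text \<open>For the trivial labelling, comparison with the function 0 bounds each residual by
  \<open>n ^ 2\<close>, so \<open>c / \<epsilon> ^ 2\<close> units of budget suffice. The resulting
  \<open>q\<close> depends only on \<open>c\<close> and \<open>\<epsilon>\<close>.\<close>

lemma weak_regularity:
  fixes \<epsilon> :: real
  assumes "\<epsilon> > 0"
  shows "\<exists>q. \<forall>(V :: 'a set) \<W>. finite V \<longrightarrow> finite \<W> \<longrightarrow> card \<W> \<le> c \<longrightarrow>
    (\<forall>w\<in>\<W>. \<forall>u\<in>V \<times> V. 0 \<le> w u \<and> w u \<le> 1) \<longrightarrow>
    (\<exists>p :: 'a \<Rightarrow> nat. (\<forall>x\<in>V. p x < q) \<and> (\<forall>w\<in>\<W>. cut_regular \<epsilon> V p w))"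
proof -
  define s where "s = nat \<lceil>real c / \<epsilon> ^ 2\<rceil>"
  have s: "real c \<le> real s * \<epsilon> ^ 2"
  proof -
    have "real c / \<epsilon> ^ 2 \<le> real s" unfolding s_def by linarith
    then show ?thesis using assms by (simp add: divide_le_eq)
  qed
  show ?thesis
  proof (rule exI[of _ "1 * 4 ^ s"], intro allI impI)
    fix V :: "'a set" and \<W> :: "('a \<times> 'a \<Rightarrow> real) set"
    assume fin: "finite V" "finite \<W>" and card: "card \<W> \<le> c"
      and bd: "\<forall>w\<in>\<W>. \<forall>u\<in>V \<times> V. 0 \<le> w u \<and> w u \<le> 1"
    let ?p = "\<lambda>_ :: 'a. 0 :: nat"
    have "cell_residual (V \<times> V) (map_prod ?p ?p) w \<le> real (card V) ^ 2" if "w \<in> \<W>" for w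
    proof -
      have "cell_residual (V \<times> V) (map_prod ?p ?p) w \<le> (\<Sum>u\<in>V \<times> V. (w u - 0) ^ 2)"
        using fin by (intro cell_residual_le) (auto simp: cell_const_def)
      also have "\<dots> \<le> (\<Sum>u\<in>V \<times> V. 1)"
        using bd that by (intro sum_mono) (auto simp: power_le_one)
      also have "\<dots> = real (card V) ^ 2" by (simp add: card_cartesian_product power2_eq_square)
      finally show ?thesis .
    qed
    then have "(\<Sum>w\<in>\<W>. cell_residual (V \<times> V) (map_prod ?p ?p) w) \<le> (\<Sum>w\<in>\<W>. real (card V) ^ 2)"
      by (rule sum_mono)
    also have "\<dots> \<le> real c * real (card V) ^ 2" using card by (simp add: mult_right_mono)
    also have "\<dots> \<le> real s * \<epsilon> ^ 2 * real (card V) ^ 2" using s by (rule mult_right_mono) simp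
    finally have "(\<Sum>w\<in>\<W>. cell_residual (V \<times> V) (map_prod ?p ?p) w) \<le> real s * (\<epsilon> ^ 2 * real (card V) ^ 2)"
      by (simp add: mult.assoc)
    then show "\<exists>p :: 'a \<Rightarrow> nat. (\<forall>x\<in>V. p x < 1 * 4 ^ s) \<and> (\<forall>w\<in>\<W>. cut_regular \<epsilon> V p w)"
      by (rule weak_regularity_step[OF fin assms]) simp
  qed
qed

section \<open>Approximation by step functions\<close>

text \<open>A linear form on a cube is maximal at a vertex: with weights in [0,1] the extreme choice
  is the indicator of the positive terms.\<close>

lemma weighted_sum_le:
  fixes \<alpha> s :: "'a \<Rightarrow> real"
  assumes "finite V" "\<And>A. A \<subseteq> V \<Longrightarrow> \<bar>\<Sum>x\<in>A. s x\<bar> \<le> C"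
    and \<alpha>: "\<And>x. x \<in> V \<Longrightarrow> 0 \<le> \<alpha> x" "\<And>x. x \<in> V \<Longrightarrow> \<alpha> x \<le> 1"
  shows "\<bar>\<Sum>x\<in>V. \<alpha> x * s x\<bar> \<le> C"
proof -
  have *: "(\<Sum>x\<in>V. \<alpha> x * t x) \<le> C" if t: "\<And>A. A \<subseteq> V \<Longrightarrow> \<bar>\<Sum>x\<in>A. t x\<bar> \<le> C" for t
  proof -
    have "(\<Sum>x\<in>V. \<alpha> x * t x) \<le> (\<Sum>x\<in>V. if t x > 0 then t x else 0)"
    proof (rule sum_mono)
      fix x assume "x \<in> V"
      with \<alpha> show "\<alpha> x * t x \<le> (if t x > 0 then t x else 0)"
        by (auto simp: mult_left_le_one_le mult_nonneg_nonpos)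
    qed
    also have "\<dots> = (\<Sum>x\<in>{x \<in> V. t x > 0}. t x)" using assms(1) by (rule sum.inter_filter[symmetric])
    also have "\<dots> \<le> C" using t[of "{x \<in> V. t x > 0}"] by auto
    finally show ?thesis .
  qed
  have "(\<Sum>x\<in>V. \<alpha> x * - s x) \<le> C" by (rule *) (simp only: sum_negf abs_minus_cancel assms(2))
  then have "- (\<Sum>x\<in>V. \<alpha> x * s x) \<le> C" by (simp add: sum_negf)
  moreover have "(\<Sum>x\<in>V. \<alpha> x * s x) \<le> C" using assms(2) by (rule *)
  ultimately show ?thesis by linarith
qed

text \<open>The extreme point argument in each variable separately; it extends a cut norm bound from
  rectangles to products of [0,1]-valued functions.\<close>

lemma weighted_cut_le:
  fixes \<alpha> \<beta> :: "'a \<Rightarrow> real"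
  assumes "finite V" "\<And>A B. A \<subseteq> V \<Longrightarrow> B \<subseteq> V \<Longrightarrow> \<bar>\<Sum>u\<in>A \<times> B. d u\<bar> \<le> C"
    and "\<And>x. x \<in> V \<Longrightarrow> 0 \<le> \<alpha> x" "\<And>x. x \<in> V \<Longrightarrow> \<alpha> x \<le> 1"
    and "\<And>x. x \<in> V \<Longrightarrow> 0 \<le> \<beta> x" "\<And>x. x \<in> V \<Longrightarrow> \<beta> x \<le> 1"
  shows "\<bar>\<Sum>x\<in>V. \<Sum>y\<in>V. \<alpha> x * \<beta> y * d (x, y)\<bar> \<le> C"
proof -
  have 1: "\<bar>\<Sum>x\<in>A. \<Sum>y\<in>V. \<beta> y * d (x, y)\<bar> \<le> C" if A: "A \<subseteq> V" for A
  proof -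
    have "\<bar>\<Sum>y\<in>B. \<Sum>x\<in>A. d (x, y)\<bar> \<le> C" if "B \<subseteq> V" for B
    proof -
      have "(\<Sum>y\<in>B. \<Sum>x\<in>A. d (x, y)) = (\<Sum>x\<in>A. \<Sum>y\<in>B. d (x, y))" by (rule sum.swap)
      also have "\<dots> = (\<Sum>u\<in>A \<times> B. d u)" by (simp add: sum.cartesian_product)
      finally show ?thesis using assms(2)[OF A that] by simp
    qed
    then have "\<bar>\<Sum>y\<in>V. \<beta> y * (\<Sum>x\<in>A. d (x, y))\<bar> \<le> C"
      using assms(1,5,6) by (intro weighted_sum_le) auto
    moreover have "(\<Sum>y\<in>V. \<beta> y * (\<Sum>x\<in>A. d (x, y))) = (\<Sum>x\<in>A. \<Sum>y\<in>V. \<beta> y * d (x, y))"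
      unfolding sum_distrib_left by (rule sum.swap)
    ultimately show ?thesis by simp
  qed
  then have "\<bar>\<Sum>x\<in>V. \<alpha> x * (\<Sum>y\<in>V. \<beta> y * d (x, y))\<bar> \<le> C"
    using assms(1,3,4) by (intro weighted_sum_le) auto
  then show ?thesis by (simp add: sum_distrib_left mult.assoc)
qed

lemma sum4_swap:
  "(\<Sum>x\<in>A. \<Sum>y\<in>B. \<Sum>i\<in>I. \<Sum>j\<in>J. h x y i j) = (\<Sum>i\<in>I. \<Sum>j\<in>J. \<Sum>x\<in>A. \<Sum>y\<in>B. h x y i j)"
proof -
  have "(\<Sum>x\<in>A. \<Sum>y\<in>B. \<Sum>i\<in>I. \<Sum>j\<in>J. h x y i j) = (\<Sum>x\<in>A. \<Sum>i\<in>I. \<Sum>y\<in>B. \<Sum>j\<in>J. h x y i j)"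
    by (intro sum.cong refl sum.swap)
  also have "\<dots> = (\<Sum>i\<in>I. \<Sum>x\<in>A. \<Sum>y\<in>B. \<Sum>j\<in>J. h x y i j)" by (rule sum.swap)
  also have "\<dots> = (\<Sum>i\<in>I. \<Sum>x\<in>A. \<Sum>j\<in>J. \<Sum>y\<in>B. h x y i j)" by (intro sum.cong refl sum.swap)
  also have "\<dots> = (\<Sum>i\<in>I. \<Sum>j\<in>J. \<Sum>x\<in>A. \<Sum>y\<in>B. h x y i j)" by (intro sum.cong refl sum.swap)
  finally show ?thesis .
qed

text \<open>For fixed \<open>z\<close>, the weight of \<open>d j (x, y)\<close> is a function of \<open>x\<close> times a function of \<open>y\<close>.\<close>

lemma triangle_cut_le:
  fixes \<alpha> \<beta> b :: "nat \<Rightarrow> 'a \<Rightarrow> 'a \<Rightarrow> real"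
  assumes "finite V"
    and d: "\<And>j A B. j < m \<Longrightarrow> A \<subseteq> V \<Longrightarrow> B \<subseteq> V \<Longrightarrow> \<bar>\<Sum>u\<in>A \<times> B. d j u\<bar> \<le> C"
    and \<alpha>: "\<And>i x z. x \<in> V \<Longrightarrow> z \<in> V \<Longrightarrow> 0 \<le> \<alpha> i x z \<and> \<alpha> i x z \<le> 1"
    and \<beta>: "\<And>i y z. y \<in> V \<Longrightarrow> z \<in> V \<Longrightarrow> 0 \<le> \<beta> i y z \<and> \<beta> i y z \<le> 1"
    and b: "\<And>j y z. y \<in> V \<Longrightarrow> z \<in> V \<Longrightarrow> 0 \<le> b j y z \<and> b j y z \<le> 1"
  shows "\<bar>\<Sum>z\<in>V. \<Sum>x\<in>V. \<Sum>y\<in>V. (\<Sum>i<k. \<alpha> i x z * \<beta> i y z) * (\<Sum>j<m. d j (x, y) * b j y z)\<bar>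
    \<le> card V * (real k * (real m * C))"
proof -
  have "\<bar>\<Sum>x\<in>V. \<Sum>y\<in>V. (\<Sum>i<k. \<alpha> i x z * \<beta> i y z) * (\<Sum>j<m. d j (x, y) * b j y z)\<bar> \<le> real k * (real m * C)"
    if z: "z \<in> V" for z
  proof -
    have "(\<Sum>x\<in>V. \<Sum>y\<in>V. (\<Sum>i<k. \<alpha> i x z * \<beta> i y z) * (\<Sum>j<m. d j (x, y) * b j y z))
      = (\<Sum>x\<in>V. \<Sum>y\<in>V. \<Sum>i<k. \<Sum>j<m. \<alpha> i x z * (\<beta> i y z * b j y z) * d j (x, y))"
      unfolding sum_product by (simp add: mult.assoc mult.commute mult.left_commute)
    also have "\<dots> = (\<Sum>i<k. \<Sum>j<m. \<Sum>x\<in>V. \<Sum>y\<in>V. \<alpha> i x z * (\<beta> i y z * b j y z) * d j (x, y))"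
      by (rule sum4_swap)
    also have "\<bar>\<dots>\<bar> \<le> (\<Sum>i<k. \<Sum>j<m. C)"
    proof (rule order_trans[OF sum_abs], rule sum_mono, rule order_trans[OF sum_abs], rule sum_mono)
      fix i j assume "j \<in> {..<m}"
      show "\<bar>\<Sum>x\<in>V. \<Sum>y\<in>V. \<alpha> i x z * (\<beta> i y z * b j y z) * d j (x, y)\<bar> \<le> C"
        by (rule weighted_cut_le[OF assms(1) d])
          (use \<open>j \<in> _\<close> \<alpha> \<beta> b z in \<open>auto simp: mult_le_one\<close>)
    qed
    finally show ?thesis by simp
  qed
  then have "(\<Sum>z\<in>V. \<bar>\<Sum>x\<in>V. \<Sum>y\<in>V. (\<Sum>i<k. \<alpha> i x z * \<beta> i y z) * (\<Sum>j<m. d j (x, y) * b j y z)\<bar>)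
     \<le> (\<Sum>z\<in>V. real k * (real m * C))" by (rule sum_mono)
  then show ?thesis by (intro order_trans[OF sum_abs]) simp
qed

text \<open>For a \<open>{0,1}\<close>-valued \<open>f\<close> and \<open>g, g'\<close> with values in \<open>[0,1]\<close>, one has
  \<open>\<bar>f - g'\<bar> = \<bar>f - g\<bar> - (g - g') + 2 f (g - g')\<close>.\<close>

lemma replace_le:
  fixes f g g' k :: "'u \<Rightarrow> real"
  assumes f: "\<And>u. u \<in> U \<Longrightarrow> f u \<in> {0, 1}"
    and g: "\<And>u. u \<in> U \<Longrightarrow> 0 \<le> g u \<and> g u \<le> 1" "\<And>u. u \<in> U \<Longrightarrow> 0 \<le> g' u \<and> g' u \<le> 1"
  shows "(\<Sum>u\<in>U. \<bar>f u - g' u\<bar>) \<le> (\<Sum>u\<in>U. \<bar>f u - g u\<bar>) + 2 * (\<Sum>u\<in>U. \<bar>f u - k u\<bar>)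
     + 2 * \<bar>\<Sum>u\<in>U. k u * (g u - g' u)\<bar> + \<bar>\<Sum>u\<in>U. g u - g' u\<bar>"
proof -
  have "(\<Sum>u\<in>U. \<bar>f u - g' u\<bar>) = (\<Sum>u\<in>U. \<bar>f u - g u\<bar> - (g u - g' u) + 2 * (f u * (g u - g' u)))"
  proof (rule sum.cong[OF refl])
    fix u assume "u \<in> U"
    from f[OF this] g[OF this] show "\<bar>f u - g' u\<bar> = \<bar>f u - g u\<bar> - (g u - g' u) + 2 * (f u * (g u - g' u))" by auto
  qed
  also have "\<dots> = (\<Sum>u\<in>U. \<bar>f u - g u\<bar>) - (\<Sum>u\<in>U. g u - g' u) + 2 * (\<Sum>u\<in>U. f u * (g u - g' u))"
    by (simp add: sum.distrib sum_subtractf sum_distrib_left)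
  finally have eq: "(\<Sum>u\<in>U. \<bar>f u - g' u\<bar>) =
    (\<Sum>u\<in>U. \<bar>f u - g u\<bar>) - (\<Sum>u\<in>U. g u - g' u) + 2 * (\<Sum>u\<in>U. f u * (g u - g' u))" .
  \<comment> \<open>In the linear term \<open>f\<close> is exchanged for \<open>k\<close>. As
    \<open>g - g'\<close> is at most 1 in absolute value, this costs the L1 distance of
    \<open>f\<close> and \<open>k\<close>.\<close>
  have "(\<Sum>u\<in>U. f u * (g u - g' u)) \<le> (\<Sum>u\<in>U. \<bar>f u - k u\<bar> + k u * (g u - g' u))"
  proof (rule sum_mono)
    fix u assume "u \<in> U"
    from g[OF this] have "\<bar>g u - g' u\<bar> \<le> 1" by auto
    then have "\<bar>(f u - k u) * (g u - g' u)\<bar> \<le> \<bar>f u - k u\<bar>" by (simp add: abs_mult mult_left_le)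
    then have "(f u - k u) * (g u - g' u) \<le> \<bar>f u - k u\<bar>" by linarith
    then show "f u * (g u - g' u) \<le> \<bar>f u - k u\<bar> + k u * (g u - g' u)" by (simp add: left_diff_distrib)
  qed
  also have "\<dots> = (\<Sum>u\<in>U. \<bar>f u - k u\<bar>) + (\<Sum>u\<in>U. k u * (g u - g' u))" by (rule sum.distrib)
  finally show ?thesis unfolding eq by linarith
qed

lemma sum_triple:
  "(\<Sum>u\<in>A \<times> B \<times> C. g u) = (\<Sum>x\<in>A. \<Sum>y\<in>B. \<Sum>z\<in>C. g (x, y, z))"
  by (simp add: sum.cartesian_product)

lemma sum3_rotate:
  "(\<Sum>x\<in>A. \<Sum>y\<in>B. \<Sum>z\<in>C. g x y z) = (\<Sum>z\<in>C. \<Sum>x\<in>A. \<Sum>y\<in>B. g x y z)"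
proof -
  have "(\<Sum>x\<in>A. \<Sum>y\<in>B. \<Sum>z\<in>C. g x y z) = (\<Sum>x\<in>A. \<Sum>z\<in>C. \<Sum>y\<in>B. g x y z)"
    by (intro sum.cong refl sum.swap)
  also have "\<dots> = (\<Sum>z\<in>C. \<Sum>x\<in>A. \<Sum>y\<in>B. g x y z)" by (rule sum.swap)
  finally show ?thesis .
qed

lemma sum_of_bool_collapse:
  fixes h :: "nat \<Rightarrow> real"
  shows "i < M \<Longrightarrow> (\<Sum>j<M. of_bool (i = j) * h j) = h i"
  by (subst sum.remove[of _ i]) (auto intro!: sum.neutral)

text \<open>Write \<open>F x y z\<close> for the approximation \<open>f (\<xi> z (\<iota> z x)) y z\<close>, of the form
  \<open>\<Sum>i. u i (x, z) * v i (y, z)\<close>. By symmetry of \<open>f\<close>, \<open>F x z y\<close> and \<open>F y z x\<close> approximate it as well. The first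
  step averages the \<open>u\<close>-factors of \<open>F x z y\<close>, tested against \<open>F x y z\<close>; the second one averages the
  \<open>v\<close>-factors, tested against \<open>F y z x\<close>.\<close>

lemma triangle_approximation:
  fixes f :: "'a \<Rightarrow> 'a \<Rightarrow> 'a \<Rightarrow> bool" and p :: "'a \<Rightarrow> nat" and \<epsilon> \<tau> :: real
  assumes fin: "finite V" and "\<epsilon> \<ge> 0"
    and sym: "\<And>x y z. f x y z = f y x z" "\<And>x y z. f x y z = f x z y"
    and \<iota>: "\<And>x z. z \<in> V \<Longrightarrow> \<iota> z x < (M :: nat)"
    and err: "(\<Sum>z\<in>V. \<Sum>x\<in>V. \<Sum>y\<in>V. of_bool (f x y z \<noteq> f (\<xi> z (\<iota> z x)) y z)) \<le> \<tau>"
    and reg_u: "\<And>j. j < M \<Longrightarrow> cut_regular \<epsilon> V p (\<lambda>(x, y). of_bool (\<iota> y x = j))"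
    and reg_v: "\<And>j. j < M \<Longrightarrow> cut_regular \<epsilon> V p (\<lambda>(z, y). of_bool (f (\<xi> y j) z y))"
  shows "\<exists>H :: 'a \<Rightarrow> 'a \<Rightarrow> 'a \<Rightarrow> real.
    (\<forall>x\<in>V. \<forall>x'\<in>V. \<forall>y\<in>V. \<forall>y'\<in>V. \<forall>z\<in>V. \<forall>z'\<in>V.
        p x = p x' \<longrightarrow> p y = p y' \<longrightarrow> p z = p z' \<longrightarrow> H x y z = H x' y' z') \<and>
    (\<Sum>x\<in>V. \<Sum>y\<in>V. \<Sum>z\<in>V. \<bar>of_bool (f x y z) - H x y z\<bar>)
      \<le> 5 * \<tau> + 6 * real M ^ 2 * \<epsilon> * real (card V) ^ 3"
proof -
  define n where "n = real (card V)"
  define F :: "'a \<Rightarrow> 'a \<Rightarrow> 'a \<Rightarrow> real" where "F = (\<lambda>x y z. of_bool (f (\<xi> z (\<iota> z x)) y z))"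
  define u :: "nat \<Rightarrow> 'a \<times> 'a \<Rightarrow> real" where "u = (\<lambda>j (x, y). of_bool (\<iota> y x = j))"
  define v :: "nat \<Rightarrow> 'a \<times> 'a \<Rightarrow> real" where "v = (\<lambda>j (z, y). of_bool (f (\<xi> y j) z y))"
  define a where "a = cell_avg (V \<times> V) (map_prod p p)"
  define G where "G = (\<lambda>x y z. \<Sum>j<M. a (u j) (x, y) * v j (z, y))"
  define H where "H = (\<lambda>x y z. \<Sum>j<M. a (u j) (x, y) * a (v j) (z, y))"
  have F_eq: "F x y z = (\<Sum>i<M. u i (x, z) * v i (y, z))" if "z \<in> V" for x y z
    using sum_of_bool_collapse[OF \<iota>[OF that, of x], of "\<lambda>i. v i (y, z)"]
    by (simp add: F_def u_def v_def)
  have u01: "0 \<le> u j q" "u j q \<le> 1" and v01: "0 \<le> v j q" "v j q \<le> 1" for j q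
    by (auto simp: u_def v_def split: prod.split)
  have a01: "0 \<le> a (u j) q" "a (u j) q \<le> 1" "0 \<le> a (v j) q" "a (v j) q \<le> 1" for j q
    unfolding a_def using u01 v01 by (auto intro: cell_avg_nonneg cell_avg_le_1)
  \<comment> \<open>For fixed arguments exactly one \<open>u j\<close> is 1, and averaging preserves
    this partition of unity. It keeps \<open>G\<close> and \<open>H\<close> in [0,1], as
    \<open>replace_le\<close> requires.\<close>
  have a_sum: "(\<Sum>j<M. a (u j) (x, y)) = 1" if "x \<in> V" "y \<in> V" for x y
    unfolding a_def cell_avg_sum
  proof (rule cell_avg_one)
    fix q assume "q \<in> V \<times> V"
    then obtain x y where "q = (x, y)" "y \<in> V" by auto
    then show "(\<Sum>j<M. u j q) = 1"
      using sum_of_bool_collapse[OF \<iota>[of y x], of "\<lambda>_. 1"] by (simp add: u_def)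
  qed (use fin that in auto)
  have G01: "0 \<le> G x y z \<and> G x y z \<le> 1" and H01: "0 \<le> H x y z \<and> H x y z \<le> 1"
    if "x \<in> V" "y \<in> V" "z \<in> V" for x y z
  proof -
    have "G x y z \<le> (\<Sum>j<M. a (u j) (x, y))" "H x y z \<le> (\<Sum>j<M. a (u j) (x, y))"
      unfolding G_def H_def using a01 v01 by (auto intro!: sum_mono mult_left_le)
    moreover have "0 \<le> G x y z" "0 \<le> H x y z"
      unfolding G_def H_def using a01 v01 by (auto intro!: sum_nonneg)
    ultimately show "0 \<le> G x y z \<and> G x y z \<le> 1" "0 \<le> H x y z \<and> H x y z \<le> 1"
      using a_sum[OF that(1,2)] by auto
  qed
  have F01: "0 \<le> F x y z \<and> F x y z \<le> 1" for x y z by (simp add: F_def)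
  have cut_u: "\<bar>\<Sum>q\<in>A \<times> B. u j q - a (u j) q\<bar> \<le> \<epsilon> * n ^ 2"
    and cut_v: "\<bar>\<Sum>q\<in>A \<times> B. v j q - a (v j) q\<bar> \<le> \<epsilon> * n ^ 2"
    if "j < M" "A \<subseteq> V" "B \<subseteq> V" for j A B
    using reg_u[OF that(1)] reg_v[OF that(1)] that(2,3) unfolding u_def v_def a_def n_def by blast+
  let ?U = "V \<times> V \<times> V"
  let ?f = "\<lambda>(x, y, z). of_bool (f x y z) :: real"
  define E where "E = (\<Sum>z\<in>V. \<Sum>x\<in>V. \<Sum>y\<in>V. \<bar>of_bool (f x y z) - F x y z\<bar>)"
  have E: "E \<le> \<tau>"
  proof -
    have "E = (\<Sum>z\<in>V. \<Sum>x\<in>V. \<Sum>y\<in>V. of_bool (f x y z \<noteq> f (\<xi> z (\<iota> z x)) y z))"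
      unfolding E_def F_def by (intro sum.cong refl) auto
    with err show ?thesis by simp
  qed
  have E1: "(\<Sum>q\<in>?U. \<bar>?f q - (\<lambda>(x, y, z). F x y z) q\<bar>) = E"
    unfolding sum_triple E_def by (subst sum3_rotate) simp
  have E2: "(\<Sum>q\<in>?U. \<bar>?f q - (\<lambda>(x, y, z). F x z y) q\<bar>) = E"
    unfolding sum_triple E_def by (subst sum.swap) (simp add: sym(2))
  have E3: "(\<Sum>q\<in>?U. \<bar>?f q - (\<lambda>(x, y, z). F y z x) q\<bar>) = E"
    unfolding sum_triple E_def using sym by simp
  \<comment> \<open>The plain sum of the differences is a pairing with the constant weight 1, a
    single product term; hence only one factor \<open>M\<close>.\<close>
  have const: "\<bar>\<Sum>z\<in>V. \<Sum>x\<in>V. \<Sum>y\<in>V. \<Sum>j<M. d j (x, y) * b j y z\<bar> \<le> real M * \<epsilon> * n ^ 3"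
    and paired: "\<bar>\<Sum>z\<in>V. \<Sum>x\<in>V. \<Sum>y\<in>V. (\<Sum>i<M. \<alpha> i x z * \<beta> i y z) * (\<Sum>j<M. d j (x, y) * b j y z)\<bar>
      \<le> real M ^ 2 * \<epsilon> * n ^ 3"
    if d: "\<And>j A B. j < M \<Longrightarrow> A \<subseteq> V \<Longrightarrow> B \<subseteq> V \<Longrightarrow> \<bar>\<Sum>q\<in>A \<times> B. d j q\<bar> \<le> \<epsilon> * n ^ 2"
      and \<alpha>: "\<And>i x z. 0 \<le> \<alpha> i x z \<and> \<alpha> i x z \<le> 1" and \<beta>: "\<And>i y z. 0 \<le> \<beta> i y z \<and> \<beta> i y z \<le> 1"
      and b: "\<And>j y z. 0 \<le> b j y z \<and> b j y z \<le> 1"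
    for d :: "nat \<Rightarrow> 'a \<times> 'a \<Rightarrow> real" and \<alpha> \<beta> b :: "nat \<Rightarrow> 'a \<Rightarrow> 'a \<Rightarrow> real"
  proof -
    have "\<bar>\<Sum>z\<in>V. \<Sum>x\<in>V. \<Sum>y\<in>V. (\<Sum>i<1::nat. 1 * 1) * (\<Sum>j<M. d j (x, y) * b j y z)\<bar>
       \<le> card V * (real 1 * (real M * (\<epsilon> * n ^ 2)))"
      by (rule triangle_cut_le[OF fin d]) (use b in auto)
    then show "\<bar>\<Sum>z\<in>V. \<Sum>x\<in>V. \<Sum>y\<in>V. \<Sum>j<M. d j (x, y) * b j y z\<bar> \<le> real M * \<epsilon> * n ^ 3"
      by (simp add: n_def power2_eq_square power3_eq_cube mult.assoc mult.left_commute)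
    have "\<bar>\<Sum>z\<in>V. \<Sum>x\<in>V. \<Sum>y\<in>V. (\<Sum>i<M. \<alpha> i x z * \<beta> i y z) * (\<Sum>j<M. d j (x, y) * b j y z)\<bar>
       \<le> card V * (real M * (real M * (\<epsilon> * n ^ 2)))"
      using \<alpha> \<beta> b by (intro triangle_cut_le[OF fin d]) simp_all
    then show "\<bar>\<Sum>z\<in>V. \<Sum>x\<in>V. \<Sum>y\<in>V. (\<Sum>i<M. \<alpha> i x z * \<beta> i y z) * (\<Sum>j<M. d j (x, y) * b j y z)\<bar>
      \<le> real M ^ 2 * \<epsilon> * n ^ 3"
      by (simp add: n_def power2_eq_square power3_eq_cube mult.assoc mult.left_commute)
  qed
  have M2: "real M * \<epsilon> * n ^ 3 \<le> real M ^ 2 * \<epsilon> * n ^ 3"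
  proof -
    have "M \<le> M ^ 2" by (simp add: power2_eq_square)
    then have "real M \<le> real M ^ 2" by (metis of_nat_le_iff of_nat_power)
    then show ?thesis using assms(2) by (intro mult_right_mono) (auto simp: n_def)
  qed
  have diff1: "F x z y - G x y z = (\<Sum>j<M. (u j (x, y) - a (u j) (x, y)) * v j (z, y))" if "y \<in> V" for x y z
    unfolding F_eq[OF that] G_def by (simp add: sum_subtractf left_diff_distrib)
  have diff2: "G x y z - H x y z = (\<Sum>j<M. (v j (z, y) - a (v j) (z, y)) * a (u j) (x, y))" for x y z
    unfolding G_def H_def sum_subtractf[symmetric] by (intro sum.cong refl) (simp add: algebra_simps)
  \<comment> \<open>\<open>E\<close> enters once as the distance of \<open>f\<close> from
    \<open>F x z y\<close> and twice from exchanging \<open>f\<close> for the test function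
    \<open>F x y z\<close>; the cut terms enter with weights 2 and 1. The variable held fixed is
    \<open>z\<close>, on which \<open>u j (x, y)\<close> does not depend.\<close>
  have step1: "(\<Sum>q\<in>?U. \<bar>?f q - (\<lambda>(x, y, z). G x y z) q\<bar>)
     \<le> 3 * \<tau> + 3 * real M ^ 2 * \<epsilon> * n ^ 3"
  proof -
    have p1: "\<bar>\<Sum>q\<in>?U. (\<lambda>(x, y, z). F x y z) q * ((\<lambda>(x, y, z). F x z y) q - (\<lambda>(x, y, z). G x y z) q)\<bar>
      \<le> real M ^ 2 * \<epsilon> * n ^ 3"
    proof -
      have "(\<Sum>q\<in>?U. (\<lambda>(x, y, z). F x y z) q * ((\<lambda>(x, y, z). F x z y) q - (\<lambda>(x, y, z). G x y z) q))
        = (\<Sum>z\<in>V. \<Sum>x\<in>V. \<Sum>y\<in>V. F x y z * (F x z y - G x y z))"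
        unfolding sum_triple by (subst sum3_rotate) simp
      also have "\<dots> = (\<Sum>z\<in>V. \<Sum>x\<in>V. \<Sum>y\<in>V. (\<Sum>i<M. u i (x, z) * v i (y, z)) *
          (\<Sum>j<M. (u j (x, y) - a (u j) (x, y)) * v j (z, y)))"
        by (intro sum.cong refl) (simp only: F_eq[symmetric] diff1[symmetric])
      finally show ?thesis
        using paired[of "\<lambda>j q. u j q - a (u j) q" "\<lambda>i x z. u i (x, z)" "\<lambda>i y z. v i (y, z)" "\<lambda>j y z. v j (z, y)"]
          cut_u u01 v01 by simp
    qed
    have p2: "\<bar>\<Sum>q\<in>?U. (\<lambda>(x, y, z). F x z y) q - (\<lambda>(x, y, z). G x y z) q\<bar> \<le> real M * \<epsilon> * n ^ 3"
    proof -
      have "(\<Sum>q\<in>?U. (\<lambda>(x, y, z). F x z y) q - (\<lambda>(x, y, z). G x y z) q)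
        = (\<Sum>z\<in>V. \<Sum>x\<in>V. \<Sum>y\<in>V. F x z y - G x y z)"
        unfolding sum_triple by (subst sum3_rotate) simp
      also have "\<dots> = (\<Sum>z\<in>V. \<Sum>x\<in>V. \<Sum>y\<in>V. (\<Sum>j<M. (u j (x, y) - a (u j) (x, y)) * v j (z, y)))"
        by (intro sum.cong refl) (simp only: diff1)
      finally show ?thesis
        using const[of "\<lambda>j q. u j q - a (u j) q" "\<lambda>i x z. u i (x, z)" "\<lambda>i y z. v i (y, z)" "\<lambda>j y z. v j (z, y)"]
          cut_u u01 v01 by simp
    qed
    have "(\<Sum>q\<in>?U. \<bar>?f q - (\<lambda>(x, y, z). G x y z) q\<bar>) \<le> E + 2 * E
      + 2 * \<bar>\<Sum>q\<in>?U. (\<lambda>(x, y, z). F x y z) q * ((\<lambda>(x, y, z). F x z y) q - (\<lambda>(x, y, z). G x y z) q)\<bar>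
      + \<bar>\<Sum>q\<in>?U. (\<lambda>(x, y, z). F x z y) q - (\<lambda>(x, y, z). G x y z) q\<bar>"
      using replace_le[where f = ?f and g = "\<lambda>(x, y, z). F x z y" and g' = "\<lambda>(x, y, z). G x y z"
          and k = "\<lambda>(x, y, z). F x y z" and U = ?U] G01 F01 unfolding E1 E2 by force
    with p1 p2 M2 E show ?thesis by linarith
  qed
  \<comment> \<open>The starting error is now that of \<open>G\<close>; the replacement adds
    \<open>2 * \<tau>\<close> and three more cut terms. The variable held fixed is \<open>x\<close>,
    on which \<open>v j (z, y)\<close> does not depend.\<close>
  have step2: "(\<Sum>q\<in>?U. \<bar>?f q - (\<lambda>(x, y, z). H x y z) q\<bar>)
     \<le> 5 * \<tau> + 6 * real M ^ 2 * \<epsilon> * n ^ 3"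
  proof -
    have F3: "F y z x = (\<Sum>i<M. v i (z, x) * u i (y, x))" if "x \<in> V" for x y z
      unfolding F_eq[OF that] by (simp add: mult.commute)
    have p1: "\<bar>\<Sum>q\<in>?U. (\<lambda>(x, y, z). F y z x) q * ((\<lambda>(x, y, z). G x y z) q - (\<lambda>(x, y, z). H x y z) q)\<bar>
      \<le> real M ^ 2 * \<epsilon> * n ^ 3"
    proof -
      have "(\<Sum>q\<in>?U. (\<lambda>(x, y, z). F y z x) q * ((\<lambda>(x, y, z). G x y z) q - (\<lambda>(x, y, z). H x y z) q))
        = (\<Sum>x\<in>V. \<Sum>y\<in>V. \<Sum>z\<in>V. F y z x * (G x y z - H x y z))"
        unfolding sum_triple by simp
      also have "\<dots> = (\<Sum>x\<in>V. \<Sum>z\<in>V. \<Sum>y\<in>V. F y z x * (G x y z - H x y z))"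
        by (intro sum.cong refl sum.swap)
      also have "\<dots> = (\<Sum>x\<in>V. \<Sum>z\<in>V. \<Sum>y\<in>V. (\<Sum>i<M. v i (z, x) * u i (y, x)) *
          (\<Sum>j<M. (v j (z, y) - a (v j) (z, y)) * a (u j) (x, y)))"
        by (intro sum.cong refl) (simp only: F3[symmetric] diff2[symmetric])
      finally show ?thesis
        using paired[of "\<lambda>j q. v j q - a (v j) q" "\<lambda>i z x. v i (z, x)" "\<lambda>i y x. u i (y, x)" "\<lambda>j y x. a (u j) (x, y)"]
          cut_v u01 v01 a01 by simp
    qed
    have p2: "\<bar>\<Sum>q\<in>?U. (\<lambda>(x, y, z). G x y z) q - (\<lambda>(x, y, z). H x y z) q\<bar> \<le> real M * \<epsilon> * n ^ 3"
    proof -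
      have "(\<Sum>q\<in>?U. (\<lambda>(x, y, z). G x y z) q - (\<lambda>(x, y, z). H x y z) q)
        = (\<Sum>x\<in>V. \<Sum>y\<in>V. \<Sum>z\<in>V. G x y z - H x y z)"
        unfolding sum_triple by simp
      also have "\<dots> = (\<Sum>x\<in>V. \<Sum>z\<in>V. \<Sum>y\<in>V. G x y z - H x y z)"
        by (intro sum.cong refl sum.swap)
      also have "\<dots> = (\<Sum>x\<in>V. \<Sum>z\<in>V. \<Sum>y\<in>V. (\<Sum>j<M. (v j (z, y) - a (v j) (z, y)) * a (u j) (x, y)))"
        by (intro sum.cong refl) (simp only: diff2)
      finally show ?thesis
        using const[of "\<lambda>j q. v j q - a (v j) q" "\<lambda>i z x. v i (z, x)" "\<lambda>i y x. u i (y, x)" "\<lambda>j y x. a (u j) (x, y)"]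
          cut_v u01 v01 a01 by simp
    qed
    have "(\<Sum>q\<in>?U. \<bar>?f q - (\<lambda>(x, y, z). H x y z) q\<bar>)
      \<le> (\<Sum>q\<in>?U. \<bar>?f q - (\<lambda>(x, y, z). G x y z) q\<bar>) + 2 * E
      + 2 * \<bar>\<Sum>q\<in>?U. (\<lambda>(x, y, z). F y z x) q * ((\<lambda>(x, y, z). G x y z) q - (\<lambda>(x, y, z). H x y z) q)\<bar>
      + \<bar>\<Sum>q\<in>?U. (\<lambda>(x, y, z). G x y z) q - (\<lambda>(x, y, z). H x y z) q\<bar>"
      using replace_le[where f = ?f and g = "\<lambda>(x, y, z). G x y z" and g' = "\<lambda>(x, y, z). H x y z"
          and k = "\<lambda>(x, y, z). F y z x" and U = ?U] G01 H01 unfolding E3 by force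
    with p1 p2 M2 E step1 show ?thesis by linarith
  qed
  have "H x y z = H x' y' z'"
    if "x \<in> V" "x' \<in> V" "y \<in> V" "y' \<in> V" "z \<in> V" "z' \<in> V" "p x = p x'" "p y = p y'" "p z = p z'"
    for x x' y y' z z'
  proof -
    have "a w (x, y) = a w (x', y')" "a w (z, y) = a w (z', y')" for w
      unfolding a_def by (rule cell_constD[OF cell_const_cell_avg], use that in auto)+
    then show ?thesis by (simp add: H_def)
  qed
  moreover have "(\<Sum>x\<in>V. \<Sum>y\<in>V. \<Sum>z\<in>V. \<bar>of_bool (f x y z) - H x y z\<bar>)
      \<le> 5 * \<tau> + 6 * real M ^ 2 * \<epsilon> * real (card V) ^ 3"
    using step2 unfolding sum_triple n_def by simp
  ultimately show ?thesis by (intro exI[of _ H] conjI ballI impI)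
qed

text \<open>Counted over ordered triples, degenerate ones included, which makes it a plain iterated
  sum; \<open>h\<close> is a set of ordered label triples and need not be symmetric.\<close>

definition step_err :: "'a graph3 \<Rightarrow> ('a \<Rightarrow> nat) \<Rightarrow> (nat \<times> nat \<times> nat) set \<Rightarrow> real" where
  "step_err G p h = (\<Sum>x\<in>verts G. \<Sum>y\<in>verts G. \<Sum>z\<in>verts G.
     of_bool (({x, y, z} \<in> edges G) \<noteq> ((p x, p y, p z) \<in> h)))"

text \<open>The real-valued step function \<open>H\<close> is rounded at 1/2. Where the rounded
  value is wrong, \<open>H\<close> is off by at least 1/2, so the error at most doubles.\<close>

lemma no_config_imp_step_approximation:
  fixes \<delta> :: real
  assumes "0 < \<delta>"
  shows "\<exists>q N. \<forall>G :: 'a graph3. finite (verts G) \<longrightarrow> \<not> ubar_config G k \<longrightarrow> N \<le> card (verts G) \<longrightarrow>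
    (\<exists>p h. (\<forall>x\<in>verts G. p x < q) \<and> step_err G p h \<le> \<delta> * real (card (verts G)) ^ 3)"
proof -
  \<comment> \<open>After rounding the error is at most
    \<open>2 * (15 * \<delta>' + 6 * (M ^ 2 * \<epsilon>))\<close> times \<open>n ^ 3\<close>. This
    choice, and \<open>\<epsilon>\<close> below, make each of the two terms at most
    \<open>\<delta> / 2\<close>.\<close>
  define \<delta>' where "\<delta>' = min 1 (\<delta> / 60)"
  have \<delta>': "0 < \<delta>'" "\<delta>' \<le> 1" "\<delta>' \<le> \<delta> / 60" using assms by (auto simp: \<delta>'_def)
  obtain M :: nat and N where MN: "\<And>G :: 'a graph3. finite (verts G) \<Longrightarrow> \<not> ubar_config G k \<Longrightarrow> N \<le> card (verts G) \<Longrightarrow>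
    \<exists>\<xi> \<iota>. (\<forall>z\<in>verts G. \<forall>i. \<xi> z i \<in> verts G) \<and> (\<forall>z\<in>verts G. \<forall>x. \<iota> z x < M) \<and>
      (\<Sum>z\<in>verts G. \<Sum>x\<in>verts G. \<Sum>y\<in>verts G.
         of_bool (({x, y, z} \<in> edges G) \<noteq> ({\<xi> z (\<iota> z x), y, z} \<in> edges G))) \<le> 3 * \<delta>' * real (card (verts G)) ^ 3"
    using slice_approximation[OF \<delta>'(1,2), of k] by blast
  define \<epsilon> where "\<epsilon> = \<delta> / (24 * (real M ^ 2 + 1))"
  have "real M ^ 2 + 1 > 0" by (simp add: add_nonneg_pos)
  then have \<epsilon>: "\<epsilon> > 0" using assms by (simp add: \<epsilon>_def)
  have "real M ^ 2 * \<epsilon> \<le> (real M ^ 2 + 1) * \<epsilon>" using \<epsilon> by (intro mult_right_mono) auto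
  also have "\<dots> = \<delta> / 24"
  proof -
    have "c * (\<delta> / (24 * c)) = \<delta> / 24" if "c > 0" for c :: real using that by simp
    from this[OF \<open>real M ^ 2 + 1 > 0\<close>] show ?thesis unfolding \<epsilon>_def .
  qed
  finally have M\<epsilon>: "real M ^ 2 * \<epsilon> \<le> \<delta> / 24" .
  from weak_regularity[OF \<epsilon>, of "2 * M"]
  obtain q where "\<forall>(V :: 'a set) \<W>. finite V \<longrightarrow> finite \<W> \<longrightarrow> card \<W> \<le> 2 * M \<longrightarrow>
    (\<forall>w\<in>\<W>. \<forall>u\<in>V \<times> V. 0 \<le> w u \<and> w u \<le> 1) \<longrightarrow>
    (\<exists>p :: 'a \<Rightarrow> nat. (\<forall>x\<in>V. p x < q) \<and> (\<forall>w\<in>\<W>. cut_regular \<epsilon> V p w))" ..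
  note q = this[THEN spec, THEN spec, THEN mp, THEN mp, THEN mp, THEN mp]
  show ?thesis
  proof (rule exI[of _ q], rule exI[of _ N], intro allI impI)
    fix G :: "'a graph3"
    assume fin: "finite (verts G)" and no: "\<not> ubar_config G k" and N: "N \<le> card (verts G)"
    define V where "V = verts G"
    define n where "n = real (card V)"
    define f where "f = (\<lambda>x y z. {x, y, z} \<in> edges G)"
    obtain \<xi> \<iota> where \<iota>: "\<And>z x. z \<in> V \<Longrightarrow> \<iota> z x < M"
      and err: "(\<Sum>z\<in>V. \<Sum>x\<in>V. \<Sum>y\<in>V. of_bool (f x y z \<noteq> f (\<xi> z (\<iota> z x)) y z)) \<le> 3 * \<delta>' * n ^ 3"
      using MN[OF fin no N] unfolding V_def[symmetric] f_def n_def by blast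
    define u where "u = (\<lambda>j (x, y). of_bool (\<iota> y x = j) :: real)"
    define v where "v = (\<lambda>j (z, y). of_bool (f (\<xi> y j) z y) :: real)"
    have "card (u ` {..<M} \<union> v ` {..<M}) \<le> 2 * M"
      using card_Un_le[of "u ` {..<M}" "v ` {..<M}"] card_image_le[of "{..<M}" u] card_image_le[of "{..<M}" v] by simp
    moreover have "\<forall>w\<in>u ` {..<M} \<union> v ` {..<M}. \<forall>c\<in>V \<times> V. 0 \<le> w c \<and> w c \<le> 1"
      by (auto simp: u_def v_def)
    ultimately obtain p :: "'a \<Rightarrow> nat" where p: "\<forall>x\<in>V. p x < q"
      and reg: "\<forall>w\<in>u ` {..<M} \<union> v ` {..<M}. cut_regular \<epsilon> V p w"
      using q[of V "u ` {..<M} \<union> v ` {..<M}"] fin unfolding V_def[symmetric] by blast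
    have f_sym: "f x y z = f y x z" "f x y z = f x z y" for x y z
      unfolding f_def by (simp_all add: insert_commute)
    have "\<exists>H :: 'a \<Rightarrow> 'a \<Rightarrow> 'a \<Rightarrow> real.
      (\<forall>x\<in>V. \<forall>x'\<in>V. \<forall>y\<in>V. \<forall>y'\<in>V. \<forall>z\<in>V. \<forall>z'\<in>V.
        p x = p x' \<longrightarrow> p y = p y' \<longrightarrow> p z = p z' \<longrightarrow> H x y z = H x' y' z') \<and>
      (\<Sum>x\<in>V. \<Sum>y\<in>V. \<Sum>z\<in>V. \<bar>of_bool (f x y z) - H x y z\<bar>)
        \<le> 5 * (3 * \<delta>' * n ^ 3) + 6 * real M ^ 2 * \<epsilon> * real (card V) ^ 3"
    proof (rule triangle_approximation[where \<iota> = \<iota> and \<xi> = \<xi>])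
      show "finite V" using fin by (simp add: V_def)
      show "0 \<le> \<epsilon>" using \<epsilon> by simp
      show "f x y z = f y x z" "f x y z = f x z y" for x y z by (rule f_sym)+
      show "\<iota> z x < M" if "z \<in> V" for x z using \<iota> that .
      show "(\<Sum>z\<in>V. \<Sum>x\<in>V. \<Sum>y\<in>V. of_bool (f x y z \<noteq> f (\<xi> z (\<iota> z x)) y z)) \<le> 3 * \<delta>' * n ^ 3" by (rule err)
      show "cut_regular \<epsilon> V p (\<lambda>(x, y). of_bool (\<iota> y x = j))" if "j < M" for j
        using bspec[OF reg, of "u j"] that unfolding u_def by blast
      show "cut_regular \<epsilon> V p (\<lambda>(z, y). of_bool (f (\<xi> y j) z y))" if "j < M" for j
        using bspec[OF reg, of "v j"] that unfolding v_def by blast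
    qed
    then obtain H :: "'a \<Rightarrow> 'a \<Rightarrow> 'a \<Rightarrow> real" where
      H: "\<forall>x\<in>V. \<forall>x'\<in>V. \<forall>y\<in>V. \<forall>y'\<in>V. \<forall>z\<in>V. \<forall>z'\<in>V.
        p x = p x' \<longrightarrow> p y = p y' \<longrightarrow> p z = p z' \<longrightarrow> H x y z = H x' y' z'"
      and H_err: "(\<Sum>x\<in>V. \<Sum>y\<in>V. \<Sum>z\<in>V. \<bar>of_bool (f x y z) - H x y z\<bar>)
        \<le> 5 * (3 * \<delta>' * n ^ 3) + 6 * real M ^ 2 * \<epsilon> * n ^ 3" unfolding n_def by blast
    define h where "h = {(i, j, k). \<exists>x\<in>V. \<exists>y\<in>V. \<exists>z\<in>V. i = p x \<and> j = p y \<and> k = p z \<and> H x y z > 1 / 2}"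
    have h: "(p x, p y, p z) \<in> h \<longleftrightarrow> H x y z > 1 / 2" if xyz: "x \<in> V" "y \<in> V" "z \<in> V" for x y z
    proof
      assume "(p x, p y, p z) \<in> h"
      then obtain x' y' z' where "x' \<in> V" "y' \<in> V" "z' \<in> V" "p x = p x'" "p y = p y'" "p z = p z'" "H x' y' z' > 1 / 2"
        unfolding h_def by blast
      moreover from this have "H x y z = H x' y' z'" using H xyz by blast
      ultimately show "H x y z > 1 / 2" by simp
    qed (use xyz in \<open>auto simp: h_def\<close>)
    have "step_err G p h \<le> (\<Sum>x\<in>V. \<Sum>y\<in>V. \<Sum>z\<in>V. 2 * \<bar>of_bool (f x y z) - H x y z\<bar>)"
      unfolding step_err_def V_def[symmetric]
    proof (intro sum_mono)
      fix x y z assume "x \<in> V" "y \<in> V" "z \<in> V"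
      from h[OF this] show "of_bool (({x, y, z} \<in> edges G) \<noteq> ((p x, p y, p z) \<in> h)) \<le> 2 * \<bar>of_bool (f x y z) - H x y z\<bar>"
        by (cases "f x y z") (auto simp: f_def)
    qed
    also have "\<dots> = 2 * (\<Sum>x\<in>V. \<Sum>y\<in>V. \<Sum>z\<in>V. \<bar>of_bool (f x y z) - H x y z\<bar>)"
      by (simp add: sum_distrib_left)
    also have "\<dots> \<le> 2 * (15 * \<delta>' + 6 * (real M ^ 2 * \<epsilon>)) * n ^ 3"
      using H_err by (simp add: algebra_simps)
    also have "\<dots> \<le> \<delta> * n ^ 3"
      using \<delta>'(3) M\<epsilon> by (intro mult_right_mono) (auto simp: n_def)
    finally have "step_err G p h \<le> \<delta> * n ^ 3" .
    with p show "\<exists>p h. (\<forall>x\<in>verts G. p x < q) \<and> step_err G p h \<le> \<delta> * real (card (verts G)) ^ 3"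
      unfolding V_def n_def by blast
  qed
qed

section \<open>Equitable refinements of a labelling\<close>

definition equitable :: "'a set \<Rightarrow> ('a \<Rightarrow> nat) \<Rightarrow> nat \<Rightarrow> bool" where
  "equitable V p t \<longleftrightarrow> (\<forall>x\<in>V. p x < t) \<and>
     (\<forall>i<t. \<forall>j<t. card {x \<in> V. p x = i} \<le> card {x \<in> V. p x = j} + 1)"

lemma sum_card_classes:
  assumes "finite V" "\<forall>x\<in>V. p x < (t :: nat)"
  shows "(\<Sum>i<t. card {x \<in> V. p x = i}) = card V"
proof -
  have "card V = card (\<Union>i\<in>{..<t}. {x \<in> V. p x = i})"
    using assms(2) by (intro arg_cong[where f = card]) auto
  also have "\<dots> = (\<Sum>i<t. card {x \<in> V. p x = i})"
    using assms(1) by (intro card_UN_disjoint) auto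
  finally show ?thesis by simp
qed

lemma equitable_card:
  assumes "finite V" "equitable V p t" "i < t"
  shows "t * card {x \<in> V. p x = i} \<le> card V + t" "card V \<le> t * card {x \<in> V. p x = i} + t"
proof -
  let ?c = "\<lambda>i. card {x \<in> V. p x = i}"
  have eq: "(\<Sum>j<t. ?c j) = card V" using assms by (intro sum_card_classes) (auto simp: equitable_def)
  have le: "?c i \<le> ?c j + 1" "?c j \<le> ?c i + 1" if "j < t" for j
    using assms that unfolding equitable_def by blast+
  have "(\<Sum>j<t. ?c i) \<le> (\<Sum>j<t. ?c j + 1)" by (rule sum_mono) (use le in blast)
  moreover have "(\<Sum>j<t. ?c j) \<le> (\<Sum>j<t. ?c i + 1)" by (rule sum_mono) (use le in blast)
  ultimately show "t * ?c i \<le> card V + t" "card V \<le> t * ?c i + t"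
    unfolding eq sum.distrib by (simp_all add: mult.commute)
qed

text \<open>The classes of \<open>j * t div n\<close> are the intervals between consecutive ceilings
  \<open>g i\<close> of \<open>i * n / t\<close>, so their sizes differ from \<open>n / t\<close> by
  less than 1. The inequalities say this multiplied by \<open>t\<close>.\<close>

lemma interval_class_card:
  fixes n t i :: nat
  assumes "0 < n" "i < t"
  shows "n < t * card {j. j < n \<and> j * t div n = i} + t" "t * card {j. j < n \<and> j * t div n = i} < n + t"
proof -
  define g where "g = (\<lambda>i. (i * n + t - 1) div t)"
  have t: "0 < t" using assms by simp
  have g: "g i \<le> j \<longleftrightarrow> i * n \<le> j * t" for i j
  proof
    assume "g i \<le> j"
    then have "(i * n + t - 1) div t < Suc j" by (simp add: g_def)
    then have "i * n + t - 1 < Suc j * t" using t by (simp only: div_less_iff_less_mult)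
    then show "i * n \<le> j * t" using t by simp
  next
    assume "i * n \<le> j * t"
    then have "i * n + t - 1 < Suc j * t" using t by simp
    then have "(i * n + t - 1) div t < Suc j" using t by (simp only: div_less_iff_less_mult)
    then show "g i \<le> j" by (simp add: g_def)
  qed
  have "{j. j < n \<and> j * t div n = i} = {g i..<g (Suc i)}"
  proof (intro set_eqI iffI)
    fix j assume "j \<in> {j. j < n \<and> j * t div n = i}"
    then have "i * n \<le> j * t" "j * t < Suc i * n"
      using assms(1) by (auto simp: div_less_iff_less_mult[symmetric] simp del: mult_Suc)
    then show "j \<in> {g i..<g (Suc i)}" using g[of i j] g[of "Suc i" j] by auto
  next
    fix j assume "j \<in> {g i..<g (Suc i)}"
    then have *: "i * n \<le> j * t" "j * t < Suc i * n" using g[of i j] g[of "Suc i" j] by auto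
    have "Suc i * n \<le> t * n" using assms(2) by (intro mult_right_mono) auto
    with * have "j * t < n * t" unfolding mult.commute[of t n] by linarith
    then have "j < n" by (simp only: mult_less_cancel2)
    moreover have "j * t div n = i" using * assms(1)
      by (metis div_nat_eqI mult.commute)
    ultimately show "j \<in> {j. j < n \<and> j * t div n = i}" by simp
  qed
  then have card: "card {j. j < n \<and> j * t div n = i} = g (Suc i) - g i" by simp
  have gb: "i * n \<le> t * g i" "t * g i < i * n + t" for i
  proof -
    show "i * n \<le> t * g i" using g[of i "g i"] by (simp add: mult.commute)
    have "t * g i \<le> i * n + t - 1" unfolding g_def by simp
    then show "t * g i < i * n + t" using t by linarith
  qed
  have "g i \<le> g (Suc i)" unfolding g_def by (intro div_le_mono) auto
  then have "t * (g (Suc i) - g i) + t * g i = t * g (Suc i)" by (simp add: diff_mult_distrib2)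
  with gb[of i] gb[of "Suc i"] show "n < t * card {j. j < n \<and> j * t div n = i} + t"
    "t * card {j. j < n \<and> j * t div n = i} < n + t"
    unfolding card by (simp_all)
qed

text \<open>Sort \<open>V\<close> by colour and cut the list into \<open>t\<close> consecutive
  intervals of nearly equal length. Sending an interval with several colours to its largest colour
  is injective: a later such interval starts at or above that colour and then rises. So there are at
  most \<open>q\<close> of them.\<close>

lemma equitable_refinement:
  fixes c :: "'a \<Rightarrow> nat"
  assumes fin: "finite V" and c: "\<forall>x\<in>V. c x < q" and "t \<ge> 1"
  obtains p where "equitable V p t" "card {i. i < t \<and> (\<exists>x\<in>V. \<exists>y\<in>V. p x = i \<and> p y = i \<and> c x \<noteq> c y)} \<le> q"
proof (cases "V = {}")
  case True
  then show thesis by (intro that[of "\<lambda>_. 0"]) (auto simp: equitable_def)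
next
  case False
  define n where "n = card V"
  have n: "n > 0" using False fin by (simp add: n_def card_gt_0_iff)
  obtain zs where zs: "set zs = V" "distinct zs" using finite_distinct_list[OF fin] by blast
  define xs where "xs = sort_key c zs"
  have xs: "set xs = V" "distinct xs" "length xs = n" "sorted (map c xs)"
    using zs distinct_card[of zs] by (simp_all add: xs_def n_def)
  define pos where "pos = (\<lambda>x. THE i. i < n \<and> xs ! i = x)"
  have pos: "pos x < n" "xs ! pos x = x" if x: "x \<in> V" for x
  proof -
    obtain i where i: "i < n" "xs ! i = x" using xs x by (metis in_set_conv_nth)
    have "pos x = i" unfolding pos_def
      using i xs by (intro the_equality) (auto simp: nth_eq_iff_index_eq)
    with i show "pos x < n" "xs ! pos x = x" by auto
  qed
  have pos_nth: "xs ! j \<in> V" "pos (xs ! j) = j" if "j < n" for j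
  proof -
    show "xs ! j \<in> V" using xs that nth_mem by metis
    from pos[OF this] show "pos (xs ! j) = j" using xs that by (simp add: nth_eq_iff_index_eq)
  qed
  have mono: "c x \<le> c y" if "x \<in> V" "y \<in> V" "pos x \<le> pos y" for x y
    using sorted_nth_mono[OF xs(4), of "pos x" "pos y"] pos[OF that(1)] pos[OF that(2)] that(3) xs(3) by simp
  define p where "p = (\<lambda>x. pos x * t div n)"
  have class_card: "card {x \<in> V. p x = i} = card {j. j < n \<and> j * t div n = i}" for i
  proof (rule bij_betw_same_card)
    show "bij_betw pos {x \<in> V. p x = i} {j. j < n \<and> j * t div n = i}"
      by (rule bij_betwI[where g = "\<lambda>j. xs ! j"]) (auto simp: p_def pos pos_nth)
  qed
  have pt: "p x < t" if "x \<in> V" for x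
    using pos[OF that] assms(3) n unfolding p_def by (simp add: div_less_iff_less_mult mult.commute)
  have "equitable V p t"
    unfolding equitable_def
  proof (intro conjI ballI allI impI)
    fix i j assume "i < t" "j < t"
    then have "t * card {x \<in> V. p x = i} < t * (card {x \<in> V. p x = j} + 2)"
      using interval_class_card[OF n, of i t] interval_class_card[OF n, of j t]
      unfolding class_card by simp
    then have "card {x \<in> V. p x = i} < card {x \<in> V. p x = j} + 2" by (simp only: mult_less_cancel1)
    then show "card {x \<in> V. p x = i} \<le> card {x \<in> V. p x = j} + 1" by simp
  qed (rule pt)
  moreover have "card {i. i < t \<and> (\<exists>x\<in>V. \<exists>y\<in>V. p x = i \<and> p y = i \<and> c x \<noteq> c y)} \<le> q"
  proof -
    define J where "J = {i. i < t \<and> (\<exists>x\<in>V. \<exists>y\<in>V. p x = i \<and> p y = i \<and> c x \<noteq> c y)}"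
    define L where "L = (\<lambda>i. Max (c ` {x \<in> V. p x = i}))"
    have L: "\<exists>x\<in>V. p x = i \<and> c x = L i" "\<And>x. x \<in> V \<Longrightarrow> p x = i \<Longrightarrow> c x \<le> L i" if "i \<in> J" for i
    proof -
      have ne: "c ` {x \<in> V. p x = i} \<noteq> {}" "finite (c ` {x \<in> V. p x = i})" using that fin by (auto simp: J_def)
      from Max_in[OF ne(2,1)] show "\<exists>x\<in>V. p x = i \<and> c x = L i" by (auto simp: L_def)
      show "c x \<le> L i" if "x \<in> V" "p x = i" for x unfolding L_def using ne(2) that by (intro Max_ge) auto
    qed
    have lt: "L i < L j" if ij: "i \<in> J" "j \<in> J" "i < j" for i j
    proof -
      obtain x where x: "x \<in> V" "p x = i" "c x = L i" using L(1)[OF ij(1)] by blast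
      obtain y1 y2 where y12: "y1 \<in> V" "y2 \<in> V" "p y1 = j" "p y2 = j" "c y1 \<noteq> c y2"
        using ij(2) unfolding J_def by blast
      then obtain y y' where y: "y \<in> V" "y' \<in> V" "p y = j" "p y' = j" "c y < c y'"
        by (cases "c y1 < c y2") (use y12 in \<open>auto simp: not_less le_less\<close>)
      have "pos x \<le> pos y"
      proof (rule ccontr)
        assume "\<not> pos x \<le> pos y"
        then have "pos y * t div n \<le> pos x * t div n" by (intro div_le_mono mult_right_mono) auto
        then show False using x y ij(3) by (simp add: p_def)
      qed
      then have "L i \<le> c y" using mono[OF x(1) y(1)] x(3) by simp
      also have "\<dots> < c y'" by (rule y(5))
      also have "\<dots> \<le> L j" by (rule L(2)[OF ij(2) y(2,4)])
      finally show ?thesis .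
    qed
    have "inj_on L J"
    proof (rule inj_onI)
      fix i j assume "i \<in> J" "j \<in> J" "L i = L j"
      then show "i = j" using lt[of i j] lt[of j i] by (cases i j rule: linorder_cases) auto
    qed
    moreover have "L ` J \<subseteq> {..<q}" using L(1) c by fastforce
    ultimately have "card J \<le> card {..<q}" by (intro card_inj_on_le) auto
    then show ?thesis by (simp add: J_def)
  qed
  ultimately show thesis by (rule that)
qed

text \<open>Triples that meet \<open>I\<close> are written off, at most
  \<open>3 * card I * n ^ 2\<close> of them. Outside \<open>I\<close> each class has a single
  colour, so a pattern on colours induces one on classes.\<close>

lemma step_err_refine:
  assumes fin: "finite (verts G)"
    and imp: "I \<subseteq> verts G"
    and pure: "\<And>x y. x \<in> verts G - I \<Longrightarrow> y \<in> verts G - I \<Longrightarrow> p x = p y \<Longrightarrow> c x = c y"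
  shows "\<exists>h. step_err G p h \<le> step_err G c h0 + 3 * real (card I) * real (card (verts G)) ^ 2"
proof -
  define V where "V = verts G"
  define h where "h = {(i, j, k). \<exists>x\<in>V - I. \<exists>y\<in>V - I. \<exists>z\<in>V - I.
      i = p x \<and> j = p y \<and> k = p z \<and> (c x, c y, c z) \<in> h0}"
  have h: "(p x, p y, p z) \<in> h \<longleftrightarrow> (c x, c y, c z) \<in> h0" if xyz: "x \<in> V - I" "y \<in> V - I" "z \<in> V - I" for x y z
  proof
    assume "(p x, p y, p z) \<in> h"
    then obtain x' y' z' where *: "x' \<in> V - I" "y' \<in> V - I" "z' \<in> V - I" "p x = p x'" "p y = p y'" "p z = p z'"
      "(c x', c y', c z') \<in> h0" unfolding h_def by blast
    then have "c x = c x'" "c y = c y'" "c z = c z'" using xyz pure unfolding V_def by blast+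
    with * show "(c x, c y, c z) \<in> h0" by simp
  qed (use xyz in \<open>auto simp: h_def\<close>)
  have "step_err G p h \<le> (\<Sum>x\<in>V. \<Sum>y\<in>V. \<Sum>z\<in>V. of_bool (({x, y, z} \<in> edges G) \<noteq> ((c x, c y, c z) \<in> h0))
     + (of_bool (x \<in> I) + (of_bool (y \<in> I) + of_bool (z \<in> I))))"
    unfolding step_err_def V_def[symmetric]
  proof (intro sum_mono)
    fix x y z assume "x \<in> V" "y \<in> V" "z \<in> V"
    then show "(of_bool (({x, y, z} \<in> edges G) \<noteq> ((p x, p y, p z) \<in> h)) :: real)
       \<le> of_bool (({x, y, z} \<in> edges G) \<noteq> ((c x, c y, c z) \<in> h0))
     + (of_bool (x \<in> I) + (of_bool (y \<in> I) + of_bool (z \<in> I)))"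
      using h[of x y z] by (cases "x \<in> I"; cases "y \<in> I"; cases "z \<in> I") auto
  qed
  also have "\<dots> = step_err G c h0 + 3 * real (card I) * real (card V) ^ 2"
  proof -
    have I: "(\<Sum>x\<in>V. of_bool (x \<in> I) :: real) = card I"
      using fin imp unfolding V_def by (simp add: sum_of_bool_eq_card Int_absorb1) 
    show ?thesis
      unfolding sum.distrib step_err_def V_def[symmetric]
      by (simp add: I sum_distrib_left[symmetric] power2_eq_square)
  qed
  finally show ?thesis unfolding V_def by blast
qed

text \<open>The lower bound on \<open>t\<close> is carried along for two reasons:
  \<open>vdisc3_homogeneous\<close> prescribes one, and many parts make the triples with two
  vertices in the same part negligible.\<close>

definition approximable :: "'a graph3 set \<Rightarrow> bool" where
  "approximable \<H> \<longleftrightarrow> (\<forall>\<eta>>0. \<forall>t\<^sub>0. \<exists>T N. \<forall>G\<in>\<H>. N \<le> card (verts G) \<longrightarrow>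
     (\<exists>t p h. t\<^sub>0 \<le> t \<and> t \<le> T \<and> equitable (verts G) p t \<and> step_err G p h \<le> \<eta> * real (card (verts G)) ^ 3))"

lemma no_config_imp_approximable:
  fixes \<H> :: "'a graph3 set"
  assumes fin: "\<And>G. G \<in> \<H> \<Longrightarrow> finite (verts G)" and no: "\<And>G. G \<in> \<H> \<Longrightarrow> \<not> ubar_config G k"
  shows "approximable \<H>"
  unfolding approximable_def
proof (intro allI impI)
  fix \<eta> :: real and t\<^sub>0 :: nat assume "\<eta> > 0"
  then obtain q N where qN: "\<And>G :: 'a graph3. finite (verts G) \<Longrightarrow> \<not> ubar_config G k \<Longrightarrow> N \<le> card (verts G) \<Longrightarrow>
    \<exists>p h. (\<forall>x\<in>verts G. p x < q) \<and> step_err G p h \<le> \<eta> / 2 * real (card (verts G)) ^ 3"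
    using no_config_imp_step_approximation[of "\<eta> / 2" k] by (metis half_gt_zero)
  \<comment> \<open>At most \<open>q\<close> classes are impure, each of size at most
    \<open>2 * n / t\<close>. Writing off their triples costs at most
    \<open>6 * q / t * n ^ 3\<close>, which is half of the allowed error once \<open>t\<close>
    reaches \<open>12 * q / \<eta>\<close>.\<close>
  define t where "t = max (max t\<^sub>0 1) (nat \<lceil>12 * real q / \<eta>\<rceil>)"
  have "12 * real q / \<eta> \<le> real t" unfolding t_def by linarith
  then have tq: "12 * real q \<le> \<eta> * real t" using \<open>\<eta> > 0\<close> by (simp add: field_simps)
  have t1: "t \<ge> 1" "t\<^sub>0 \<le> t" by (auto simp: t_def)
  show "\<exists>T N. \<forall>G\<in>\<H>. N \<le> card (verts G) \<longrightarrow>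
     (\<exists>t p h. t\<^sub>0 \<le> t \<and> t \<le> T \<and> equitable (verts G) p t \<and> step_err G p h \<le> \<eta> * real (card (verts G)) ^ 3)"
  proof (rule exI[of _ t], rule exI[of _ "max N t"], intro ballI impI)
    fix G assume G: "G \<in> \<H>" and N: "max N t \<le> card (verts G)"
    define V where "V = verts G"
    define n where "n = real (card V)"
    have finV: "finite V" using fin[OF G] by (simp add: V_def)
    obtain c h0 where c: "\<forall>x\<in>V. c x < q" and h0: "step_err G c h0 \<le> \<eta> / 2 * n ^ 3"
      using qN[OF fin[OF G] no[OF G]] N unfolding V_def n_def by auto
    obtain p where p: "equitable V p t"
      and J: "card {i. i < t \<and> (\<exists>x\<in>V. \<exists>y\<in>V. p x = i \<and> p y = i \<and> c x \<noteq> c y)} \<le> q"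
      using equitable_refinement[OF finV c t1(1)] by blast
    define J where "J = {i. i < t \<and> (\<exists>x\<in>V. \<exists>y\<in>V. p x = i \<and> p y = i \<and> c x \<noteq> c y)}"
    define I where "I = {x \<in> V. p x \<in> J}"
    have pt: "p x < t" if "x \<in> V" for x using p that by (simp add: equitable_def)
    have pure: "c x = c y" if xy: "x \<in> V - I" "y \<in> V - I" "p x = p y" for x y
    proof (rule ccontr)
      assume "c x \<noteq> c y"
      then have "\<exists>x'\<in>V. \<exists>y'\<in>V. p x' = p x \<and> p y' = p x \<and> c x' \<noteq> c y'"
        using xy by (intro bexI[of _ x, OF bexI[of _ y]]) simp_all
      then have "p x \<in> J" using xy(1) pt unfolding J_def by simp
      with xy(1) show False by (simp add: I_def)
    qed
    have "real t * card I \<le> 2 * real q * n"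
    proof -
      have "I = (\<Union>i\<in>J. {x \<in> V. p x = i})" by (auto simp: I_def)
      then have "card I \<le> (\<Sum>i\<in>J. card {x \<in> V. p x = i})"
        using card_UN_le[of J "\<lambda>i. {x \<in> V. p x = i}"] by (simp add: J_def)
      then have "t * card I \<le> t * (\<Sum>i\<in>J. card {x \<in> V. p x = i})" by (rule mult_left_mono) simp
      also have "\<dots> = (\<Sum>i\<in>J. t * card {x \<in> V. p x = i})" by (rule sum_distrib_left)
      also have "\<dots> \<le> (\<Sum>i\<in>J. 2 * card V)"
      proof (rule sum_mono)
        fix i assume "i \<in> J"
        then have "i < t" by (simp add: J_def)
        from equitable_card(1)[OF finV p this] N show "t * card {x \<in> V. p x = i} \<le> 2 * card V"
          unfolding V_def by simp
      qed
      also have "\<dots> \<le> q * (2 * card V)" using J by (simp add: J_def)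
      finally have "real (t * card I) \<le> real (q * (2 * card V))" by (simp only: of_nat_le_iff)
      then show ?thesis by (simp add: n_def mult_ac)
    qed
    then have "6 * (real t * card I) \<le> 12 * real q * n" by linarith
    also have "\<dots> \<le> \<eta> * real t * n" using tq by (rule mult_right_mono) (simp add: n_def)
    finally have "real t * (6 * card I) \<le> real t * (\<eta> * n)" by (simp add: mult_ac)
    then have I: "3 * real (card I) \<le> \<eta> / 2 * n" using t1(1) by simp
    have "\<exists>h. step_err G p h \<le> step_err G c h0 + 3 * real (card I) * real (card (verts G)) ^ 2"
    proof (rule step_err_refine)
      show "finite (verts G)" "I \<subseteq> verts G" using finV by (auto simp: V_def I_def)
      show "c x = c y" if "x \<in> verts G - I" "y \<in> verts G - I" "p x = p y" for x y
        using that unfolding V_def[symmetric] by (rule pure)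
    qed
    then obtain h where "step_err G p h \<le> step_err G c h0 + 3 * real (card I) * n ^ 2"
      unfolding n_def V_def ..
    also have "\<dots> \<le> \<eta> / 2 * n ^ 3 + \<eta> / 2 * n * n ^ 2"
      using h0 I by (intro add_mono mult_right_mono) auto
    also have "\<dots> = \<eta> * n ^ 3" by (simp add: power2_eq_square power3_eq_cube)
    finally have "step_err G p h \<le> \<eta> * n ^ 3" .
    with p t1(2) show "\<exists>t' p h. t\<^sub>0 \<le> t' \<and> t' \<le> t \<and> equitable (verts G) p t' \<and> step_err G p h \<le> \<eta> * real (card (verts G)) ^ 3"
      unfolding V_def n_def by (intro exI[of _ t] exI[of _ p] exI[of _ h] conjI) auto
  qed
qed

section \<open>Homogeneous partitions\<close>

text \<open>Twice \<open>(t - 1) * (t - 2)\<close> is at least \<open>t ^ 2\<close> from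
  \<open>t = 6\<close> on; the constant 12 is 6 with this factor 2 of slack. It converts counts of
  ordered triples into binomials.\<close>

lemma cube_le_choose:
  assumes "6 \<le> t"
  shows "real t ^ 3 \<le> 12 * real (t choose 3)"
proof -
  obtain m where m: "t = m + 3" "3 \<le> m" using assms by (intro that[of "t - 3"]) auto
  have "3 * (t choose 3) = t * ((m + 2) choose 2)"
    using Suc_times_binomial_eq[of "m + 2" 2] by (simp add: m eval_nat_numeral)
  moreover have "2 * ((m + 2) choose 2) = (m + 2) * (m + 1)"
    using Suc_times_binomial_eq[of "m + 1" 1] by (simp add: eval_nat_numeral)
  moreover have "6 * (t choose 3) = 2 * (3 * (t choose 3))" by simp
  ultimately have "6 * (t choose 3) = t * ((m + 2) * (m + 1))" by (simp only: mult.left_commute[of 2 t])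
  then have "real (6 * (t choose 3)) = real (t * ((m + 2) * (m + 1)))" by simp
  then have eq: "6 * real (t choose 3) = real t * ((real m + 2) * (real m + 1))" by (simp add: algebra_simps)
  have "3 * 3 \<le> m * m" using m(2) by (intro mult_le_mono)
  then have "real (3 * 3) \<le> real (m * m)" by (simp only: of_nat_le_iff)
  then have "9 \<le> real m * real m" by simp
  then have "real t * (real t * real t) \<le> real t * (2 * ((real m + 2) * (real m + 1)))"
    by (intro mult_left_mono) (auto simp: m algebra_simps)
  then show ?thesis using eq by (simp add: power3_eq_cube algebra_simps)
qed

text \<open>For disjoint classes the unordered triples of \<open>K3\<close> correspond bijectively
  to the points of a box, over which sums are taken.\<close>

lemma K3_disjoint:
  assumes "A \<inter> B = {}" "A \<inter> C = {}" "B \<inter> C = {}"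
  shows "K3 A B C = (\<lambda>(x, y, z). {x, y, z}) ` (A \<times> B \<times> C)"
    and "inj_on (\<lambda>(x, y, z). {x, y, z}) (A \<times> B \<times> C)"
proof -
  show "K3 A B C = (\<lambda>(x, y, z). {x, y, z}) ` (A \<times> B \<times> C)"
  proof (intro equalityI subsetI)
    fix e assume "e \<in> K3 A B C"
    then obtain x y z where "e = {x, y, z}" "x \<in> A" "y \<in> B" "z \<in> C" unfolding K3_def by blast
    then show "e \<in> (\<lambda>(x, y, z). {x, y, z}) ` (A \<times> B \<times> C)" by (intro image_eqI[of _ _ "(x, y, z)"]) auto
  next
    fix e assume "e \<in> (\<lambda>(x, y, z). {x, y, z}) ` (A \<times> B \<times> C)"
    then obtain x y z where e: "e = {x, y, z}" "x \<in> A" "y \<in> B" "z \<in> C" by auto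
    then have "x \<noteq> y" "x \<noteq> z" "y \<noteq> z" using assms by auto
    with e show "e \<in> K3 A B C" unfolding K3_def by blast
  qed
  show "inj_on (\<lambda>(x, y, z). {x, y, z}) (A \<times> B \<times> C)"
  proof (rule inj_onI)
    fix q q' assume q: "q \<in> A \<times> B \<times> C" "q' \<in> A \<times> B \<times> C"
      and eq: "(\<lambda>(x, y, z). {x, y, z}) q = (\<lambda>(x, y, z). {x, y, z}) q'"
    obtain x y z x' y' z' where qq: "q = (x, y, z)" "q' = (x', y', z')" by (metis prod_cases3)
    have e: "{x, y, z} = {x', y', z'}" using eq by (simp add: qq)
    have m: "x \<in> A" "y \<in> B" "z \<in> C" "x' \<in> A" "y' \<in> B" "z' \<in> C" using q by (auto simp: qq)
    have "{x, y, z} \<inter> A = {x}" "{x', y', z'} \<inter> A = {x'}" "{x, y, z} \<inter> B = {y}" "{x', y', z'} \<inter> B = {y'}"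
      "{x, y, z} \<inter> C = {z}" "{x', y', z'} \<inter> C = {z'}" using m assms by auto
    then show "q = q'" unfolding qq e by simp
  qed
qed

lemma card_K3_disjoint:
  assumes "A \<inter> B = {}" "A \<inter> C = {}" "B \<inter> C = {}"
  shows "card (K3 A B C) = card A * card B * card C"
  unfolding K3_disjoint(1)[OF assms] card_image[OF K3_disjoint(2)[OF assms]] by (simp add: card_cartesian_product mult.assoc)

lemma card_Int_K3_disjoint:
  assumes "A \<inter> B = {}" "A \<inter> C = {}" "B \<inter> C = {}" "finite A" "finite B" "finite C"
  shows "real (card (F \<inter> K3 A B C)) = (\<Sum>(x, y, z)\<in>A \<times> B \<times> C. of_bool ({x, y, z} \<in> F))"
proof -
  let ?\<phi> = "\<lambda>(x, y, z). {x, y, z}"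
  have "F \<inter> K3 A B C = ?\<phi> ` {q \<in> A \<times> B \<times> C. ?\<phi> q \<in> F}"
    unfolding K3_disjoint(1)[OF assms(1-3)] by blast
  then have "card (F \<inter> K3 A B C) = card {q \<in> A \<times> B \<times> C. ?\<phi> q \<in> F}"
    using inj_on_subset[OF K3_disjoint(2)[OF assms(1-3)]] by (simp add: card_image)
  then show ?thesis
    using sum_of_bool_eq_card[of "A \<times> B \<times> C" "\<lambda>q. ?\<phi> q \<in> F"] assms(4-6)
    by (simp add: case_prod_unfold)
qed

text \<open>Both the number of edges in a sub-box and its expected value lie between 0 and
  \<open>d * N\<close>, so they differ by at most that. If the density is near 1, the same argument
  applies to the non-edges.\<close>

lemma vdisc3_if_extreme_density:
  fixes A B C :: "'a set"
  assumes disj: "A \<inter> B = {}" "A \<inter> C = {}" "B \<inter> C = {}" and fin: "finite A" "finite B" "finite C"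
    and ne: "A \<noteq> {}" "B \<noteq> {}" "C \<noteq> {}"
    and F: "F \<subseteq> K3 A B C"
    and d: "d = real (card F) / (real (card A) * real (card B) * real (card C))" "d < \<epsilon> \<or> 1 - \<epsilon> < d"
  shows "vdisc3 \<epsilon> A B C F"
  unfolding vdisc3_def Let_def d(1)[symmetric]
proof (intro allI impI)
  fix U V W assume sub: "U \<subseteq> A \<and> V \<subseteq> B \<and> W \<subseteq> C"
  define N where "N = real (card A) * real (card B) * real (card C)"
  define N' where "N' = real (card U) * real (card V) * real (card W)"
  define X where "X = real (card (F \<inter> K3 U V W))"
  have "N > 0" using ne fin by (simp add: N_def card_gt_0_iff)
  have finK: "finite (K3 A B C)" using fin by (simp add: K3_disjoint(1)[OF disj])
  have "d = real (card F) / N" by (simp add: d(1) N_def)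
  then have dN: "real (card F) = d * N" using \<open>N > 0\<close> by simp
  have disj': "U \<inter> V = {}" "U \<inter> W = {}" "V \<inter> W = {}" using sub disj by blast+
  have cU: "card U \<le> card A" "card V \<le> card B" "card W \<le> card C" using sub fin by (auto intro: card_mono)
  have KK: "K3 U V W \<subseteq> K3 A B C" using sub unfolding K3_def by blast
  have cK: "real (card (K3 U V W)) = N'" "real (card (K3 A B C)) = N"
    by (simp_all add: card_K3_disjoint[OF disj'] card_K3_disjoint[OF disj] N_def N'_def)
  have N': "0 \<le> N'" "N' \<le> N" unfolding N'_def N_def using cU by (auto intro!: mult_mono)
  have finF: "finite F" using F finK finite_subset by blast
  have X: "0 \<le> X" "X \<le> d * N" unfolding X_def dN[symmetric] using finF by (auto intro: card_mono)
  have "X \<le> N'" unfolding X_def cK(1)[symmetric] using finK KK finite_subset by (auto intro: card_mono)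
  have "N' - X \<le> N - d * N"
  proof -
    have "K3 U V W - F \<subseteq> K3 A B C - F" using KK by blast
    then have le: "card (K3 U V W - F) \<le> card (K3 A B C - F)" using finK by (intro card_mono) auto
    have "real (card (K3 U V W - F)) = N' - X"
      using finK KK finite_subset[OF KK] unfolding cK(1)[symmetric] X_def
      by (simp add: card_Diff_subset_Int Int_commute of_nat_diff card_mono)
    moreover have "real (card (K3 A B C - F)) = N - d * N"
      using finK F finF cK(2) dN by (simp add: card_Diff_subset of_nat_diff card_mono)
    ultimately show ?thesis using le by linarith
  qed
  have d01: "0 \<le> d" "d \<le> 1"
  proof -
    show "0 \<le> d" by (simp add: d(1))
    have "real (card F) \<le> real (card (K3 A B C))" using F finK by (simp add: card_mono)
    then have "d * N \<le> N" using dN cK(2) by simp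
    then show "d \<le> 1" using \<open>N > 0\<close> by simp
  qed
  have dN': "0 \<le> d * N'" "d * N' \<le> d * N" "0 \<le> (1 - d) * N'" "(1 - d) * N' \<le> (1 - d) * N"
    using d01 N' by (auto intro: mult_left_mono)
  have "\<bar>X - d * N'\<bar> \<le> \<epsilon> * N"
    using d(2)
  proof
    assume "d < \<epsilon>"
    then have "d * N \<le> \<epsilon> * N" using \<open>N > 0\<close> by simp
    with X dN' show ?thesis by linarith
  next
    assume "1 - \<epsilon> < d"
    then have "(1 - d) * N \<le> \<epsilon> * N" using \<open>N > 0\<close> by simp
    with dN' \<open>X \<le> N'\<close> \<open>N' - X \<le> _\<close> show ?thesis by (simp add: left_diff_distrib abs_le_iff)
  qed
  then show "\<bar>real (card (F \<inter> K3 U V W)) - d * real (card U) * real (card V) * real (card W)\<bar>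
      \<le> \<epsilon> * real (card A) * real (card B) * real (card C)"
    by (simp add: X_def N_def N'_def mult.assoc)
qed

text \<open>Bounds the triples with two vertices in one class, which lie in no box of three distinct
  parts.\<close>

lemma sum_class_pairs_le:
  assumes fin: "finite V" and p: "equitable V p t" and t: "t \<le> card V" "0 < t"
  shows "(\<Sum>x\<in>V. \<Sum>y\<in>V. of_bool (p x = p y) :: real) \<le> 2 * real (card V) ^ 2 / t"
proof -
  have "(\<Sum>y\<in>V. of_bool (p x = p y) :: real) \<le> 2 * real (card V) / t" if "x \<in> V" for x
  proof -
    have "p x < t" using p that by (simp add: equitable_def)
    from equitable_card(1)[OF fin p this] have "t * card {y \<in> V. p y = p x} \<le> 2 * card V" using t by simp
    then have "real (t * card {y \<in> V. p y = p x}) \<le> real (2 * card V)" by (simp only: of_nat_le_iff)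
    then have "real (card {y \<in> V. p y = p x}) \<le> 2 * real (card V) / t"
      using t(2) by (simp add: le_divide_eq mult.commute)
    moreover have "(\<Sum>y\<in>V. of_bool (p x = p y) :: real) = card {y \<in> V. p x = p y}"
      by (rule sum_of_bool_eq_card[OF fin])
    ultimately show ?thesis by (simp add: eq_commute)
  qed
  then have "(\<Sum>x\<in>V. \<Sum>y\<in>V. of_bool (p x = p y) :: real) \<le> (\<Sum>x\<in>V. 2 * real (card V) / t)" by (rule sum_mono)
  then show ?thesis by (simp add: power2_eq_square mult_ac)
qed

text \<open>On a box of intermediate density the pattern is wrong on a proportion of at least
  \<epsilon>, whichever value it takes there. A small step error therefore bounds both the total
  volume of such boxes, for homogeneity, and their number, for regularity.\<close>

lemma approximable_imp_homogeneous:
  assumes H: "\<And>G. G \<in> \<H> \<Longrightarrow> finite (verts G)" "\<And>G. G \<in> \<H> \<Longrightarrow> is_graph3 G" and ap: "approximable \<H>"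
  shows "vdisc3_homogeneous \<H>"
  unfolding vdisc3_homogeneous_def
proof (intro allI impI)
  fix \<epsilon> :: real and t\<^sub>0 :: nat assume \<epsilon>: "\<epsilon> > 0" and "t\<^sub>0 \<ge> 1"
  define t\<^sub>1 where "t\<^sub>1 = max (max t\<^sub>0 6) (nat \<lceil>144 / \<epsilon>\<rceil>)"
  \<comment> \<open>The bad boxes have total volume at most \<open>\<epsilon> / 200 * n ^ 3\<close>
    and each has volume at least \<open>(n / (2 * t)) ^ 3\<close>, so there are at most
    \<open>\<epsilon> / 25 * t ^ 3\<close>; the factor 12 for binomials fits. The bound
    \<open>144 / \<epsilon>\<close> in \<open>t\<^sub>1\<close> makes triples with a repeated class
    at most \<open>\<epsilon> / 24 * n ^ 3\<close>.\<close>
  define \<eta> where "\<eta> = \<epsilon> ^ 2 / 200"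
  have "\<eta> > 0" using \<epsilon> by (simp add: \<eta>_def)
  with ap obtain T N where TN: "\<And>G. G \<in> \<H> \<Longrightarrow> N \<le> card (verts G) \<Longrightarrow>
    \<exists>t p h. t\<^sub>1 \<le> t \<and> t \<le> T \<and> equitable (verts G) p t \<and> step_err G p h \<le> \<eta> * real (card (verts G)) ^ 3"
    unfolding approximable_def by metis
  show "\<exists>T N. \<forall>H\<in>\<H>. N \<le> card (verts H) \<longrightarrow>
     (\<exists>P. t\<^sub>0 \<le> card P \<and> card P \<le> T \<and> vdisc3_regular \<epsilon> H P \<and> homogeneous3 \<epsilon> H P)"
  \<comment> \<open>From \<open>2 * T\<close> vertices on every class has at least
    \<open>n / (2 * t)\<close> elements; in particular none is empty and the partition has exactly
    \<open>t\<close> parts.\<close>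
  proof (rule exI[of _ T], rule exI[of _ "max N (2 * T)"], intro ballI impI)
    fix G assume G: "G \<in> \<H>" and N: "max N (2 * T) \<le> card (verts G)"
    define V where "V = verts G"
    define F where "F = edges G"
    define n where "n = real (card V)"
    obtain t p h where t: "t\<^sub>1 \<le> t" "t \<le> T" and p: "equitable V p t" and err: "step_err G p h \<le> \<eta> * n ^ 3"
      using TN[OF G] N unfolding V_def n_def by auto
    have t6: "6 \<le> t" "t\<^sub>0 \<le> t" "2 * t \<le> card V" "0 < t" using t N by (auto simp: t\<^sub>1_def V_def)
    have "144 / \<epsilon> \<le> real t" using t(1) unfolding t\<^sub>1_def by linarith
    then have t144: "144 \<le> \<epsilon> * real t" using \<epsilon> by (simp add: divide_le_eq mult.commute)
    have fin: "finite V" and F3: "F \<subseteq> [V]\<^bsup>3\<^esup>" using H[OF G] by (simp_all add: V_def F_def is_graph3_def)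
    have n0: "n > 0" using t6 by (auto simp: n_def)
    define cls where "cls = (\<lambda>i. {x \<in> V. p x = i})"
    have pt: "p x < t" if "x \<in> V" for x using p that by (simp add: equitable_def)
    have cls_V: "cls i \<subseteq> V" and fin_cls: "finite (cls i)" for i using fin by (auto simp: cls_def)
    have disj: "cls i \<inter> cls j = {}" if "i \<noteq> j" for i j using that by (auto simp: cls_def)
    have size: "n / (2 * t) \<le> card (cls i)" if "i < t" for i
    proof -
      have "card V \<le> t * card (cls i) + t" using equitable_card(2)[OF fin p that] by (simp add: cls_def)
      then have "card V \<le> 2 * t * card (cls i)" using t6(3) by linarith
      then have "real (card V) \<le> real (2 * t * card (cls i))" by (simp only: of_nat_le_iff)
      then show ?thesis using t6(4) by (simp add: n_def divide_le_eq mult.commute)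
    qed
    have ne: "cls i \<noteq> {}" if "i < t" for i
    proof -
      have "0 < n / (2 * t)" using n0 t6(4) by simp
      with size[OF that] have "0 < real (card (cls i))" by linarith
      then show ?thesis by auto
    qed
    have inj: "inj_on cls {..<t}" using disj ne by (intro inj_onI) (metis Int_absorb lessThan_iff)
    define P where "P = cls ` {..<t}"
    have cardP: "card P = t" unfolding P_def using inj by (simp add: card_image)
    have eqP: "equipartition V P"
      unfolding equipartition_def
    proof (intro conjI ballI)
      show "partition_on V P"
      proof (rule partition_onI)
        show "\<Union>P = V" using pt by (auto simp: P_def cls_def)
        show "{} \<notin> P" using ne by (auto simp: P_def)
        show "disjnt A B" if AB: "A \<in> P" "B \<in> P" "A \<noteq> B" for A B
        proof -
          obtain i where "A = cls i" using AB(1) unfolding P_def by blast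
          moreover obtain j where "B = cls j" using AB(2) unfolding P_def by blast
          ultimately show ?thesis using disj[of i j] AB(3) unfolding disjnt_def by auto
        qed
      qed
      show "card A \<le> card B + 1" if AB: "A \<in> P" "B \<in> P" for A B
      proof -
        obtain i where "i < t" "A = cls i" using AB(1) unfolding P_def by blast
        moreover obtain j where "j < t" "B = cls j" using AB(2) unfolding P_def by blast
        ultimately show ?thesis
          using p[unfolded equitable_def, THEN conjunct2, rule_format, of i j] by (simp add: cls_def)
      qed
    qed
    let ?\<phi> = "\<lambda>(x, y, z). {x, y, z}"
    define box where "box = (\<lambda>(i, j, k). cls i \<times> cls j \<times> cls k)"
    define d where "d = (\<lambda>i j k. real (card (F \<inter> K3 (cls i) (cls j) (cls k))) / real (card (K3 (cls i) (cls j) (cls k))))"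
    define Bad where "Bad = {(i, j, k). i < t \<and> j < t \<and> k < t \<and> i \<noteq> j \<and> i \<noteq> k \<and> j \<noteq> k \<and> \<epsilon> \<le> d i j k \<and> d i j k \<le> 1 - \<epsilon>}"
    have finBad: "finite Bad"
      by (rule finite_subset[of _ "{..<t} \<times> {..<t} \<times> {..<t}"]) (auto simp: Bad_def)
    define e where "e = (\<lambda>(x, y, z). of_bool (({x, y, z} \<in> F) \<noteq> ((p x, p y, p z) \<in> h)) :: real)"
    have err_box: "\<epsilon> * card (box b) \<le> (\<Sum>q\<in>box b. e q)" if b: "b \<in> Bad" for b
    proof -
      obtain i j k where ijk: "b = (i, j, k)" by (metis prod_cases3)
      have lt: "i < t" "j < t" "k < t" and neq: "i \<noteq> j" "i \<noteq> k" "j \<noteq> k" and de: "\<epsilon> \<le> d i j k" "d i j k \<le> 1 - \<epsilon>"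
        using b by (auto simp: Bad_def ijk)
      note dj = disj[OF neq(1)] disj[OF neq(2)] disj[OF neq(3)]
      define M where "M = real (card (box b))"
      have M: "M = real (card (cls i)) * real (card (cls j)) * real (card (cls k))"
        by (simp add: M_def ijk box_def card_cartesian_product)
      have "M > 0" unfolding M using ne[OF lt(1)] ne[OF lt(2)] ne[OF lt(3)] fin_cls by (simp add: card_gt_0_iff)
      define s where "s = (\<Sum>q\<in>box b. of_bool (?\<phi> q \<in> F) :: real)"
      have "real (card (F \<inter> K3 (cls i) (cls j) (cls k))) = s"
        unfolding card_Int_K3_disjoint[OF dj fin_cls fin_cls fin_cls] s_def box_def ijk
        by (simp add: case_prod_unfold)
      then have "d i j k = s / M" by (simp add: d_def card_K3_disjoint[OF dj] M)
      then have s: "s = d i j k * M" using \<open>M > 0\<close> by simp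
      have labels: "(p x, p y, p z) = b" if "(x, y, z) \<in> box b" for x y z
        using that by (auto simp: box_def ijk cls_def)
      show ?thesis
      proof (cases "b \<in> h")
        case True
        have "(\<Sum>q\<in>box b. e q) = (\<Sum>q\<in>box b. 1 - of_bool (?\<phi> q \<in> F))"
          using True labels by (intro sum.cong) (auto simp: e_def)
        also have "\<dots> = M - s" by (simp add: sum_subtractf s_def M_def)
        also have "\<dots> = (1 - d i j k) * M" by (simp add: s left_diff_distrib)
        also have "\<dots> \<ge> \<epsilon> * M" using de \<open>M > 0\<close> by (intro mult_right_mono) auto
        finally show ?thesis by (simp add: M_def)
      next
        case False
        have "(\<Sum>q\<in>box b. e q) = s"
          unfolding s_def using False labels by (intro sum.cong) (auto simp: e_def)
        also have "\<dots> \<ge> \<epsilon> * M" unfolding s using de \<open>M > 0\<close> by (intro mult_right_mono) auto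
        finally show ?thesis by (simp add: M_def)
      qed
    qed
    have fin_box: "finite (box b)" for b using fin_cls by (auto simp: box_def split: prod.split)
    have disj_box: "box b \<inter> box b' = {}" if "b \<noteq> b'" for b b'
      using that by (auto simp: box_def cls_def split: prod.splits)
    have "(\<Sum>b\<in>Bad. \<epsilon> * card (box b)) \<le> (\<Sum>b\<in>Bad. \<Sum>q\<in>box b. e q)" using err_box by (rule sum_mono)
    also have "\<dots> = (\<Sum>q\<in>(\<Union>b\<in>Bad. box b). e q)"
      using finBad fin_box disj_box by (intro sum.UNION_disjoint[symmetric]) auto
    also have "\<dots> \<le> (\<Sum>q\<in>V \<times> V \<times> V. e q)"
      using fin cls_V by (intro sum_mono2) (auto simp: e_def box_def split: prod.splits)
    also have "\<dots> = step_err G p h" unfolding sum_triple e_def step_err_def V_def F_def by simp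
    finally have "\<epsilon> * (\<Sum>b\<in>Bad. real (card (box b))) \<le> \<epsilon> ^ 2 / 200 * n ^ 3"
      using err by (simp add: sum_distrib_left \<eta>_def)
    then have "\<epsilon> * (\<Sum>b\<in>Bad. real (card (box b))) \<le> \<epsilon> * (\<epsilon> / 200 * n ^ 3)"
      by (simp add: power2_eq_square)
    then have mass: "(\<Sum>b\<in>Bad. real (card (box b))) \<le> \<epsilon> / 200 * n ^ 3" using \<epsilon> by simp
    have cardBad: "real (card Bad) \<le> \<epsilon> / 25 * real t ^ 3"
    proof -
      have "(n / (2 * t)) ^ 3 \<le> card (box b)" if b: "b \<in> Bad" for b
      proof -
        obtain i j k where ijk: "b = (i, j, k)" by (metis prod_cases3)
        have lt: "i < t" "j < t" "k < t" using b by (auto simp: Bad_def ijk)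
        have "n / (2 * t) * (n / (2 * t) * (n / (2 * t))) \<le> card (cls i) * (card (cls j) * card (cls k))"
          using size[OF lt(1)] size[OF lt(2)] size[OF lt(3)] n0 unfolding of_nat_mult
          by (intro mult_mono) auto
        then show ?thesis by (simp add: ijk box_def card_cartesian_product power3_eq_cube mult.assoc)
      qed
      then have "(\<Sum>b\<in>Bad. (n / (2 * t)) ^ 3) \<le> (\<Sum>b\<in>Bad. real (card (box b)))" by (rule sum_mono)
      with mass have "real (card Bad) * (n / (2 * t)) ^ 3 \<le> \<epsilon> / 200 * n ^ 3" by simp
      moreover have "\<epsilon> / 200 * n ^ 3 = (\<epsilon> / 25 * real t ^ 3) * (n / (2 * t)) ^ 3"
        using t6(4) by (simp add: power_divide power_mult_distrib)
      moreover have "(n / (2 * t)) ^ 3 > 0" using n0 t6(4) by simp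
      ultimately show ?thesis by (metis mult_le_cancel_right_pos)
    qed
    have d01: "0 \<le> d i j k \<and> d i j k \<le> 1" for i j k
    proof -
      have "finite (K3 (cls i) (cls j) (cls k))"
        by (rule finite_subset[of _ "Pow V"]) (use fin cls_V in \<open>auto simp: K3_def\<close>)
      then have "card (F \<inter> K3 (cls i) (cls j) (cls k)) \<le> card (K3 (cls i) (cls j) (cls k))"
        by (intro card_mono) auto
      then show ?thesis by (auto simp: d_def divide_le_eq_1)
    qed
    have good: "d i j k < \<epsilon> \<or> 1 - \<epsilon> < d i j k"
      if "(i, j, k) \<notin> Bad" "i < t" "j < t" "k < t" "i \<noteq> j" "i \<noteq> k" "j \<noteq> k" for i j k
      using that by (auto simp: Bad_def)
    have "vdisc3_regular \<epsilon> G P"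
    proof -
      let ?X = "{T \<in> [P]\<^bsup>3\<^esup>. \<exists>A B C. T = {A, B, C} \<and> \<not> vdisc3 \<epsilon> A B C (F \<inter> K3 A B C)}"
      have "?X \<subseteq> (\<lambda>(i, j, k). {cls i, cls j, cls k}) ` Bad"
      proof
        fix S assume "S \<in> ?X"
        then obtain A B C where S: "S = {A, B, C}" "S \<subseteq> P" "card S = 3" and nv: "\<not> vdisc3 \<epsilon> A B C (F \<inter> K3 A B C)"
          by (auto simp: nsets_def)
        obtain i j k where ijk: "A = cls i" "B = cls j" "C = cls k" "i < t" "j < t" "k < t"
          using S(1,2) unfolding P_def by auto
        have neq: "i \<noteq> j" "i \<noteq> k" "j \<noteq> k"
          using S(1,3) unfolding ijk by (auto simp: card_insert_if split: if_splits)
        note dj = disj[OF neq(1)] disj[OF neq(2)] disj[OF neq(3)]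
        have "(i, j, k) \<in> Bad"
        proof (rule ccontr)
          assume "(i, j, k) \<notin> Bad"
          from good[OF this ijk(4-6) neq]
          have "vdisc3 \<epsilon> A B C (F \<inter> K3 A B C)"
            unfolding ijk
            by (intro vdisc3_if_extreme_density[OF dj fin_cls fin_cls fin_cls ne ne ne, where d = "d i j k"])
              (use ijk in \<open>auto simp: d_def card_K3_disjoint[OF dj]\<close>)
          with nv show False by blast
        qed
        then show "S \<in> (\<lambda>(i, j, k). {cls i, cls j, cls k}) ` Bad" unfolding S(1) ijk(1-3) by force
      qed
      then have "card ?X \<le> card Bad" by (rule surj_card_le[OF finBad])
      then have "real (card ?X) \<le> \<epsilon> / 25 * real t ^ 3" using cardBad by linarith
      also have "\<dots> \<le> \<epsilon> / 25 * (12 * real (t choose 3))"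
        using cube_le_choose[OF t6(1)] \<epsilon> by (intro mult_left_mono) auto
      also have "\<dots> \<le> \<epsilon> * real (t choose 3)" using \<epsilon> by simp
      finally show ?thesis using eqP by (simp add: vdisc3_regular_def cardP V_def F_def)
    qed
    moreover have "homogeneous3 \<epsilon> G P"
    proof -
      let ?S = "[V]\<^bsup>3\<^esup>"
      let ?good = "{S \<in> ?S. \<exists>A\<in>P. \<exists>B\<in>P. \<exists>C\<in>P. A \<noteq> B \<and> A \<noteq> C \<and> B \<noteq> C \<and> S \<in> K3 A B C \<and>
              real (card (F \<inter> K3 A B C)) / real (card (K3 A B C)) \<in> {0..<\<epsilon>} \<union> {1 - \<epsilon><..1}}"
      have finS: "finite ?S" using fin by (rule finite_imp_finite_nsets)
      define Q where "Q = {q \<in> V \<times> V \<times> V. (case q of (x, y, z) \<Rightarrow> (p x, p y, p z) \<in> Bad \<or> p x = p y \<or> p x = p z \<or> p y = p z)}"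
      have "?S - ?good \<subseteq> ?\<phi> ` Q"
      proof
        fix S assume S: "S \<in> ?S - ?good"
        then obtain x y z where xyz: "S = {x, y, z}" "x \<in> V" "y \<in> V" "z \<in> V" "x \<noteq> y" "x \<noteq> z" "y \<noteq> z"
          by (auto simp: nsets_def card_3_iff)
        have "(x, y, z) \<in> Q"
        proof (rule ccontr)
          assume "(x, y, z) \<notin> Q"
          then have nb: "(p x, p y, p z) \<notin> Bad" and neq: "p x \<noteq> p y" "p x \<noteq> p z" "p y \<noteq> p z"
            using xyz by (auto simp: Q_def)
          have lt: "p x < t" "p y < t" "p z < t" using pt xyz by auto
          have "d (p x) (p y) (p z) \<in> {0..<\<epsilon>} \<union> {1 - \<epsilon><..1}"
            using good[OF nb lt neq] d01[of "p x" "p y" "p z"] by auto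
          moreover have "cls (p x) \<noteq> cls (p y)" "cls (p x) \<noteq> cls (p z)" "cls (p y) \<noteq> cls (p z)"
            using inj neq lt by (auto simp: inj_on_eq_iff)
          moreover have "S \<in> K3 (cls (p x)) (cls (p y)) (cls (p z))"
            using xyz unfolding K3_def cls_def by blast
          moreover have "cls (p x) \<in> P" "cls (p y) \<in> P" "cls (p z) \<in> P" using lt by (auto simp: P_def)
          ultimately have "S \<in> ?good" using S unfolding d_def by blast
          with S show False by blast
        qed
        then show "S \<in> ?\<phi> ` Q" using xyz(1) by force
      qed
      moreover have finQ: "finite Q" using fin by (simp add: Q_def)
      ultimately have "card (?S - ?good) \<le> card Q" by (intro surj_card_le)
      then have "real (card (?S - ?good)) \<le> real (card Q)" by simp
      also have "real (card Q) = (\<Sum>q\<in>V \<times> V \<times> V. of_bool (case q of (x, y, z) \<Rightarrow> (p x, p y, p z) \<in> Bad \<or> p x = p y \<or> p x = p z \<or> p y = p z))"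
        unfolding Q_def using fin by (intro sum_of_bool_eq_card[symmetric]) auto
      also have "\<dots> \<le> (\<Sum>q\<in>V \<times> V \<times> V. case q of (x, y, z) \<Rightarrow>
          of_bool ((p x, p y, p z) \<in> Bad) + (of_bool (p x = p y) + (of_bool (p x = p z) + of_bool (p y = p z))))"
        by (intro sum_mono) (auto split: prod.split)
      also have "\<dots> = (\<Sum>x\<in>V. \<Sum>y\<in>V. \<Sum>z\<in>V. of_bool ((p x, p y, p z) \<in> Bad))
         + ((\<Sum>x\<in>V. \<Sum>y\<in>V. \<Sum>z\<in>V. of_bool (p x = p y)) + ((\<Sum>x\<in>V. \<Sum>y\<in>V. \<Sum>z\<in>V. of_bool (p x = p z))
         + (\<Sum>x\<in>V. \<Sum>y\<in>V. \<Sum>z\<in>V. of_bool (p y = p z))))"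
        unfolding sum_triple by (simp add: sum.distrib)
      finally have le: "real (card (?S - ?good)) \<le> (\<Sum>x\<in>V. \<Sum>y\<in>V. \<Sum>z\<in>V. of_bool ((p x, p y, p z) \<in> Bad))
         + ((\<Sum>x\<in>V. \<Sum>y\<in>V. \<Sum>z\<in>V. of_bool (p x = p y)) + ((\<Sum>x\<in>V. \<Sum>y\<in>V. \<Sum>z\<in>V. of_bool (p x = p z))
         + (\<Sum>x\<in>V. \<Sum>y\<in>V. \<Sum>z\<in>V. of_bool (p y = p z))))" .
      have bad: "(\<Sum>x\<in>V. \<Sum>y\<in>V. \<Sum>z\<in>V. of_bool ((p x, p y, p z) \<in> Bad)) \<le> \<epsilon> / 200 * n ^ 3"
      proof -
        have "(\<Sum>x\<in>V. \<Sum>y\<in>V. \<Sum>z\<in>V. of_bool ((p x, p y, p z) \<in> Bad) :: real)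
          = (\<Sum>q\<in>V \<times> V \<times> V. of_bool (map_prod p (map_prod p p) q \<in> Bad))"
          unfolding sum_triple by simp
        also have "\<dots> = card {q \<in> V \<times> V \<times> V. map_prod p (map_prod p p) q \<in> Bad}"
          using fin by (intro sum_of_bool_eq_card) auto
        also have "{q \<in> V \<times> V \<times> V. map_prod p (map_prod p p) q \<in> Bad} = (\<Union>b\<in>Bad. box b)"
          by (auto simp: box_def cls_def split: prod.splits)
        also have "card (\<Union>b\<in>Bad. box b) = (\<Sum>b\<in>Bad. card (box b))"
          using finBad fin_box disj_box by (intro card_UN_disjoint) auto
        finally show ?thesis using mass by simp
      qed
      define D where "D = (\<Sum>x\<in>V. \<Sum>y\<in>V. of_bool (p x = p y) :: real)"
      have D: "D \<le> 2 * n ^ 2 / t" unfolding D_def n_def using t6 by (intro sum_class_pairs_le[OF fin p]) auto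
      have d1: "(\<Sum>x\<in>V. \<Sum>y\<in>V. \<Sum>z\<in>V. of_bool (p x = p y)) = n * D"
        by (simp add: D_def n_def sum_distrib_left)
      have d2: "(\<Sum>x\<in>V. \<Sum>y\<in>V. \<Sum>z\<in>V. of_bool (p x = p z)) = n * D"
        by (subst sum.swap) (simp add: D_def n_def)
      have d3: "(\<Sum>x\<in>V. \<Sum>y\<in>V. \<Sum>z\<in>V. of_bool (p y = p z)) = n * D" by (simp add: D_def n_def)
      have "n * D \<le> n * (2 * n ^ 2 / t)" using n0 by (intro mult_left_mono[OF D]) simp
      then have "3 * (n * D) \<le> 3 * (n * (2 * n ^ 2 / t))" by (rule mult_left_mono) simp
      also have "\<dots> = 6 / t * n ^ 3" by (simp add: power2_eq_square power3_eq_cube)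
      also have "\<dots> \<le> \<epsilon> / 24 * n ^ 3"
        using t144 t6(4) n0 by (intro mult_right_mono) (auto simp: divide_le_eq)
      finally have "real (card (?S - ?good)) \<le> \<epsilon> / 200 * n ^ 3 + \<epsilon> / 24 * n ^ 3"
        using le bad unfolding d1 d2 d3 by linarith
      also have "\<dots> \<le> \<epsilon> / 12 * n ^ 3" using \<epsilon> n0 by (simp add: field_simps)
      also have "\<dots> \<le> \<epsilon> / 12 * (12 * real (card V choose 3))"
        using cube_le_choose[of "card V"] t6 \<epsilon> unfolding n_def by (intro mult_left_mono) auto
      finally have "real (card (?S - ?good)) \<le> \<epsilon> * real (card V choose 3)" by simp
      moreover have "real (card (?S - ?good)) = real (card ?S) - real (card ?good)"
      proof -
        have sub: "?good \<subseteq> ?S" by blast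
        then have "card (?S - ?good) = card ?S - card ?good"
          by (intro card_Diff_subset finite_subset[OF _ finS])
        moreover have "card ?good \<le> card ?S" by (rule card_mono[OF finS sub])
        ultimately show ?thesis by (simp only: of_nat_diff)
      qed
      moreover have "card ?S = card V choose 3" by (rule card_nsets)
      ultimately have "(1 - \<epsilon>) * real (card V choose 3) \<le> real (card ?good)" by (simp add: left_diff_distrib)
      then show ?thesis by (simp only: homogeneous3_def V_def F_def)
    qed
    ultimately show "\<exists>P. t\<^sub>0 \<le> card P \<and> card P \<le> T \<and> vdisc3_regular \<epsilon> G P \<and> homogeneous3 \<epsilon> G P"
      using cardP t t6 by (intro exI[of _ P]) simp
  qed
qed

section \<open>Walsh functions\<close>

text \<open>The entries of Sylvester's Hadamard matrix, rows and columns indexed by sets of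
  naturals.\<close>

definition walsh :: "nat set \<Rightarrow> nat set \<Rightarrow> real" where
  "walsh x y = (- 1) ^ card (x \<inter> y)"

lemma walsh_cases: "walsh x y = (if even (card (x \<inter> y)) then 1 else - 1)"
  by (simp add: walsh_def)

lemma walsh_flip:
  assumes "finite x" "x' = (if e \<in> x then x - {e} else insert e x)"
  shows "walsh x' z = (if e \<in> z then - walsh x z else walsh x z)"
proof (cases "e \<in> z")
  case True
  show ?thesis
  proof (cases "e \<in> x")
    case ex: True
    then have "x \<inter> z = insert e (x' \<inter> z)" "e \<notin> x' \<inter> z" "finite (x' \<inter> z)" using True assms by auto
    then show ?thesis using True by (simp add: walsh_def)
  next
    case ex: False
    then have "x' \<inter> z = insert e (x \<inter> z)" "e \<notin> x \<inter> z" "finite (x \<inter> z)" using True assms by auto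
    then show ?thesis using True by (simp add: walsh_def)
  qed
next
  case False
  then have "x' \<inter> z = x \<inter> z" using assms(2) by auto
  then show ?thesis using False by (simp add: walsh_def)
qed

text \<open>Toggling in \<open>x\<close> an element on which \<open>y\<close> and \<open>y'\<close>
  differ is an involution that reverses the sign of every summand.\<close>

lemma walsh_orthogonal:
  assumes "y \<subseteq> {..<m}" "y' \<subseteq> {..<m}" "y \<noteq> y'"
  shows "(\<Sum>x\<in>Pow {..<m}. walsh x y * walsh x y') = 0"
proof -
  obtain e where e: "e < m" "e \<in> y \<longleftrightarrow> e \<notin> y'" using assms by blast
  define flip where "flip = (\<lambda>x. if e \<in> x then x - {e} else insert e x)"
  have bij: "bij_betw flip (Pow {..<m}) (Pow {..<m})"
    by (rule bij_betwI[where g = flip]) (use e in \<open>auto simp: flip_def split: if_splits\<close>)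
  have "(\<Sum>x\<in>Pow {..<m}. walsh x y * walsh x y') = (\<Sum>x\<in>Pow {..<m}. walsh (flip x) y * walsh (flip x) y')"
    by (rule sum.reindex_bij_betw[OF bij, symmetric])
  also have "\<dots> = (\<Sum>x\<in>Pow {..<m}. - (walsh x y * walsh x y'))"
  proof (rule sum.cong[OF refl])
    fix x assume "x \<in> Pow {..<m}"
    then have "finite x" using finite_subset by auto
    then show "walsh (flip x) y * walsh (flip x) y' = - (walsh x y * walsh x y')"
      using e(2) walsh_flip[of x "flip x" e y] walsh_flip[of x "flip x" e y'] by (auto simp: flip_def)
  qed
  finally show ?thesis by (simp add: sum_negf)
qed

text \<open>Cauchy--Schwarz against the constant function, obtained from the nonnegativity of the
  variance.\<close>

lemma sum_power2_le:
  fixes s :: "'a \<Rightarrow> real"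
  assumes "finite X"
  shows "(\<Sum>x\<in>X. s x) ^ 2 \<le> card X * (\<Sum>x\<in>X. s x ^ 2)"
proof (cases "X = {}")
  case False
  define c where "c = real (card X)"
  define S where "S = (\<Sum>x\<in>X. s x)"
  have c: "c > 0" using False assms by (simp add: c_def card_gt_0_iff)
  have "0 \<le> (\<Sum>x\<in>X. (c * s x - S) ^ 2)" by (simp add: sum_nonneg)
  also have "\<dots> = (\<Sum>x\<in>X. c ^ 2 * s x ^ 2 - 2 * c * S * s x + S ^ 2)"
    by (intro sum.cong refl) (simp add: power2_eq_square algebra_simps)
  also have "\<dots> = c ^ 2 * (\<Sum>x\<in>X. s x ^ 2) - 2 * c * S * S + c * S ^ 2"
    by (simp add: sum.distrib sum_subtractf sum_distrib_left[symmetric] S_def c_def)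
  also have "\<dots> = c * (c * (\<Sum>x\<in>X. s x ^ 2) - S ^ 2)" by (simp add: power2_eq_square algebra_simps)
  finally show ?thesis using c by (simp add: zero_le_mult_iff S_def c_def)
qed simp

text \<open>Cauchy--Schwarz over the rows, then the sum over \<open>X\<close> is extended to all
  rows, where orthogonality leaves only the diagonal. The order of the matrix is a power of 4 so
  that its power 3/2 is \<open>8 ^ r\<close>, without roots.\<close>

lemma lindsey_inequality:
  assumes X: "X \<subseteq> Pow {..<2 * r}" and Y: "Y \<subseteq> Pow {..<2 * r}"
  shows "\<bar>\<Sum>x\<in>X. \<Sum>y\<in>Y. walsh x y\<bar> \<le> 8 ^ r"
proof -
  let ?I = "Pow {..<2 * r}"
  have cI: "card ?I = 4 ^ r" by (simp add: card_Pow power_mult)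
  have fin: "finite X" "finite Y" using X Y finite_subset[of _ ?I] by auto
  have le: "real (card X) \<le> 4 ^ r" "real (card Y) \<le> 4 ^ r"
    using card_mono[OF _ X] card_mono[OF _ Y] unfolding cI by (simp_all flip: of_nat_le_iff)
  have "(\<Sum>x\<in>X. \<Sum>y\<in>Y. walsh x y) ^ 2 \<le> card X * (\<Sum>x\<in>X. (\<Sum>y\<in>Y. walsh x y) ^ 2)"
    by (rule sum_power2_le[OF fin(1)])
  also have "\<dots> \<le> 4 ^ r * (\<Sum>x\<in>?I. (\<Sum>y\<in>Y. walsh x y) ^ 2)"
    using X le by (intro mult_mono sum_mono2 sum_nonneg) auto
  also have "(\<Sum>x\<in>?I. (\<Sum>y\<in>Y. walsh x y) ^ 2) = (\<Sum>x\<in>?I. \<Sum>y\<in>Y. \<Sum>y'\<in>Y. walsh x y * walsh x y')"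
    by (simp add: power2_eq_square sum_product)
  also have "\<dots> = (\<Sum>y\<in>Y. \<Sum>x\<in>?I. \<Sum>y'\<in>Y. walsh x y * walsh x y')" by (rule sum.swap)
  also have "\<dots> = (\<Sum>y\<in>Y. \<Sum>y'\<in>Y. \<Sum>x\<in>?I. walsh x y * walsh x y')" by (intro sum.cong refl sum.swap)
  also have "\<dots> = (\<Sum>y\<in>Y. \<Sum>y'\<in>Y. if y' = y then 4 ^ r else 0)"
  proof (intro sum.cong refl)
    fix y y' assume "y \<in> Y" "y' \<in> Y"
    then have "y \<subseteq> {..<2 * r}" "y' \<subseteq> {..<2 * r}" using Y by auto
    moreover have "(\<Sum>x\<in>?I. walsh x y * walsh x y) = (\<Sum>x\<in>?I. 1)"
      by (intro sum.cong refl) (simp add: walsh_cases)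
    ultimately show "(\<Sum>x\<in>?I. walsh x y * walsh x y') = (if y' = y then 4 ^ r else 0)"
      using walsh_orthogonal[of y "2 * r" y'] cI by auto
  qed
  also have "\<dots> = real (card Y) * 4 ^ r" using fin by simp
  also have "4 ^ r * (real (card Y) * 4 ^ r) \<le> (4 ^ r * (4 ^ r * 4 ^ r) :: real)"
    using le by (intro mult_left_mono mult_right_mono) auto
  also have "\<dots> = (8 ^ r) ^ 2" by (simp add: power_mult_distrib[symmetric] power2_eq_square)
  finally have "\<bar>\<Sum>x\<in>X. \<Sum>y\<in>Y. walsh x y\<bar> ^ 2 \<le> (8 ^ r) ^ 2" by simp
  then show ?thesis by (rule power2_le_imp_le) simp
qed

section \<open>Counting index triples in the boxes of a homogeneous partition\<close>

lemma card_vertex_collisions_le: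
  assumes "finite I" "finite J" "finite K" and inj: "\<And>j k. j \<in> J \<Longrightarrow> k \<in> K \<Longrightarrow> card {i \<in> I. P i j k} \<le> 1"
  shows "card {(i, j, k). i \<in> I \<and> j \<in> J \<and> k \<in> K \<and> P i j k} \<le> card J * card K"
proof -
  have "{(i, j, k). i \<in> I \<and> j \<in> J \<and> k \<in> K \<and> P i j k} =
      (\<lambda>((j, k), i). (i, j, k)) ` (SIGMA (j, k):J \<times> K. {i \<in> I. P i j k})" by force
  then have "card {(i, j, k). i \<in> I \<and> j \<in> J \<and> k \<in> K \<and> P i j k} = card (SIGMA (j, k):J \<times> K. {i \<in> I. P i j k})"
    by (simp add: card_image inj_on_def)
  also have "\<dots> = (\<Sum>(j, k)\<in>J \<times> K. card {i \<in> I. P i j k})"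
    using assms by (subst card_SigmaI) (auto simp: case_prod_unfold)
  also have "\<dots> \<le> (\<Sum>(j, k)\<in>J \<times> K. 1)" using inj by (intro sum_mono) auto
  finally show ?thesis by (simp add: card_cartesian_product)
qed

lemma card_inj_fiber_le_1:
  assumes "inj_on f I"
  shows "card {i \<in> I. f i = v} \<le> 1"
proof (cases "\<exists>i\<in>I. f i = v")
  case True
  then obtain i where "i \<in> I" "f i = v" by blast
  then have "{i \<in> I. f i = v} \<subseteq> {i}" using assms by (auto dest: inj_onD)
  from card_mono[OF _ this] show ?thesis by simp
next
  case False
  then have "{i \<in> I. f i = v} = {}" by blast
  then show ?thesis by (simp only: card.empty)
qed

text \<open>A 3-set does not tell which vertex lies in which part, whereas the boxes of indices are
  ordered; the parts are permuted to match the order \<open>u\<close>, \<open>v\<close>,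
  \<open>w\<close>.\<close>

lemma K3_member_classes:
  assumes "{u, v, w} \<in> K3 X Y Z" "X \<noteq> Y" "X \<noteq> Z" "Y \<noteq> Z"
  obtains X' Y' Z' where "u \<in> X'" "v \<in> Y'" "w \<in> Z'" "K3 X' Y' Z' = K3 X Y Z"
    "X' \<in> {X, Y, Z}" "Y' \<in> {X, Y, Z}" "Z' \<in> {X, Y, Z}" "X' \<noteq> Y'" "X' \<noteq> Z'" "Y' \<noteq> Z'"
proof -
  obtain x y z where e: "{u, v, w} = {x, y, z}" and m: "x \<in> X" "y \<in> Y" "z \<in> Z"
    and d: "x \<noteq> y" "x \<noteq> z" "y \<noteq> z"
    using assms(1) unfolding K3_def by blast
  have K: "K3 X Z Y = K3 X Y Z" "K3 Y X Z = K3 X Y Z" "K3 Y Z X = K3 X Y Z" "K3 Z X Y = K3 X Y Z" "K3 Z Y X = K3 X Y Z"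
    by (rule K3_commute, rule K3_commute, rule trans[OF K3_commute(2) K3_commute(1)],
        rule trans[OF K3_commute(1) K3_commute(2)],
        rule trans[OF K3_commute(1) trans[OF K3_commute(2) K3_commute(1)]])
  have "u \<in> {x, y, z}" "v \<in> {x, y, z}" "w \<in> {x, y, z}" unfolding e[symmetric] by simp_all
  moreover have "x \<in> {u, v, w}" "y \<in> {u, v, w}" "z \<in> {u, v, w}" unfolding e by simp_all
  ultimately consider "u = x \<and> v = y \<and> w = z" | "u = x \<and> v = z \<and> w = y" | "u = y \<and> v = x \<and> w = z"
    | "u = y \<and> v = z \<and> w = x" | "u = z \<and> v = x \<and> w = y" | "u = z \<and> v = y \<and> w = x"
    using d unfolding insert_iff empty_iff by argo
  then show thesis
  proof cases
    case 1
    show ?thesis by (rule that[of X Y Z]) (use 1 m assms in auto)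
  next
    case 2
    show ?thesis by (rule that[of X Z Y]) (use 2 m K(1) assms in auto)
  next
    case 3
    show ?thesis by (rule that[of Y X Z]) (use 3 m K(2) assms in auto)
  next
    case 4
    show ?thesis by (rule that[of Y Z X]) (use 4 m K(3) assms in auto)
  next
    case 5
    show ?thesis by (rule that[of Z X Y]) (use 5 m K(4) assms in auto)
  next
    case 6
    show ?thesis by (rule that[of Z Y X]) (use 6 m K(5) assms in auto)
  qed
qed

text \<open>The index triples \<open>(i, x, j)\<close> are a fixed proportion of all triples of a
  sub-3-graph with at most \<open>3 * k\<close> vertices, so most of them lie in boxes of extreme
  density. There almost all matrix entries have the same sign, while Lindsey's inequality balances
  the signs; so these boxes are too small to hold them.\<close>

lemma homogeneous_imp_no_config:
  assumes her: "hereditary \<H>" and hom: "vdisc3_homogeneous \<H>"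
  shows "\<exists>k\<ge>1. \<forall>H\<in>\<H>. \<not> ubar_config H k"
proof (rule ccontr)
  assume "\<not> (\<exists>k\<ge>1. \<forall>H\<in>\<H>. \<not> ubar_config H k)"
  then have conf: "\<exists>H\<in>\<H>. ubar_config H k" if "1 \<le> k" for k using that by blast
  \<comment> \<open>The final count is contradictory as soon as
    \<open>(54 + 27 * 27 / 6) * \<mu> + 1 / 4 < 1\<close>.\<close>
  define \<mu> :: real where "\<mu> = 1 / 2000"
  have "\<mu> > 0" by (simp add: \<mu>_def)
  obtain T N where TN: "\<And>H. H \<in> \<H> \<Longrightarrow> N \<le> card (verts H) \<Longrightarrow>
     \<exists>P. card P \<le> T \<and> vdisc3_regular \<mu> H P \<and> homogeneous3 \<mu> H P"
    using hom \<open>\<mu> > 0\<close> unfolding vdisc3_homogeneous_def by (metis le_refl)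
  \<comment> \<open>\<open>8 * T ^ 3 \<le> 2 ^ r\<close> makes the Lindsey errors of all
    \<open>T ^ 3\<close> boxes together at most \<open>n ^ 3 / 8\<close>; \<open>N\<close> makes the
    3-graph large enough for homogeneity; the 3 gives \<open>k \<ge> 24\<close>, so that collisions
    cost at most \<open>n ^ 3 / 8\<close>.\<close>
  define r where "r = 8 * T ^ 3 + N + 3"
  define k where "k = (4 :: nat) ^ r"
  define n where "n = real k"
  have r: "r < 2 ^ r" by (rule less_exp)
  have "(2 :: nat) ^ r \<le> k" unfolding k_def by (rule power_mono) auto
  moreover have "N \<le> r" "8 * T ^ 3 \<le> r" by (simp_all add: r_def)
  ultimately have k1: "N \<le> k" "8 * T ^ 3 \<le> 2 ^ r" using r by linarith+
  have "(4 :: nat) ^ 3 \<le> k" unfolding k_def by (rule power_increasing) (auto simp: r_def)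
  with k1 have k: "N \<le> k" "1 \<le> k" "24 \<le> k" "8 * T ^ 3 \<le> 2 ^ r" by auto
  obtain H where H: "H \<in> \<H>" and "ubar_config H k" using conf[OF k(2)] by blast
  then obtain a b c where inja: "inj_on a {1..k}"
    and V: "a ` {1..k} \<subseteq> verts H" "b ` Pow {1..k} \<subseteq> verts H" "c ` {1..k} \<subseteq> verts H"
    and e: "\<forall>i\<in>{1..k}. \<forall>S\<subseteq>{1..k}. \<forall>j\<in>{1..k}. {a i, b S, c j} \<in> edges H \<longleftrightarrow> j \<in> S"
    unfolding ubar_config_def by (elim exE conjE) (rule that)
  note injb = ubar_config_inj(1)[OF k(2) e] and injc = ubar_config_inj(2)[OF k(2) e]
  define I where "I = Pow {..<2 * r}"
  have cI: "card I = k" by (simp add: I_def card_Pow power_mult k_def)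
  have finI: "finite I" by (simp add: I_def)
  obtain idx where idx: "bij_betw idx {1..k} I"
    using ex_bij_betw_nat_finite_1[OF finI] cI by auto
  \<comment> \<open>The set of columns in which row \<open>x\<close> of the matrix is 1; the
    configuration provides a vertex \<open>b (row x)\<close> whose edges realise this row.\<close>
  define row where "row = (\<lambda>x. {j \<in> {1..k}. even (card (x \<inter> idx j))})"
  have row_sub: "row x \<subseteq> {1..k}" for x by (auto simp: row_def)
  have inj_row: "inj_on row I"
  proof (rule inj_onI, rule ccontr)
    fix x y assume xy: "x \<in> I" "y \<in> I" "row x = row y" "x \<noteq> y"
    then obtain s where s: "s < 2 * r" "s \<in> x \<longleftrightarrow> s \<notin> y" unfolding I_def by blast
    then have "{s} \<in> I" by (simp add: I_def)
    then obtain j where j: "j \<in> {1..k}" "idx j = {s}" using idx unfolding bij_betw_def by (metis imageE)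
    have "j \<in> row z \<longleftrightarrow> s \<notin> z" for z
      using j by (cases "s \<in> z") (auto simp: row_def)
    with xy(3) s(2) show False by blast
  qed
  define \<beta> where "\<beta> = (\<lambda>x. b (row x))"
  have inj\<beta>: "inj_on \<beta> I"
    unfolding \<beta>_def using comp_inj_on[OF inj_row inj_on_subset[OF injb]] row_sub by (simp add: comp_def image_subset_iff)
  have edge: "{a i, \<beta> x, c j} \<in> edges H \<longleftrightarrow> walsh x (idx j) = 1" if "i \<in> {1..k}" "x \<in> I" "j \<in> {1..k}" for i x j
    using e[rule_format, OF that(1) row_sub that(3), of x] that(3) by (simp add: \<beta>_def row_def walsh_cases)
  \<comment> \<open>Only the \<open>k\<close> sets \<open>row x\<close> among all subsets of
    \<open>{1..k}\<close> are kept. With all of them present, the index triples would be a vanishing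
    proportion of the triples of vertices.\<close>
  define W where "W = a ` {1..k} \<union> \<beta> ` I \<union> c ` {1..k}"
  have "\<beta> x \<in> verts H" for x using V(2) row_sub[of x] by (auto simp: \<beta>_def)
  then have W_sub: "W \<subseteq> verts H" using V(1,3) by (auto simp: W_def)
  have finW: "finite W" using finI by (simp add: W_def)
  define G where "G = induced H W"
  have G: "G \<in> \<H>" using her H W_sub unfolding hereditary_def G_def by blast
  have vG: "verts G = W" by (simp add: G_def induced_def)
  define F where "F = edges G"
  have F: "{a i, \<beta> x, c j} \<in> F \<longleftrightarrow> walsh x (idx j) = 1" if "i \<in> {1..k}" "x \<in> I" "j \<in> {1..k}" for i x j
    using edge[OF that] that by (auto simp: F_def G_def induced_def W_def)
  have cW: "k \<le> card W" "card W \<le> 3 * k"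
  proof -
    have "card (a ` {1..k}) \<le> card W" using finW by (intro card_mono) (auto simp: W_def)
    then show "k \<le> card W" using inja by (simp add: card_image)
    have "card W \<le> card (a ` {1..k}) + card (\<beta> ` I) + card (c ` {1..k})"
      unfolding W_def by (meson add_le_mono1 card_Un_le le_trans)
    also have "\<dots> \<le> k + k + k"
      using card_image_le[of "{1..k}" a] card_image_le[OF finI, of \<beta>] card_image_le[of "{1..k}" c] cI by simp
    finally show "card W \<le> 3 * k" by simp
  qed
  obtain P where P: "card P \<le> T" "vdisc3_regular \<mu> G P" "homogeneous3 \<mu> G P"
    using TN[OF G] cW k(1) vG by fastforce
  have part: "partition_on W P" using P(2) by (simp add: vdisc3_regular_def equipartition_def vG)
  have finP: "finite P" using part finW by (rule finite_elements[rotated])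
  have PW: "X \<subseteq> W" "finite X" if "X \<in> P" for X
  proof -
    show "X \<subseteq> W" using partition_onD1[OF part] that by auto
    then show "finite X" using finW by (rule finite_subset)
  qed
  have Pdisj: "X \<inter> Y = {}" if "X \<in> P" "Y \<in> P" "X \<noteq> Y" for X Y
    using partition_onD2[OF part] that by (rule disjointD)
  define ext where "ext = (\<lambda>K. real (card (F \<inter> K)) / real (card K) \<in> {0..<\<mu>} \<union> {1 - \<mu><..1})"
  define \<G> where "\<G> = {(X, Y, Z). X \<in> P \<and> Y \<in> P \<and> Z \<in> P \<and> X \<noteq> Y \<and> X \<noteq> Z \<and> Y \<noteq> Z \<and> ext (K3 X Y Z)}"
  have \<G>_sub: "\<G> \<subseteq> P \<times> P \<times> P" by (auto simp: \<G>_def)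
  then have fin\<G>: "finite \<G>" using finP finite_subset by blast
  define A where "A = (\<lambda>X. {i \<in> {1..k}. a i \<in> X})"
  define B where "B = (\<lambda>X. {x \<in> I. \<beta> x \<in> X})"
  define C where "C = (\<lambda>X. {j \<in> {1..k}. c j \<in> X})"
  let ?\<Omega> = "{1..k} \<times> I \<times> {1..k}"
  have c\<Omega>: "real (card ?\<Omega>) = n ^ 3" by (simp add: card_cartesian_product cI n_def power3_eq_cube)
  have pow: "(8 :: real) ^ r * 2 ^ r = n ^ 2"
    by (simp add: n_def k_def power_mult_distrib[symmetric] power2_eq_square)
  \<comment> \<open>One of \<open>P1\<close>, \<open>P0\<close> has at most \<open>\<mu>\<close>
    times the volume of the box of parts, by extreme density, and their sizes differ by the Walsh
    sum, at most \<open>n * 8 ^ r\<close>. Their total is twice the smaller plus the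
    difference.\<close>
  have box: "real (card (A X \<times> B Y \<times> C Z)) \<le> 2 * \<mu> * (real (card X) * real (card Y) * real (card Z)) + n * 8 ^ r"
    if "(X, Y, Z) \<in> \<G>" for X Y Z
  proof -
    have XYZ: "X \<in> P" "Y \<in> P" "Z \<in> P" "X \<noteq> Y" "X \<noteq> Z" "Y \<noteq> Z" "ext (K3 X Y Z)"
      using that by (auto simp: \<G>_def)
    note dj = Pdisj[OF XYZ(1,2,4)] Pdisj[OF XYZ(1,3,5)] Pdisj[OF XYZ(2,3,6)]
    define M where "M = real (card X) * real (card Y) * real (card Z)"
    have M: "real (card (K3 X Y Z)) = M" by (simp add: card_K3_disjoint[OF dj] M_def)
    define Bx where "Bx = A X \<times> B Y \<times> C Z"
    have finBx: "finite Bx" using finI by (simp add: Bx_def A_def B_def C_def)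
    define P1 where "P1 = {(i, x, j) \<in> Bx. walsh x (idx j) = 1}"
    define P0 where "P0 = {(i, x, j) \<in> Bx. walsh x (idx j) \<noteq> 1}"
    have "Bx = P1 \<union> P0" "P1 \<inter> P0 = {}" by (auto simp: P1_def P0_def)
    then have Bx: "card Bx = card P1 + card P0"
      using finBx by (simp add: card_Un_disjoint)
    let ?\<psi> = "\<lambda>(i, x, j). {a i, \<beta> x, c j}"
    have inj\<psi>: "inj_on ?\<psi> Bx"
    proof (rule inj_onI)
      fix q q' assume q: "q \<in> Bx" "q' \<in> Bx" "?\<psi> q = ?\<psi> q'"
      obtain i x j i' x' j' where qq: "q = (i, x, j)" "q' = (i', x', j')" by (metis prod_cases3)
      have m: "(a i, \<beta> x, c j) \<in> X \<times> Y \<times> Z" "(a i', \<beta> x', c j') \<in> X \<times> Y \<times> Z"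
        using q by (auto simp: qq Bx_def A_def B_def C_def)
      have "(a i, \<beta> x, c j) = (a i', \<beta> x', c j')"
        by (rule inj_onD[OF K3_disjoint(2)[OF dj] _ m]) (use q(3) in \<open>simp add: qq\<close>)
      moreover have "i \<in> {1..k}" "i' \<in> {1..k}" "x \<in> I" "x' \<in> I" "j \<in> {1..k}" "j' \<in> {1..k}"
        using q by (auto simp: qq Bx_def A_def B_def C_def)
      ultimately show "q = q'" using inja inj\<beta> injc unfolding qq by (simp add: inj_on_eq_iff)
    qed
    have finK: "finite (K3 X Y Z)" using PW(2)[OF XYZ(1)] PW(2)[OF XYZ(2)] PW(2)[OF XYZ(3)]
      by (simp add: K3_disjoint(1)[OF dj])
    have \<psi>K: "?\<psi> q \<in> K3 X Y Z" if "q \<in> Bx" for q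
      using that unfolding K3_disjoint(1)[OF dj] by (force simp: Bx_def A_def B_def C_def)
    have F_iff: "?\<psi> (i, x, j) \<in> F \<longleftrightarrow> walsh x (idx j) = 1" if "(i, x, j) \<in> Bx" for i x j
      using that F[of i x j] by (auto simp: Bx_def A_def B_def C_def)
    have "card P1 \<le> card (F \<inter> K3 X Y Z)"
    proof (rule card_inj_on_le[where f = ?\<psi>])
      show "inj_on ?\<psi> P1" by (rule inj_on_subset[OF inj\<psi>]) (auto simp: P1_def)
      show "?\<psi> ` P1 \<subseteq> F \<inter> K3 X Y Z" using \<psi>K F_iff unfolding P1_def by fast
    qed (use finK in simp)
    moreover have "card P0 \<le> card (K3 X Y Z - F)"
    proof (rule card_inj_on_le[where f = ?\<psi>])
      show "inj_on ?\<psi> P0" by (rule inj_on_subset[OF inj\<psi>]) (auto simp: P0_def)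
      show "?\<psi> ` P0 \<subseteq> K3 X Y Z - F" using \<psi>K F_iff unfolding P0_def by fast
    qed (use finK in simp)
    moreover have "card (K3 X Y Z - F) + card (F \<inter> K3 X Y Z) = card (K3 X Y Z)"
      using finK by (subst card_Un_disjoint[symmetric]) (auto intro: arg_cong[where f = card])
    moreover have "real (card (F \<inter> K3 X Y Z)) \<le> \<mu> * M \<or> M - \<mu> * M \<le> real (card (F \<inter> K3 X Y Z))"
    proof (cases "M = 0")
      case False
      then have "M > 0" by (simp add: M_def zero_less_mult_iff)
      define f where "f = real (card (F \<inter> K3 X Y Z))"
      have "f / M < \<mu> \<or> 1 - \<mu> < f / M" using XYZ(7) by (auto simp: ext_def M f_def)
      then have "f < \<mu> * M \<or> (1 - \<mu>) * M < f" using \<open>M > 0\<close> by (simp add: divide_less_eq less_divide_eq)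
      then show ?thesis by (auto simp: f_def left_diff_distrib)
    qed (use M finK in \<open>auto simp: card_mono\<close>)
    ultimately have min: "real (card P1) \<le> \<mu> * M \<or> real (card P0) \<le> \<mu> * M" using M by linarith
    have "(\<Sum>(i, x, j)\<in>Bx. walsh x (idx j)) = real (card P1) - real (card P0)"
    proof -
      have sets: "{q \<in> Bx. q \<in> P1} = P1" "{q \<in> Bx. q \<in> P0} = P0" by (auto simp: P1_def P0_def)
      have "(\<Sum>(i, x, j)\<in>Bx. walsh x (idx j)) = (\<Sum>q\<in>Bx. of_bool (q \<in> P1) - of_bool (q \<in> P0))"
        by (intro sum.cong refl) (auto simp: P1_def P0_def walsh_cases)
      also have "\<dots> = real (card {q \<in> Bx. q \<in> P1}) - real (card {q \<in> Bx. q \<in> P0})"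
        by (simp only: sum_subtractf sum_of_bool_eq_card[OF finBx])
      finally show ?thesis unfolding sets .
    qed
    moreover have "\<bar>\<Sum>(i, x, j)\<in>Bx. walsh x (idx j)\<bar> \<le> n * 8 ^ r"
    proof -
      have "(\<Sum>(i, x, j)\<in>Bx. walsh x (idx j)) = (\<Sum>i\<in>A X. \<Sum>x\<in>B Y. \<Sum>j\<in>C Z. walsh x (idx j))"
        unfolding Bx_def sum_triple by simp
      also have "\<dots> = card (A X) * (\<Sum>x\<in>B Y. \<Sum>y\<in>idx ` C Z. walsh x y)"
      proof -
        have "inj_on idx (C Z)"
          by (rule inj_on_subset[OF bij_betw_imp_inj_on[OF idx]]) (auto simp: C_def)
        then show ?thesis by (simp add: sum.reindex)
      qed
      finally have eq: "(\<Sum>(i, x, j)\<in>Bx. walsh x (idx j)) = card (A X) * (\<Sum>x\<in>B Y. \<Sum>y\<in>idx ` C Z. walsh x y)" .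
      have "\<bar>\<Sum>x\<in>B Y. \<Sum>y\<in>idx ` C Z. walsh x y\<bar> \<le> 8 ^ r"
        using idx by (intro lindsey_inequality) (auto simp: B_def C_def I_def bij_betw_def)
      moreover have "card (A X) \<le> card {1..k}" by (intro card_mono) (auto simp: A_def)
      then have "real (card (A X)) \<le> n" by (simp add: n_def)
      ultimately show ?thesis unfolding eq abs_mult by (intro mult_mono) auto
    qed
    ultimately have "real (card Bx) \<le> 2 * (\<mu> * M) + n * 8 ^ r" using min unfolding Bx of_nat_add by linarith
    then show ?thesis by (simp add: Bx_def M_def mult.assoc)
  qed
  \<comment> \<open>Vertices from different families might coincide, and then an index triple gives
    no 3-set. Injectivity within each family bounds each kind of coincidence by
    \<open>k ^ 2\<close>.\<close>
  define D1 where "D1 = {(i, x, j). i \<in> {1..k} \<and> x \<in> I \<and> j \<in> {1..k} \<and> a i = \<beta> x}"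
  define D2 where "D2 = {(i, x, j). i \<in> {1..k} \<and> x \<in> I \<and> j \<in> {1..k} \<and> a i = c j}"
  define D3 where "D3 = {(x, i, j). x \<in> I \<and> i \<in> {1..k} \<and> j \<in> {1..k} \<and> \<beta> x = c j}"
  have cD: "card D1 \<le> k * k" "card D2 \<le> k * k" "card D3 \<le> k * k"
  proof -
    have "card D1 \<le> card I * card {1..k}" unfolding D1_def
      using finI card_inj_fiber_le_1[OF inja] by (intro card_vertex_collisions_le) auto
    then show "card D1 \<le> k * k" by (simp add: cI)
    have "card D2 \<le> card I * card {1..k}" unfolding D2_def
      using finI card_inj_fiber_le_1[OF inja] by (intro card_vertex_collisions_le) auto
    then show "card D2 \<le> k * k" by (simp add: cI)
    have "card D3 \<le> card {1..k} * card {1..k}" unfolding D3_def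
      using finI card_inj_fiber_le_1[OF inj\<beta>] by (intro card_vertex_collisions_le) auto
    then show "card D3 \<le> k * k" by simp
  qed
  define Bad where "Bad = [W]\<^bsup>3\<^esup> - {S \<in> [W]\<^bsup>3\<^esup>. \<exists>X\<in>P. \<exists>Y\<in>P. \<exists>Z\<in>P. X \<noteq> Y \<and> X \<noteq> Z \<and> Y \<noteq> Z \<and> S \<in> K3 X Y Z \<and> ext (K3 X Y Z)}"
  have finW3: "finite ([W]\<^bsup>3\<^esup>)" using finW by (rule finite_imp_finite_nsets)
  have cBad: "6 * real (card Bad) \<le> \<mu> * (27 * n ^ 3)"
  proof -
    let ?good = "{S \<in> [W]\<^bsup>3\<^esup>. \<exists>X\<in>P. \<exists>Y\<in>P. \<exists>Z\<in>P. X \<noteq> Y \<and> X \<noteq> Z \<and> Y \<noteq> Z \<and> S \<in> K3 X Y Z \<and> ext (K3 X Y Z)}"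
    have "(1 - \<mu>) * real (card W choose 3) \<le> real (card ?good)"
      using P(3) unfolding homogeneous3_def vG F_def[symmetric] ext_def .
    moreover have "card Bad = card ([W]\<^bsup>3\<^esup>) - card ?good"
      unfolding Bad_def by (intro card_Diff_subset finite_subset[OF _ finW3] Collect_subset)
    moreover have "card ?good \<le> card ([W]\<^bsup>3\<^esup>)" by (intro card_mono finW3 Collect_subset)
    moreover have "card ([W]\<^bsup>3\<^esup>) = card W choose 3" by (rule card_nsets)
    ultimately have le: "real (card Bad) \<le> \<mu> * real (card W choose 3)"
      by (simp only: of_nat_diff left_diff_distrib)
    have "(card W choose 3) * fact 3 \<le> card W ^ 3" by (rule binomial_fact_pow)
    also have "\<dots> \<le> (3 * k) ^ 3" using cW(2) by (rule power_mono) simp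
    finally have "real ((card W choose 3) * fact 3) \<le> real ((3 * k) ^ 3)" by (simp only: of_nat_le_iff)
    then have "6 * real (card W choose 3) \<le> 27 * n ^ 3"
      by (simp add: n_def fact_numeral power_mult_distrib mult.commute)
    then have "\<mu> * (6 * real (card W choose 3)) \<le> \<mu> * (27 * n ^ 3)" using \<open>\<mu> > 0\<close> by (intro mult_left_mono) auto
    with le show ?thesis by linarith
  qed
  let ?\<psi> = "\<lambda>(i, x, j). {a i, \<beta> x, c j}"
  define E where "E = {q \<in> ?\<Omega>. ?\<psi> q \<in> Bad}"
  have fin\<Omega>: "finite ?\<Omega>" using finI by simp
  \<comment> \<open>A 3-set has \<open>3 ^ 3\<close> ordered triples of its elements, and each comes
    from at most one index triple.\<close>
  have cE: "card E \<le> 27 * card Bad"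
  proof -
    have "E = (\<Union>S\<in>Bad. {q \<in> ?\<Omega>. ?\<psi> q = S})" by (auto simp: E_def)
    then have "card E \<le> (\<Sum>S\<in>Bad. card {q \<in> ?\<Omega>. ?\<psi> q = S})"
      using card_UN_le[of Bad "\<lambda>S. {q \<in> ?\<Omega>. ?\<psi> q = S}"] finW3 by (simp add: Bad_def)
    also have "\<dots> \<le> (\<Sum>S\<in>Bad. 27)"
    proof (rule sum_mono)
      fix S assume "S \<in> Bad"
      then have S: "finite S" "card S = 3" by (auto simp: Bad_def nsets_def)
      have "card {q \<in> ?\<Omega>. ?\<psi> q = S} \<le> card (S \<times> S \<times> S)"
      proof (rule card_inj_on_le[where f = "map_prod a (map_prod \<beta> c)"])
        show "inj_on (map_prod a (map_prod \<beta> c)) {q \<in> ?\<Omega>. ?\<psi> q = S}"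
          by (rule inj_on_subset[OF map_prod_inj_on[OF inja map_prod_inj_on[OF inj\<beta> injc]]]) auto
        show "map_prod a (map_prod \<beta> c) ` {q \<in> ?\<Omega>. ?\<psi> q = S} \<subseteq> S \<times> S \<times> S" by auto
      qed (use S in simp)
      then show "card {q \<in> ?\<Omega>. ?\<psi> q = S} \<le> 27" by (simp add: card_cartesian_product S)
    qed
    finally show ?thesis by simp
  qed
  have cover: "?\<Omega> \<subseteq> (\<Union>(X, Y, Z)\<in>\<G>. A X \<times> B Y \<times> C Z) \<union> (D1 \<union> (D2 \<union> ((\<lambda>(x, i, j). (i, x, j)) ` D3 \<union> E)))"
  proof
    fix q assume q: "q \<in> ?\<Omega>"
    obtain i x j where qq: "q = (i, x, j)" by (metis prod_cases3)
    have ixj: "i \<in> {1..k}" "x \<in> I" "j \<in> {1..k}" using q by (auto simp: qq)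
    show "q \<in> (\<Union>(X, Y, Z)\<in>\<G>. A X \<times> B Y \<times> C Z) \<union> (D1 \<union> (D2 \<union> ((\<lambda>(x, i, j). (i, x, j)) ` D3 \<union> E)))"
    proof (cases "a i = \<beta> x \<or> a i = c j \<or> \<beta> x = c j \<or> q \<in> E")
      case True
      moreover have "q \<in> (\<lambda>(x, i, j). (i, x, j)) ` D3" if "\<beta> x = c j"
        by (rule image_eqI[of _ _ "(x, i, j)"]) (use that ixj in \<open>auto simp: qq D3_def\<close>)
      ultimately show ?thesis using ixj by (auto simp: qq D1_def D2_def)
    next
      case False
      then have neq: "a i \<noteq> \<beta> x" "a i \<noteq> c j" "\<beta> x \<noteq> c j" and "{a i, \<beta> x, c j} \<notin> Bad"
        using q by (auto simp: E_def qq)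
      moreover have "{a i, \<beta> x, c j} \<in> [W]\<^bsup>3\<^esup>" using neq ixj by (auto simp: nsets_def W_def)
      ultimately obtain X Y Z where XYZ: "X \<in> P" "Y \<in> P" "Z \<in> P" "X \<noteq> Y" "X \<noteq> Z" "Y \<noteq> Z"
        "{a i, \<beta> x, c j} \<in> K3 X Y Z" "ext (K3 X Y Z)" unfolding Bad_def by blast
      obtain X' Y' Z' where *: "a i \<in> X'" "\<beta> x \<in> Y'" "c j \<in> Z'" "K3 X' Y' Z' = K3 X Y Z"
        "X' \<in> {X, Y, Z}" "Y' \<in> {X, Y, Z}" "Z' \<in> {X, Y, Z}" "X' \<noteq> Y'" "X' \<noteq> Z'" "Y' \<noteq> Z'"
        by (rule K3_member_classes[OF XYZ(7,4,5,6)])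
      have "(X', Y', Z') \<in> \<G>" using * XYZ by (auto simp: \<G>_def)
      moreover have "q \<in> A X' \<times> B Y' \<times> C Z'" using * ixj by (auto simp: qq A_def B_def C_def)
      ultimately show ?thesis by blast
    qed
  qed
  have cPW: "(\<Sum>X\<in>P. card X) = card W"
    using card_Union_disjoint[of P] part PW(2) unfolding partition_on_def disjoint_def pairwise_def disjnt_def by auto
  have sumG: "(\<Sum>(X, Y, Z)\<in>\<G>. real (card (A X \<times> B Y \<times> C Z))) \<le> 54 * \<mu> * n ^ 3 + n ^ 3 / 8"
  proof -
    let ?w = "\<lambda>X. real (card X)"
    have "(\<Sum>(X, Y, Z)\<in>\<G>. real (card (A X \<times> B Y \<times> C Z))) \<le>
      (\<Sum>(X, Y, Z)\<in>\<G>. 2 * \<mu> * (?w X * ?w Y * ?w Z) + n * 8 ^ r)"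
      using box by (intro sum_mono) auto
    also have "\<dots> \<le> (\<Sum>(X, Y, Z)\<in>P \<times> P \<times> P. 2 * \<mu> * (?w X * ?w Y * ?w Z) + n * 8 ^ r)"
      using finP \<G>_sub \<open>\<mu> > 0\<close> by (intro sum_mono2) (auto simp: n_def)
    also have "\<dots> = 2 * \<mu> * (\<Sum>X\<in>P. \<Sum>Y\<in>P. \<Sum>Z\<in>P. ?w X * ?w Y * ?w Z) + real (card P) ^ 3 * (n * 8 ^ r)"
      unfolding sum_triple by (simp add: sum.distrib sum_distrib_left power3_eq_cube mult.assoc)
    also have "(\<Sum>X\<in>P. \<Sum>Y\<in>P. \<Sum>Z\<in>P. ?w X * ?w Y * ?w Z) = real (card W) ^ 3"
    proof -
      have "(\<Sum>X\<in>P. \<Sum>Y\<in>P. \<Sum>Z\<in>P. ?w X * ?w Y * ?w Z) = (\<Sum>X\<in>P. ?w X) * (\<Sum>X\<in>P. ?w X) * (\<Sum>X\<in>P. ?w X)"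
        by (simp add: sum_distrib_left sum_distrib_right mult.assoc mult.commute mult.left_commute)
      then show ?thesis by (simp add: cPW[symmetric] power3_eq_cube)
    qed
    finally have le: "(\<Sum>(X, Y, Z)\<in>\<G>. real (card (A X \<times> B Y \<times> C Z))) \<le>
      2 * \<mu> * real (card W) ^ 3 + real (card P) ^ 3 * (n * 8 ^ r)" .
    have "real (card W) \<le> 3 * n" using cW(2) unfolding n_def by simp
    then have "real (card W) ^ 3 \<le> (3 * n) ^ 3" by (intro power_mono) auto
    then have "2 * \<mu> * real (card W) ^ 3 \<le> 2 * \<mu> * (27 * n ^ 3)"
      using \<open>\<mu> > 0\<close> by (intro mult_left_mono) (auto simp: power_mult_distrib)
    moreover have "real (card P) ^ 3 * (n * 8 ^ r) \<le> n ^ 3 / 8"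
    proof -
      have "real (card P) ^ 3 \<le> real T ^ 3" using P(1) by (intro power_mono) auto
      moreover have "real (8 * T ^ 3) \<le> real (2 ^ r)" using k(4) by (simp only: of_nat_le_iff)
      then have "8 * real T ^ 3 \<le> 2 ^ r" by simp
      ultimately have "8 * real (card P) ^ 3 \<le> 2 ^ r" by linarith
      then have "8 * real (card P) ^ 3 * (n * 8 ^ r) \<le> 2 ^ r * (n * 8 ^ r)" by (rule mult_right_mono) (simp add: n_def)
      also have "\<dots> = n * (8 ^ r * 2 ^ r)" by simp
      also have "\<dots> = n ^ 3" unfolding pow by (simp add: power2_eq_square power3_eq_cube)
      finally show ?thesis by simp
    qed
    ultimately show ?thesis using le by simp
  qed
  have "card ?\<Omega> \<le> card ((\<Union>(X, Y, Z)\<in>\<G>. A X \<times> B Y \<times> C Z) \<union> (D1 \<union> (D2 \<union> ((\<lambda>(x, i, j). (i, x, j)) ` D3 \<union> E))))"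
  proof (rule card_mono[OF _ cover])
    have "D1 \<subseteq> ?\<Omega>" "D2 \<subseteq> ?\<Omega>" "(\<lambda>(x, i, j). (i, x, j)) ` D3 \<subseteq> ?\<Omega>" "E \<subseteq> ?\<Omega>"
      by (auto simp: D1_def D2_def D3_def E_def)
    note this[THEN finite_subset, OF fin\<Omega>]
    moreover have "finite (\<Union>(X, Y, Z)\<in>\<G>. A X \<times> B Y \<times> C Z)"
      using fin\<G> finI by (auto simp: A_def B_def C_def)
    ultimately show "finite ((\<Union>(X, Y, Z)\<in>\<G>. A X \<times> B Y \<times> C Z) \<union> (D1 \<union> (D2 \<union> ((\<lambda>(x, i, j). (i, x, j)) ` D3 \<union> E))))"
      by simp
  qed
  also have "\<dots> \<le> card (\<Union>(X, Y, Z)\<in>\<G>. A X \<times> B Y \<times> C Z) + (card D1 + (card D2 + (card ((\<lambda>(x, i, j). (i, x, j)) ` D3) + card E)))"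
    by (intro order_trans[OF card_Un_le] add_left_mono order_refl)
  also have "\<dots> \<le> (\<Sum>(X, Y, Z)\<in>\<G>. card (A X \<times> B Y \<times> C Z)) + (k * k + (k * k + (k * k + 27 * card Bad)))"
  proof (intro add_mono cD cE)
    show "card (\<Union>(X, Y, Z)\<in>\<G>. A X \<times> B Y \<times> C Z) \<le> (\<Sum>(X, Y, Z)\<in>\<G>. card (A X \<times> B Y \<times> C Z))"
      using card_UN_le[OF fin\<G>, of "\<lambda>(X, Y, Z). A X \<times> B Y \<times> C Z"] by (simp add: case_prod_unfold)
    have "finite D3" by (rule finite_subset[of _ "I \<times> {1..k} \<times> {1..k}"]) (use finI in \<open>auto simp: D3_def\<close>)
    then show "card ((\<lambda>(x, i, j). (i, x, j)) ` D3) \<le> k * k" using cD(3) card_image_le le_trans by blast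
  qed
  finally have "real (card ?\<Omega>) \<le> real ((\<Sum>(X, Y, Z)\<in>\<G>. card (A X \<times> B Y \<times> C Z)) + (k * k + (k * k + (k * k + 27 * card Bad))))"
    by (simp only: of_nat_le_iff)
  then have "n ^ 3 \<le> (\<Sum>(X, Y, Z)\<in>\<G>. real (card (A X \<times> B Y \<times> C Z))) + (3 * n ^ 2 + 27 * real (card Bad))"
    unfolding c\<Omega> by (simp add: n_def power2_eq_square case_prod_unfold)
  moreover have "3 * n ^ 2 \<le> n ^ 3 / 8"
  proof -
    have "24 * n ^ 2 \<le> n * n ^ 2" using k(3) by (intro mult_right_mono) (auto simp: n_def)
    then show ?thesis by (simp add: power2_eq_square power3_eq_cube)
  qed
  moreover have "n ^ 3 > 0" using k(2) by (simp add: n_def)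
  ultimately show False using sumG cBad unfolding \<mu>_def by linarith
qed

section \<open>Induced 3-graphs of positive density\<close>

text \<open>Induced embeddings. Extensionality makes the set finite, so its size divided by
  \<open>n\<close> to the number of vertices of \<Gamma> is an induced density.\<close>

definition emb :: "'a graph3 \<Rightarrow> 'b graph3 \<Rightarrow> ('a \<Rightarrow> 'b) set" where
  "emb \<Gamma> G = {\<phi> \<in> verts \<Gamma> \<rightarrow>\<^sub>E verts G. inj_on \<phi> (verts \<Gamma>) \<and>
     (\<forall>x\<in>verts \<Gamma>. \<forall>y\<in>verts \<Gamma>. \<forall>z\<in>verts \<Gamma>. {x, y, z} \<in> edges \<Gamma> \<longleftrightarrow> {\<phi> x, \<phi> y, \<phi> z} \<in> edges G)}"

lemma embD:
  assumes "\<phi> \<in> emb \<Gamma> G"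
  shows "\<phi> \<in> verts \<Gamma> \<rightarrow>\<^sub>E verts G" "inj_on \<phi> (verts \<Gamma>)"
    "\<And>x y z. x \<in> verts \<Gamma> \<Longrightarrow> y \<in> verts \<Gamma> \<Longrightarrow> z \<in> verts \<Gamma> \<Longrightarrow> {x, y, z} \<in> edges \<Gamma> \<longleftrightarrow> {\<phi> x, \<phi> y, \<phi> z} \<in> edges G"
  using assms unfolding emb_def by blast+

lemma finite_emb: "finite (verts \<Gamma>) \<Longrightarrow> finite (verts G) \<Longrightarrow> finite (emb \<Gamma> G)"
  by (rule finite_subset[of _ "verts \<Gamma> \<rightarrow>\<^sub>E verts G"]) (auto simp: emb_def intro!: finite_PiE)

text \<open>\<open>c\<close> may depend on \<Gamma>, and only arbitrarily large members of \<H> have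
  to reach it. Hence absence from this class means that the density tends to 0 along all of \<H>,
  which is the form used to avoid finitely many 3-graphs at once.\<close>

definition positive_part :: "nat graph3 set \<Rightarrow> nat graph3 set" where
  "positive_part \<H> = {\<Gamma>. finite (verts \<Gamma>) \<and> is_graph3 \<Gamma> \<and>
     (\<exists>c>0. \<forall>N. \<exists>G\<in>\<H>. N \<le> card (verts G) \<and>
        c * real (card (verts G)) ^ card (verts \<Gamma>) \<le> real (card (emb \<Gamma> G)))}"

lemma is_graph3_edgeE:
  assumes "is_graph3 G" "e \<in> edges G"
  obtains x y z where "e = {x, y, z}" "x \<in> verts G" "y \<in> verts G" "z \<in> verts G" "x \<noteq> y" "x \<noteq> z" "y \<noteq> z"
proof -
  have "e \<subseteq> verts G" "card e = 3" using assms by (auto simp: is_graph3_def nsets_def)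
  moreover from this obtain x y z where "e = {x, y, z}" "x \<noteq> y" "x \<noteq> z" "y \<noteq> z" by (auto simp: card_3_iff)
  ultimately show thesis by (intro that[of x y z]) auto
qed

lemma is_graph3_edge_distinct:
  assumes "is_graph3 G" "{x, y, z} \<in> edges G"
  shows "x \<noteq> y" "x \<noteq> z" "y \<noteq> z"
proof -
  have "card {x, y, z} = 3" using assms by (auto simp: is_graph3_def nsets_def)
  then show "x \<noteq> y" "x \<noteq> z" "y \<noteq> z" by (auto simp: card_insert_if split: if_splits)
qed

lemma iso3_sym:
  assumes "is_graph3 G" "iso3 G G'"
  shows "iso3 G' G"
proof -
  obtain f where f: "bij_betw f (verts G) (verts G')" "(\<lambda>e. f ` e) ` edges G = edges G'"
    using assms(2) unfolding iso3_def by blast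
  define g where "g = inv_into (verts G) f"
  have "g ` f ` e = e" if "e \<in> edges G" for e
  proof -
    have "e \<subseteq> verts G" using assms(1) that by (auto simp: is_graph3_def nsets_def)
    then show ?thesis using inv_into_image_cancel[OF bij_betw_imp_inj_on[OF f(1)]] by (simp add: g_def)
  qed
  then have "(\<lambda>e. g ` e) ` edges G' = edges G" unfolding f(2)[symmetric] by (auto simp: image_image)
  moreover have "bij_betw g (verts G') (verts G)" unfolding g_def using f(1) by (rule bij_betw_inv_into)
  ultimately show ?thesis unfolding iso3_def by blast
qed

lemma emb_imp_mem:
  assumes her: "hereditary \<H>" and G: "G \<in> \<H>" and \<Gamma>: "is_graph3 \<Gamma>" and \<phi>: "\<phi> \<in> emb \<Gamma> G"
  shows "\<Gamma> \<in> \<H>"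
proof -
  let ?W = "\<phi> ` verts \<Gamma>"
  note e = embD[OF \<phi>]
  have W: "?W \<subseteq> verts G" using e(1) by auto
  have gG: "is_graph3 G" using her G unfolding hereditary_def by blast
  have "(\<lambda>e. \<phi> ` e) ` edges \<Gamma> = {e \<in> edges G. e \<subseteq> ?W}"
  proof (intro equalityI subsetI)
    fix X assume "X \<in> (\<lambda>e. \<phi> ` e) ` edges \<Gamma>"
    then obtain s where s: "s \<in> edges \<Gamma>" "X = \<phi> ` s" by blast
    obtain x y z where "s = {x, y, z}" "x \<in> verts \<Gamma>" "y \<in> verts \<Gamma>" "z \<in> verts \<Gamma>"
      by (rule is_graph3_edgeE[OF \<Gamma> s(1)])
    then show "X \<in> {e \<in> edges G. e \<subseteq> ?W}" using s e(3)[of x y z] by auto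
  next
    fix X assume X: "X \<in> {e \<in> edges G. e \<subseteq> ?W}"
    then have "X \<in> edges G" by blast
    then obtain u v w where X3: "X = {u, v, w}" by (rule is_graph3_edgeE[OF gG])
    have "u \<in> ?W" "v \<in> ?W" "w \<in> ?W" using X X3 by auto
    then obtain x y z where xyz: "x \<in> verts \<Gamma>" "y \<in> verts \<Gamma>" "z \<in> verts \<Gamma>" "u = \<phi> x" "v = \<phi> y" "w = \<phi> z"
      by blast
    then have "{x, y, z} \<in> edges \<Gamma>" using e(3)[of x y z] X X3 by simp
    moreover have "X = \<phi> ` {x, y, z}" using X3 xyz by simp
    ultimately show "X \<in> (\<lambda>e. \<phi> ` e) ` edges \<Gamma>" by blast
  qed
  then have "iso3 \<Gamma> (induced G ?W)"
    unfolding iso3_def induced_def using e(2) by (auto simp: bij_betw_def)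
  then have "iso3 (induced G ?W) \<Gamma>" by (rule iso3_sym[OF \<Gamma>])
  moreover have "induced G ?W \<in> \<H>" using her G W unfolding hereditary_def by blast
  ultimately show ?thesis using her \<Gamma> unfolding hereditary_def by blast
qed

lemma positive_part_subset:
  assumes "hereditary \<H>"
  shows "positive_part \<H> \<subseteq> \<H>"
proof
  fix \<Gamma> assume "\<Gamma> \<in> positive_part \<H>"
  then obtain c where \<Gamma>: "is_graph3 \<Gamma>" "c > 0"
    and c: "\<forall>N. \<exists>G\<in>\<H>. N \<le> card (verts G) \<and> c * real (card (verts G)) ^ card (verts \<Gamma>) \<le> real (card (emb \<Gamma> G))"
    unfolding positive_part_def by blast
  then obtain G where G: "G \<in> \<H>" "1 \<le> card (verts G)" "c * real (card (verts G)) ^ card (verts \<Gamma>) \<le> real (card (emb \<Gamma> G))"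
    by blast
  have "0 < c * real (card (verts G)) ^ card (verts \<Gamma>)" using \<Gamma>(2) G(2) by simp
  with G(3) have "0 < real (card (emb \<Gamma> G))" by linarith
  then have "emb \<Gamma> G \<noteq> {}" by auto
  then show "\<Gamma> \<in> \<H>" using emb_imp_mem[OF assms G(1) \<Gamma>(1)] by blast
qed

text \<open>An embedding of \<Gamma> is determined by its restriction along \<open>\<phi>0\<close>
  and its values on the vertices missed by \<open>\<phi>0\<close>. Each missed vertex costs a factor
  of at most \<open>n\<close>, so the same constant \<open>c\<close> works for
  \<open>\<Gamma>0\<close>. This covers isomorphic copies and induced sub-3-graphs alike.\<close>

lemma positive_part_emb:
  fixes \<Gamma> \<Gamma>0 :: "nat graph3"
  assumes fin: "\<And>G. G \<in> \<H> \<Longrightarrow> finite (verts G)"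
    and \<Gamma>: "\<Gamma> \<in> positive_part \<H>" and \<Gamma>0: "is_graph3 \<Gamma>0" and \<phi>0: "\<phi>0 \<in> emb \<Gamma>0 \<Gamma>"
  shows "\<Gamma>0 \<in> positive_part \<H>"
proof -
  let ?V = "verts \<Gamma>" and ?U = "verts \<Gamma>0"
  obtain c where c: "c > 0" "finite ?V"
    "\<forall>N. \<exists>G\<in>\<H>. N \<le> card (verts G) \<and> c * real (card (verts G)) ^ card ?V \<le> real (card (emb \<Gamma> G))"
    using \<Gamma> unfolding positive_part_def by blast
  note e0 = embD[OF \<phi>0]
  have im: "\<phi>0 ` ?U \<subseteq> ?V" using e0(1) by auto
  have fin0: "finite ?U" using inj_on_finite[OF e0(2) im c(2)] .
  have card0: "card (\<phi>0 ` ?U) = card ?U" using e0(2) by (rule card_image)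
  then have le: "card ?U \<le> card ?V" using card_mono[OF c(2) im] by simp
  define B where "B = ?V - \<phi>0 ` ?U"
  have cB: "card B = card ?V - card ?U" unfolding B_def using card_Diff_subset[OF finite_imageI[OF fin0] im] card0 by simp
  have key: "card (emb \<Gamma> G) \<le> card (emb \<Gamma>0 G) * card (verts G) ^ card B" if G: "G \<in> \<H>" for G
  proof -
    define \<Psi> where "\<Psi> = (\<lambda>\<phi> :: nat \<Rightarrow> nat. (restrict (\<lambda>x. \<phi> (\<phi>0 x)) ?U, restrict \<phi> B))"
    have "card (emb \<Gamma> G) \<le> card (emb \<Gamma>0 G \<times> (B \<rightarrow>\<^sub>E verts G))"
    proof (rule card_inj_on_le[of \<Psi>])
      show "inj_on \<Psi> (emb \<Gamma> G)"
      proof (rule inj_onI)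
        fix \<phi> \<phi>' assume p: "\<phi> \<in> emb \<Gamma> G" "\<phi>' \<in> emb \<Gamma> G" "\<Psi> \<phi> = \<Psi> \<phi>'"
        show "\<phi> = \<phi>'"
        proof (rule PiE_ext[OF embD(1)[OF p(1)] embD(1)[OF p(2)]])
          fix x assume x: "x \<in> ?V"
          show "\<phi> x = \<phi>' x"
          proof (cases "x \<in> B")
            case True
            then show ?thesis using p(3) unfolding \<Psi>_def by (metis prod.inject restrict_apply')
          next
            case False
            then obtain y where "y \<in> ?U" "x = \<phi>0 y" using x unfolding B_def by blast
            then show ?thesis using p(3) unfolding \<Psi>_def by (metis (mono_tags, lifting) prod.inject restrict_apply')
          qed
        qed
      qed
      show "\<Psi> ` emb \<Gamma> G \<subseteq> emb \<Gamma>0 G \<times> (B \<rightarrow>\<^sub>E verts G)"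
      proof
        fix q assume "q \<in> \<Psi> ` emb \<Gamma> G"
        then obtain \<phi> where \<phi>: "\<phi> \<in> emb \<Gamma> G" "q = \<Psi> \<phi>" by blast
        note e = embD[OF \<phi>(1)]
        have V0: "\<phi>0 x \<in> ?V" if "x \<in> ?U" for x using im that by blast
        have "restrict (\<lambda>x. \<phi> (\<phi>0 x)) ?U \<in> emb \<Gamma>0 G"
          unfolding emb_def
        proof (intro CollectI conjI ballI)
          show "restrict (\<lambda>x. \<phi> (\<phi>0 x)) ?U \<in> ?U \<rightarrow>\<^sub>E verts G"
            using e(1) V0 by (auto simp: PiE_iff)
          show "inj_on (restrict (\<lambda>x. \<phi> (\<phi>0 x)) ?U) ?U"
          proof (rule inj_onI)
            fix x y assume "x \<in> ?U" "y \<in> ?U" "restrict (\<lambda>x. \<phi> (\<phi>0 x)) ?U x = restrict (\<lambda>x. \<phi> (\<phi>0 x)) ?U y"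
            then show "x = y" using inj_onD[OF e(2), of "\<phi>0 x" "\<phi>0 y"] inj_onD[OF e0(2), of x y] V0 by simp
          qed
          fix x y z assume "x \<in> ?U" "y \<in> ?U" "z \<in> ?U"
          then show "({x, y, z} \<in> edges \<Gamma>0) = ({restrict (\<lambda>x. \<phi> (\<phi>0 x)) ?U x, restrict (\<lambda>x. \<phi> (\<phi>0 x)) ?U y, restrict (\<lambda>x. \<phi> (\<phi>0 x)) ?U z} \<in> edges G)"
            using e0(3)[of x y z] e(3)[of "\<phi>0 x" "\<phi>0 y" "\<phi>0 z"] V0 by simp
        qed
        moreover have "restrict \<phi> B \<in> B \<rightarrow>\<^sub>E verts G" using e(1) by (auto simp: PiE_iff B_def)
        ultimately show "q \<in> emb \<Gamma>0 G \<times> (B \<rightarrow>\<^sub>E verts G)" by (simp add: \<phi>(2) \<Psi>_def)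
      qed
      show "finite (emb \<Gamma>0 G \<times> (B \<rightarrow>\<^sub>E verts G))"
        using finite_emb[OF fin0 fin[OF G]] fin[OF G] c(2) by (auto simp: B_def intro!: finite_PiE)
    qed
    then show ?thesis using c(2) by (simp add: card_cartesian_product card_funcsetE B_def)
  qed
  have "\<exists>G\<in>\<H>. N \<le> card (verts G) \<and> c * real (card (verts G)) ^ card ?U \<le> real (card (emb \<Gamma>0 G))" for N
  proof -
    obtain G where G: "G \<in> \<H>" "max N 1 \<le> card (verts G)" "c * real (card (verts G)) ^ card ?V \<le> real (card (emb \<Gamma> G))"
      using c(3) by blast
    let ?n = "real (card (verts G))"
    have n: "?n > 0" using G(2) by simp
    have "c * ?n ^ card ?U * ?n ^ card B = c * ?n ^ card ?V"
      using le by (simp add: cB mult.assoc power_add[symmetric])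
    also have "\<dots> \<le> real (card (emb \<Gamma>0 G) * card (verts G) ^ card B)"
      using G(3) key[OF G(1)] by (meson of_nat_le_iff order_trans)
    also have "\<dots> = real (card (emb \<Gamma>0 G)) * ?n ^ card B" by simp
    finally have "c * ?n ^ card ?U \<le> real (card (emb \<Gamma>0 G))" using n by simp
    with G show ?thesis by auto
  qed
  then show ?thesis unfolding positive_part_def using fin0 \<Gamma>0 c(1) by blast
qed

lemma hereditary_positive_part:
  assumes "hereditary \<H>"
  shows "hereditary (positive_part \<H>)"
proof -
  have fin: "finite (verts G)" if "G \<in> \<H>" for G using assms that unfolding hereditary_def by blast
  show ?thesis
    unfolding hereditary_def
  proof (intro conjI ballI allI impI)
    fix \<Gamma> assume \<Gamma>: "\<Gamma> \<in> positive_part \<H>"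
    then have g: "finite (verts \<Gamma>)" "is_graph3 \<Gamma>" by (auto simp: positive_part_def)
    then show "finite (verts \<Gamma>)" "is_graph3 \<Gamma>" by auto
    have edge_sub: "edges \<Gamma> \<subseteq> Pow (verts \<Gamma>)" using g(2) by (auto simp: is_graph3_def nsets_def)
    {
      fix \<Gamma>' :: "nat graph3" assume iso: "is_graph3 \<Gamma>' \<and> iso3 \<Gamma> \<Gamma>'"
      then obtain f where f: "bij_betw f (verts \<Gamma>) (verts \<Gamma>')" "(\<lambda>e. f ` e) ` edges \<Gamma> = edges \<Gamma>'"
        unfolding iso3_def by blast
      have injf: "inj_on f (verts \<Gamma>)" using f(1) by (rule bij_betw_imp_inj_on)
      define g where "g = restrict (inv_into (verts \<Gamma>) f) (verts \<Gamma>')"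
      have gf: "g x \<in> verts \<Gamma>" "f (g x) = x" if "x \<in> verts \<Gamma>'" for x
        using f(1) that unfolding g_def by (auto simp: bij_betw_def inv_into_into f_inv_into_f)
      have "g \<in> emb \<Gamma>' \<Gamma>"
        unfolding emb_def
      proof (intro CollectI conjI ballI)
        show "g \<in> verts \<Gamma>' \<rightarrow>\<^sub>E verts \<Gamma>" using gf(1) by (auto simp: PiE_iff g_def)
        show "inj_on g (verts \<Gamma>')" using gf(2) by (metis inj_onI)
        fix x y z assume xyz: "x \<in> verts \<Gamma>'" "y \<in> verts \<Gamma>'" "z \<in> verts \<Gamma>'"
        have "{x, y, z} = f ` {g x, g y, g z}" using gf(2) xyz by simp
        moreover have "f ` {g x, g y, g z} \<in> (\<lambda>e. f ` e) ` edges \<Gamma> \<longleftrightarrow> {g x, g y, g z} \<in> edges \<Gamma>"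
          using gf(1) xyz by (intro inj_on_image_mem_iff[OF inj_on_image_Pow[OF injf] _ edge_sub]) auto
        ultimately show "({x, y, z} \<in> edges \<Gamma>') = ({g x, g y, g z} \<in> edges \<Gamma>)" unfolding f(2) by simp
      qed
      then show "\<Gamma>' \<in> positive_part \<H>" using positive_part_emb[OF fin \<Gamma>] iso by blast
    }
    fix W assume W: "W \<subseteq> verts \<Gamma>"
    have "restrict (\<lambda>x. x) W \<in> emb (induced \<Gamma> W) \<Gamma>"
      using W by (auto simp: emb_def induced_def inj_on_def)
    moreover have "is_graph3 (induced \<Gamma> W)" using g(2) by (auto simp: is_graph3_def induced_def nsets_def)
    ultimately show "induced \<Gamma> W \<in> positive_part \<H>" using positive_part_emb[OF fin \<Gamma>] by blast
  qed
qed

lemma close_to_superset: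
  assumes "\<A> \<subseteq> \<B>"
  shows "close_to \<A> \<B>"
  unfolding close_to_def
proof (intro allI impI)
  fix \<delta> :: real assume "\<delta> > 0"
  then have "delta_close \<delta> G G" for G :: "nat graph3" by (simp add: delta_close_def)
  with assms show "\<exists>N. \<forall>G\<in>\<A>. N \<le> card (verts G) \<longrightarrow> (\<exists>G'\<in>\<B>. delta_close \<delta> G G')" by blast
qed

text \<open>Blowing up only the vertex \<open>a\<close> turns one shattered slice into many copies of it.\<close>

lemma positive_part_not_slice_shatters:
  assumes her: "hereditary \<H>" and no: "\<And>G. G \<in> \<H> \<Longrightarrow> \<not> ubar_config G k" and \<Gamma>: "\<Gamma> \<in> positive_part \<H>"
  shows "\<not> slice_shatters \<Gamma> (Suc k)"
proof
  assume "slice_shatters \<Gamma> (Suc k)"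
  then obtain a c b where a: "a \<in> verts \<Gamma>"
    and cV: "\<forall>i\<in>{1..Suc k}. c i \<in> verts \<Gamma>" and bV: "\<forall>S\<subseteq>{1..Suc k}. b S \<in> verts \<Gamma>"
    and e: "\<forall>i\<in>{1..Suc k}. \<forall>S\<subseteq>{1..Suc k}. {a, c i, b S} \<in> edges \<Gamma> \<longleftrightarrow> i \<in> S"
    unfolding slice_shatters_def by blast
  obtain \<gamma> where g: "finite (verts \<Gamma>)" "is_graph3 \<Gamma>" and \<gamma>: "\<gamma> > 0"
    "\<forall>N. \<exists>G\<in>\<H>. N \<le> card (verts G) \<and> \<gamma> * real (card (verts G)) ^ card (verts \<Gamma>) \<le> real (card (emb \<Gamma> G))"
    using \<Gamma> unfolding positive_part_def by blast
  \<comment> \<open>With \<open>Suc k\<close> added to the set, \<open>b' S\<close> lies on an edge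
    with \<open>a\<close> and so differs from \<open>a\<close>. One of the \<open>Suc k\<close>
    shattered points is spent on this.\<close>
  define b' where "b' = (\<lambda>S. b (insert (Suc k) S))"
  let ?V' = "verts \<Gamma> - {a}"
  have c': "c j \<in> ?V'" if "j \<in> {1..k}" for j
  proof -
    have "{a, c j, b {j}} \<in> edges \<Gamma>" using e that by auto
    from is_graph3_edge_distinct[OF g(2) this] show ?thesis using cV that by auto
  qed
  have b'V: "b' S \<in> ?V'" if S: "S \<subseteq> {1..k}" for S
  proof -
    have S': "insert (Suc k) S \<subseteq> {1..Suc k}" using S by auto
    have "{a, c (Suc k), b' S} \<in> edges \<Gamma>" using e[rule_format, of "Suc k", OF _ S'] by (simp add: b'_def)
    from is_graph3_edge_distinct[OF g(2) this] show ?thesis using bV S' by (auto simp: b'_def)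
  qed
  have e': "{a, b' S, c j} \<in> edges \<Gamma> \<longleftrightarrow> j \<in> S" if "S \<subseteq> {1..k}" "j \<in> {1..k}" for S j
  proof -
    have S': "insert (Suc k) S \<subseteq> {1..Suc k}" using that by auto
    have "{a, b' S, c j} = {a, c j, b (insert (Suc k) S)}" by (auto simp: b'_def)
    then show ?thesis using e[rule_format, of j, OF _ S'] that by auto
  qed
  obtain G where G: "G \<in> \<H>" "nat \<lceil>real k / \<gamma>\<rceil> + 1 \<le> card (verts G)"
    "\<gamma> * real (card (verts G)) ^ card (verts \<Gamma>) \<le> real (card (emb \<Gamma> G))"
    using \<gamma>(2) by blast
  have finG: "finite (verts G)" using her G(1) unfolding hereditary_def by blast
  define n where "n = real (card (verts G))"
  have n: "n > 0" using G(2) by (simp add: n_def)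
  have "real k / \<gamma> \<le> n" using G(2) unfolding n_def by linarith
  then have k: "real k \<le> \<gamma> * n" using \<gamma>(1) by (simp add: divide_le_eq mult.commute)
  define R where "R = (?V' \<rightarrow>\<^sub>E verts G)"
  have finR: "finite R" unfolding R_def using g(1) finG by (intro finite_PiE) auto
  have cR: "real (card R) = n ^ (card (verts \<Gamma>) - 1)"
    unfolding R_def n_def using g(1) a by (subst card_funcsetE) auto
  have cRpos: "real (card R) > 0" unfolding cR using n by simp
  have "card (verts \<Gamma>) > 0" using a g(1) by (auto simp: card_gt_0_iff)
  then have "n ^ card (verts \<Gamma>) = n * real (card R)" unfolding cR by (simp add: power_eq_if)
  \<comment> \<open>Embeddings are grouped by their values off \<open>a\<close>. Some group has at
    least \<open>\<gamma> * n \<ge> k\<close> members; these differ only in the image of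
    \<open>a\<close> and supply the first family of the configuration.\<close>
  define Q where "Q = (\<lambda>(\<phi> :: nat \<Rightarrow> nat) \<psi>. restrict \<phi> ?V' = \<psi>)"
  have one: "1 / real (card R) * real (card R) \<le> real (card {\<psi> \<in> R. Q \<phi> \<psi>})" if "\<phi> \<in> emb \<Gamma> G" for \<phi>
  proof -
    have "restrict \<phi> ?V' \<in> R" using embD(1)[OF that] by (auto simp: R_def PiE_iff)
    then have "{\<psi> \<in> R. Q \<phi> \<psi>} = {restrict \<phi> ?V'}" by (auto simp: Q_def)
    then show ?thesis using cRpos by simp
  qed
  have "R \<noteq> {}" using cRpos by auto
  obtain \<psi> where \<psi>: "\<psi> \<in> R" "1 / real (card R) * real (card (emb \<Gamma> G)) \<le> real (card {\<phi> \<in> emb \<Gamma> G. Q \<phi> \<psi>})"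
    by (rule popular_element[where P = Q, OF finite_emb[OF g(1) finG] finR \<open>R \<noteq> {}\<close> one])
  define S where "S = {\<phi> \<in> emb \<Gamma> G. Q \<phi> \<psi>}"
  have "\<gamma> * n = 1 / real (card R) * (\<gamma> * n ^ card (verts \<Gamma>))"
    using cRpos \<open>n ^ card (verts \<Gamma>) = _\<close> by simp
  also have "\<dots> \<le> 1 / real (card R) * real (card (emb \<Gamma> G))"
    using G(3) cRpos unfolding n_def by (intro mult_left_mono) auto
  finally have "real k \<le> real (card S)" using k \<psi>(2) unfolding S_def by linarith
  moreover have "inj_on (\<lambda>\<phi>. \<phi> a) S"
  proof (rule inj_onI)
    fix \<phi> \<phi>' assume p: "\<phi> \<in> S" "\<phi>' \<in> S" "\<phi> a = \<phi>' a"
    then have em: "\<phi> \<in> emb \<Gamma> G" "\<phi>' \<in> emb \<Gamma> G" and r: "restrict \<phi> ?V' = restrict \<phi>' ?V'" by (auto simp: S_def Q_def)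
    show "\<phi> = \<phi>'"
    proof (rule PiE_ext[OF embD(1)[OF em(1)] embD(1)[OF em(2)]])
      fix x assume "x \<in> verts \<Gamma>"
      then show "\<phi> x = \<phi>' x" using p(3) fun_cong[OF r, of x] by (cases "x = a") auto
    qed
  qed
  then have "card ((\<lambda>\<phi>. \<phi> a) ` S) = card S" by (rule card_image)
  ultimately have "card {1..k} \<le> card ((\<lambda>\<phi>. \<phi> a) ` S)" by simp
  moreover have "finite ((\<lambda>\<phi>. \<phi> a) ` S)" using finite_emb[OF g(1) finG] by (simp add: S_def)
  ultimately obtain \<alpha> where \<alpha>: "\<alpha> ` {1..k} \<subseteq> (\<lambda>\<phi>. \<phi> a) ` S" "inj_on \<alpha> {1..k}"
    using card_le_inj[of "{1..k}" "(\<lambda>\<phi>. \<phi> a) ` S"] by auto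
  have \<psi>V: "\<psi> x \<in> verts G" if "x \<in> ?V'" for x using \<psi>(1) that unfolding R_def by (rule PiE_mem)
  have "ubar_config G k"
    unfolding ubar_config_def
  proof (intro exI conjI ballI allI impI)
    show "inj_on \<alpha> {1..k}" by (rule \<alpha>(2))
    show "\<alpha> ` {1..k} \<subseteq> verts G"
    proof
      fix v assume "v \<in> \<alpha> ` {1..k}"
      then obtain \<phi> where "\<phi> \<in> S" "v = \<phi> a" using \<alpha>(1) by blast
      then show "v \<in> verts G" using PiE_mem[OF embD(1), of \<phi> \<Gamma> G a] a by (simp add: S_def)
    qed
    show "(\<lambda>S. \<psi> (b' S)) ` Pow {1..k} \<subseteq> verts G" using \<psi>V b'V by blast
    show "(\<lambda>j. \<psi> (c j)) ` {1..k} \<subseteq> verts G" using \<psi>V c' by blast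
    fix i X j assume iXj: "i \<in> {1..k}" "X \<subseteq> {1..k}" "j \<in> {1..k}"
    then obtain \<phi> where \<phi>: "\<phi> \<in> S" "\<alpha> i = \<phi> a" using \<alpha>(1) by blast
    then have em: "\<phi> \<in> emb \<Gamma> G" and r: "restrict \<phi> ?V' = \<psi>" by (auto simp: S_def Q_def)
    have bc: "b' X \<in> ?V'" "c j \<in> ?V'" using b'V[OF iXj(2)] c'[OF iXj(3)] .
    have "\<psi> (b' X) = \<phi> (b' X)" "\<psi> (c j) = \<phi> (c j)" unfolding r[symmetric] using bc by simp_all
    then have "{\<alpha> i, \<psi> (b' X), \<psi> (c j)} \<in> edges G \<longleftrightarrow> {a, b' X, c j} \<in> edges \<Gamma>"
      using embD(3)[OF em, of a "b' X" "c j"] a bc \<phi>(2) by simp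
    then show "({\<alpha> i, \<psi> (b' X), \<psi> (c j)} \<in> edges G) = (j \<in> X)" using e'[OF iXj(2,3)] by simp
  qed
  with no[OF G(1)] show False by blast
qed

lemma slice_shatters_antimono:
  assumes "slice_shatters H l" "k \<le> l"
  shows "slice_shatters H k"
proof -
  obtain a c b where "a \<in> verts H" "\<forall>i\<in>{1..l}. c i \<in> verts H" "\<forall>S\<subseteq>{1..l}. b S \<in> verts H"
    "\<forall>i\<in>{1..l}. \<forall>S\<subseteq>{1..l}. {a, c i, b S} \<in> edges H \<longleftrightarrow> i \<in> S"
    using assms(1) unfolding slice_shatters_def by blast
  moreover have sub: "{1..k} \<subseteq> {1..l}" using assms(2) by simp
  ultimately have "a \<in> verts H" "\<forall>i\<in>{1..k}. c i \<in> verts H" "\<forall>S\<subseteq>{1..k}. b S \<in> verts H"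
    "\<forall>i\<in>{1..k}. \<forall>S\<subseteq>{1..k}. {a, c i, b S} \<in> edges H \<longleftrightarrow> i \<in> S"
    by (meson subset_iff subset_trans)+
  then show ?thesis unfolding slice_shatters_def by (intro bexI exI conjI)
qed

lemma SVC_positive_part_le:
  assumes "hereditary \<H>" "\<And>G. G \<in> \<H> \<Longrightarrow> \<not> ubar_config G k" "\<Gamma> \<in> positive_part \<H>"
  shows "SVC \<Gamma> \<le> k"
proof -
  have "finite (verts \<Gamma>)" using assms(3) by (simp add: positive_part_def)
  moreover have "l \<le> k" if "slice_shatters \<Gamma> l" for l
    using slice_shatters_antimono[OF that, of "Suc k"] positive_part_not_slice_shatters[OF assms]
    by (meson not_less_eq_eq)
  ultimately show ?thesis by (simp add: SVC_le_iff)
qed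

section \<open>Random label-preserving maps\<close>

lemma card_PiE_fix3:
  fixes B :: "'a \<Rightarrow> 'b set"
  assumes "finite V" "x \<in> V" "y \<in> V" "z \<in> V" "x \<noteq> y" "x \<noteq> z" "y \<noteq> z"
    and "a \<in> B x" "b \<in> B y" "c \<in> B z"
  shows "card {\<pi> \<in> PiE V B. (\<pi> x, \<pi> y, \<pi> z) = (a, b, c)} * (card (B x) * card (B y) * card (B z)) = card (PiE V B)"
proof -
  define B' where "B' = B(x := {a}, y := {b}, z := {c})"
  have eq: "{\<pi> \<in> PiE V B. (\<pi> x, \<pi> y, \<pi> z) = (a, b, c)} = PiE V B'"
  proof (intro equalityI subsetI)
    fix \<pi> assume "\<pi> \<in> {\<pi> \<in> PiE V B. (\<pi> x, \<pi> y, \<pi> z) = (a, b, c)}"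
    then show "\<pi> \<in> PiE V B'" by (auto simp: PiE_iff B'_def)
  next
    fix \<pi> assume \<pi>: "\<pi> \<in> PiE V B'"
    have "\<pi> x = a" "\<pi> y = b" "\<pi> z = c"
      using PiE_mem[OF \<pi>, of x] PiE_mem[OF \<pi>, of y] PiE_mem[OF \<pi>, of z] assms by (auto simp: B'_def)
    moreover have "\<pi> v \<in> B v" if "v \<in> V" for v
      using PiE_mem[OF \<pi> that] assms by (auto simp: B'_def split: if_splits)
    ultimately show "\<pi> \<in> {\<pi> \<in> PiE V B. (\<pi> x, \<pi> y, \<pi> z) = (a, b, c)}"
      using \<pi> by (auto simp: PiE_iff)
  qed
  let ?R = "V - {x, y, z}"
  have V: "V = insert x (insert y (insert z ?R))" using assms by auto
  have prod: "(\<Prod>v\<in>V. card (D v)) = card (D x) * card (D y) * card (D z) * (\<Prod>v\<in>?R. card (D v))" for D :: "'a \<Rightarrow> 'b set"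
    by (subst V) (use assms in \<open>simp add: mult.assoc\<close>)
  have "(\<Prod>v\<in>?R. card (B' v)) = (\<Prod>v\<in>?R. card (B v))" by (intro prod.cong) (auto simp: B'_def)
  then have "card (PiE V B') = (\<Prod>v\<in>?R. card (B v))"
    using assms by (simp add: card_PiE prod B'_def)
  then show ?thesis unfolding eq card_PiE[OF assms(1), of B] prod by simp
qed

text \<open>Three distinct coordinates of a uniform point of a product are independent and uniform
  on their fibres. Denominators are cleared.\<close>

lemma sum_PiE_marginal3:
  fixes B :: "'a \<Rightarrow> 'b set" and g :: "'b \<Rightarrow> 'b \<Rightarrow> 'b \<Rightarrow> real"
  assumes "finite V" "x \<in> V" "y \<in> V" "z \<in> V" "x \<noteq> y" "x \<noteq> z" "y \<noteq> z"
    and B: "\<And>v. v \<in> V \<Longrightarrow> finite (B v)"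
  shows "(\<Sum>\<pi>\<in>PiE V B. g (\<pi> x) (\<pi> y) (\<pi> z)) * (real (card (B x)) * real (card (B y)) * real (card (B z)))
    = card (PiE V B) * (\<Sum>(a, b, c)\<in>B x \<times> B y \<times> B z. g a b c)"
proof -
  let ?T = "B x \<times> B y \<times> B z" and ?l = "\<lambda>\<pi>. (\<pi> x, \<pi> y, \<pi> z)"
  let ?k = "real (card (B x)) * real (card (B y)) * real (card (B z))"
  have fin: "finite (PiE V B)" "finite ?T" using assms by (auto intro!: finite_PiE)
  have "?l ` PiE V B \<subseteq> ?T" using assms by auto
  then have "(\<Sum>\<pi>\<in>PiE V B. g (\<pi> x) (\<pi> y) (\<pi> z)) = (\<Sum>q\<in>?T. \<Sum>\<pi>\<in>{\<pi> \<in> PiE V B. ?l \<pi> = q}. g (\<pi> x) (\<pi> y) (\<pi> z))"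
    by (rule sum.group[OF fin, symmetric])
  also have "\<dots> = (\<Sum>(a, b, c)\<in>?T. card {\<pi> \<in> PiE V B. ?l \<pi> = (a, b, c)} * g a b c)"
  proof (intro sum.cong refl)
    fix q assume "q \<in> ?T"
    obtain a b c where q: "q = (a, b, c)" by (metis prod_cases3)
    have "(\<Sum>\<pi>\<in>{\<pi> \<in> PiE V B. ?l \<pi> = q}. g (\<pi> x) (\<pi> y) (\<pi> z)) = (\<Sum>\<pi>\<in>{\<pi> \<in> PiE V B. ?l \<pi> = q}. g a b c)"
      by (intro sum.cong refl) (auto simp: q)
    then show "(\<Sum>\<pi>\<in>{\<pi> \<in> PiE V B. ?l \<pi> = q}. g (\<pi> x) (\<pi> y) (\<pi> z)) =
      (case q of (a, b, c) \<Rightarrow> card {\<pi> \<in> PiE V B. ?l \<pi> = (a, b, c)} * g a b c)" by (simp add: q)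
  qed
  finally have "(\<Sum>\<pi>\<in>PiE V B. g (\<pi> x) (\<pi> y) (\<pi> z)) * ?k =
     (\<Sum>q\<in>?T. (case q of (a, b, c) \<Rightarrow> card {\<pi> \<in> PiE V B. ?l \<pi> = (a, b, c)} * g a b c) * ?k)"
    by (simp add: sum_distrib_right)
  also have "\<dots> = (\<Sum>q\<in>?T. card (PiE V B) * (case q of (a, b, c) \<Rightarrow> g a b c))"
  proof (intro sum.cong refl)
    fix q assume "q \<in> ?T"
    obtain a b c where q: "q = (a, b, c)" by (metis prod_cases3)
    have "card {\<pi> \<in> PiE V B. ?l \<pi> = (a, b, c)} * (card (B x) * card (B y) * card (B z)) = card (PiE V B)"
      using \<open>q \<in> ?T\<close> by (intro card_PiE_fix3[OF assms(1-7)]) (auto simp: q)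
    then have "real (card {\<pi> \<in> PiE V B. ?l \<pi> = (a, b, c)} * (card (B x) * card (B y) * card (B z))) = card (PiE V B)"
      by (rule arg_cong)
    then have "real (card {\<pi> \<in> PiE V B. ?l \<pi> = (a, b, c)}) * ?k = card (PiE V B)"
      by (simp only: of_nat_mult)
    then show "(case q of (a, b, c) \<Rightarrow> card {\<pi> \<in> PiE V B. ?l \<pi> = (a, b, c)} * g a b c) * ?k
      = card (PiE V B) * (case q of (a, b, c) \<Rightarrow> g a b c)" by (simp add: q)
  qed
  finally show ?thesis by (simp add: sum_distrib_left case_prod_unfold)
qed

text \<open>Otherwise each \<kappa> stops occurring beyond some size, and an object beyond the sum
  of these sizes has no \<kappa> left.\<close>

lemma infinite_pigeonhole:
  fixes f :: "'g \<Rightarrow> nat"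
  assumes "finite K" "\<And>N. \<exists>G. N \<le> f G \<and> (\<exists>\<kappa>\<in>K. R \<kappa> G)"
  shows "\<exists>\<kappa>\<in>K. \<forall>N. \<exists>G. N \<le> f G \<and> R \<kappa> G"
proof (rule ccontr)
  assume "\<not> ?thesis"
  then have "\<forall>\<kappa>\<in>K. \<exists>N. \<forall>G. R \<kappa> G \<longrightarrow> f G < N" by (meson not_le)
  from bchoice[OF this] obtain M where M: "\<forall>\<kappa>\<in>K. \<forall>G. R \<kappa> G \<longrightarrow> f G < M \<kappa>" by blast
  obtain G \<kappa> where G: "(\<Sum>\<kappa>\<in>K. M \<kappa>) \<le> f G" "\<kappa> \<in> K" "R \<kappa> G" using assms(2) by blast
  have "M \<kappa> \<le> (\<Sum>\<kappa>\<in>K. M \<kappa>)" using assms(1) G(2) by (intro member_le_sum) auto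
  with G M show False by fastforce
qed

lemma card_collisions_le:
  assumes "finite V" "finite V'" "x \<in> V" "y \<in> V" "x \<noteq> y"
  shows "card {\<pi> \<in> V \<rightarrow>\<^sub>E V'. \<pi> x = \<pi> y} \<le> card V' ^ (card V - 1)"
proof -
  have "card {\<pi> \<in> V \<rightarrow>\<^sub>E V'. \<pi> x = \<pi> y} \<le> card ((V - {y}) \<rightarrow>\<^sub>E V')"
  proof (rule card_inj_on_le[where f = "\<lambda>\<pi>. restrict \<pi> (V - {y})"])
    show "inj_on (\<lambda>\<pi>. restrict \<pi> (V - {y})) {\<pi> \<in> V \<rightarrow>\<^sub>E V'. \<pi> x = \<pi> y}"
    proof (rule inj_onI)
      fix \<pi> \<pi>' assume p: "\<pi> \<in> {\<pi> \<in> V \<rightarrow>\<^sub>E V'. \<pi> x = \<pi> y}" "\<pi>' \<in> {\<pi> \<in> V \<rightarrow>\<^sub>E V'. \<pi> x = \<pi> y}"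
        and r: "restrict \<pi> (V - {y}) = restrict \<pi>' (V - {y})"
      have *: "\<pi> v = \<pi>' v" if "v \<in> V" "v \<noteq> y" for v using fun_cong[OF r, of v] that by simp
      show "\<pi> = \<pi>'"
      proof (rule PiE_ext)
        show "\<pi> \<in> V \<rightarrow>\<^sub>E V'" "\<pi>' \<in> V \<rightarrow>\<^sub>E V'" using p by auto
        fix v assume "v \<in> V"
        then show "\<pi> v = \<pi>' v" using *[of v] *[of x] p assms by (cases "v = y") auto
      qed
    qed
    show "(\<lambda>\<pi>. restrict \<pi> (V - {y})) ` {\<pi> \<in> V \<rightarrow>\<^sub>E V'. \<pi> x = \<pi> y} \<subseteq> (V - {y}) \<rightarrow>\<^sub>E V'"
    proof (rule image_subsetI)
      fix \<pi> assume \<pi>: "\<pi> \<in> {\<pi> \<in> V \<rightarrow>\<^sub>E V'. \<pi> x = \<pi> y}"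
      have "\<pi> v \<in> V'" if "v \<in> V" for v using \<pi> that PiE_mem[of \<pi> V "\<lambda>_. V'" v] by simp
      then show "restrict \<pi> (V - {y}) \<in> (V - {y}) \<rightarrow>\<^sub>E V'" by (simp add: restrict_PiE_iff)
    qed
    show "finite ((V - {y}) \<rightarrow>\<^sub>E V')" using assms by (intro finite_PiE) auto
  qed
  also have "\<dots> = card V' ^ (card V - 1)" using assms by (subst card_funcsetE) auto
  finally show ?thesis .
qed

text \<open>A random map respecting the labels pulls \<open>G'\<close> back to a 3-graph close to \<open>G\<close>, because both are
  close to the same step pattern \<open>h\<close>.\<close>

lemma pullback_error_sum_le:
  fixes G :: "'a graph3" and G' :: "'b graph3"
  defines "V \<equiv> verts G" and "V' \<equiv> verts G'"
  assumes fin: "finite V" "finite V'" and g: "is_graph3 G" "is_graph3 G'"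
    and p: "equitable V p t" "equitable V' p' t" and t: "2 * t \<le> card V" "2 * t \<le> card V'" "0 < t"
    and err: "step_err G p h \<le> \<eta> * real (card V) ^ 3" "step_err G' p' h \<le> \<eta> * real (card V') ^ 3"
    and \<Omega>: "\<Omega> = PiE V (\<lambda>v. {w \<in> V'. p' w = p v})"
  shows "(\<Sum>\<pi>\<in>\<Omega>. \<Sum>(x, y, z)\<in>V \<times> V \<times> V. of_bool (({x, y, z} \<in> edges G) \<noteq> ({\<pi> x, \<pi> y, \<pi> z} \<in> edges G')))
    \<le> real (card \<Omega>) * (65 * \<eta> * real (card V) ^ 3)"
proof -
  define n where "n = real (card V)"
  define m where "m = real (card V')"
  have nm: "n > 0" "m > 0" using t by (simp_all add: n_def m_def)
  define cl where "cl = (\<lambda>i. {x \<in> V. p x = i})"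
  define cl' where "cl' = (\<lambda>i. {x \<in> V'. p' x = i})"
  define B where "B = (\<lambda>v. {w \<in> V'. p' w = p v})"
  have fin\<Omega>: "finite \<Omega>" unfolding \<Omega> using fin by (intro finite_PiE) auto
  have \<Omega>B: "\<Omega> = PiE V B" by (simp add: \<Omega> B_def)
  have pt: "p x < t" if "x \<in> V" for x using p(1) that by (simp add: equitable_def)
  have pt': "p' x < t" if "x \<in> V'" for x using p(2) that by (simp add: equitable_def)
  have clle: "card (cl i) \<le> 2 * n / t" if "i < t" for i
  proof -
    have "t * card (cl i) \<le> 2 * card V" using equitable_card(1)[OF fin(1) p(1) that] t by (simp add: cl_def)
    then have "real (t * card (cl i)) \<le> real (2 * card V)" by (simp only: of_nat_le_iff)
    then show ?thesis using t(3) by (simp add: n_def le_divide_eq mult.commute)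
  qed
  have Bge: "m / (2 * t) \<le> card (B v)" if "v \<in> V" for v
  proof -
    have "card V' \<le> t * card (B v) + t" using equitable_card(2)[OF fin(2) p(2) pt[OF that]] by (simp add: B_def)
    then have "card V' \<le> 2 * t * card (B v)" using t(2) by linarith
    then have "real (card V') \<le> real (2 * t * card (B v))" by (simp only: of_nat_le_iff)
    then show ?thesis using t(3) by (simp add: m_def divide_le_eq mult.commute)
  qed
  define e where "e = (\<lambda>x y z. of_bool (({x, y, z} \<in> edges G) \<noteq> ((p x, p y, p z) \<in> h)) :: real)"
  define e' where "e' = (\<lambda>x y z. of_bool (({x, y, z} \<in> edges G') \<noteq> ((p' x, p' y, p' z) \<in> h)) :: real)"
  define S where "S = (\<lambda>x y z. \<Sum>(a, b, c)\<in>B x \<times> B y \<times> B z. e' a b c)"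
  have S0: "0 \<le> S x y z" for x y z unfolding S_def e'_def by (intro sum_nonneg) auto
  \<comment> \<open>The reciprocal of a lower bound for the volume of a box of three fibres of
    \<open>G'\<close>.\<close>
  define u where "u = (2 * t / m) ^ 3"
  have marg: "(\<Sum>\<pi>\<in>\<Omega>. e' (\<pi> x) (\<pi> y) (\<pi> z)) \<le> card \<Omega> * (u * S x y z)"
    if xyz: "x \<in> V" "y \<in> V" "z \<in> V" "x \<noteq> y" "x \<noteq> z" "y \<noteq> z" for x y z
  proof -
    define k where "k = real (card (B x)) * real (card (B y)) * real (card (B z))"
    have eq: "(\<Sum>\<pi>\<in>\<Omega>. e' (\<pi> x) (\<pi> y) (\<pi> z)) * k = card \<Omega> * S x y z"
      unfolding \<Omega>B k_def S_def using fin by (intro sum_PiE_marginal3[OF fin(1) xyz]) (auto simp: B_def)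
    have "m / (2 * t) * (m / (2 * t)) * (m / (2 * t)) \<le> k"
      unfolding k_def using Bge xyz nm by (intro mult_mono) auto
    then have k: "(m / (2 * t)) ^ 3 \<le> k" by (simp add: power3_eq_cube)
    have "(m / (2 * t)) ^ 3 * u = 1" unfolding u_def using nm t(3) by (simp add: power_mult_distrib[symmetric])
    moreover have "0 \<le> u" using nm by (simp add: u_def)
    ultimately have "1 \<le> k * u" using mult_right_mono[OF k, of u] by simp
    moreover have "0 \<le> (\<Sum>\<pi>\<in>\<Omega>. e' (\<pi> x) (\<pi> y) (\<pi> z))" unfolding e'_def by (intro sum_nonneg) auto
    ultimately have "(\<Sum>\<pi>\<in>\<Omega>. e' (\<pi> x) (\<pi> y) (\<pi> z)) * 1 \<le> (\<Sum>\<pi>\<in>\<Omega>. e' (\<pi> x) (\<pi> y) (\<pi> z)) * (k * u)"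
      by (intro mult_left_mono)
    also have "\<dots> = card \<Omega> * (u * S x y z)" using eq by (simp add: mult.assoc[symmetric])
    finally show ?thesis by simp
  qed
  have pointwise: "(\<Sum>\<pi>\<in>\<Omega>. of_bool (({x, y, z} \<in> edges G) \<noteq> ({\<pi> x, \<pi> y, \<pi> z} \<in> edges G'))) \<le> card \<Omega> * (e x y z + u * S x y z)"
    if xyz: "x \<in> V" "y \<in> V" "z \<in> V" for x y z
  \<comment> \<open>On degenerate triples the three images are not independent, but neither 3-graph
    has an edge there.\<close>
  proof (cases "x = y \<or> x = z \<or> y = z")
    case True
    then have "{x, y, z} \<notin> edges G" "{\<pi> x, \<pi> y, \<pi> z} \<notin> edges G'" for \<pi>
      using is_graph3_edge_distinct[OF g(1)] is_graph3_edge_distinct[OF g(2)] by metis+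
    then have "(\<Sum>\<pi>\<in>\<Omega>. of_bool (({x, y, z} \<in> edges G) \<noteq> ({\<pi> x, \<pi> y, \<pi> z} \<in> edges G')) :: real) = 0" by simp
    moreover have "0 \<le> e x y z + u * S x y z" using S0 nm by (simp add: e_def u_def)
    ultimately show ?thesis by simp
  next
    case False
    have "(\<Sum>\<pi>\<in>\<Omega>. of_bool (({x, y, z} \<in> edges G) \<noteq> ({\<pi> x, \<pi> y, \<pi> z} \<in> edges G')))
      \<le> (\<Sum>\<pi>\<in>\<Omega>. e x y z + e' (\<pi> x) (\<pi> y) (\<pi> z))"
    proof (rule sum_mono)
      fix \<pi> assume "\<pi> \<in> \<Omega>"
      then have "p' (\<pi> x) = p x" "p' (\<pi> y) = p y" "p' (\<pi> z) = p z"
        using PiE_mem[of \<pi> V B] xyz unfolding \<Omega>B by (auto simp: B_def)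
      then show "of_bool (({x, y, z} \<in> edges G) \<noteq> ({\<pi> x, \<pi> y, \<pi> z} \<in> edges G')) \<le> e x y z + e' (\<pi> x) (\<pi> y) (\<pi> z)"
        unfolding e_def e'_def by (auto simp: of_bool_def)
    qed
    also have "\<dots> = card \<Omega> * e x y z + (\<Sum>\<pi>\<in>\<Omega>. e' (\<pi> x) (\<pi> y) (\<pi> z))" by (simp add: sum.distrib)
    also have "\<dots> \<le> card \<Omega> * e x y z + card \<Omega> * (u * S x y z)" using marg[OF xyz] False by simp
    finally show ?thesis by (simp add: distrib_left)
  qed
  \<comment> \<open>After exchanging the sums, a triple of \<open>V'\<close> is counted once for
    each triple of \<open>V\<close> with the same labels, at most \<open>(2 * n / t) ^ 3\<close>
    times.\<close>
  have sumS: "(\<Sum>(x, y, z)\<in>V \<times> V \<times> V. S x y z) \<le> (2 * n / t) ^ 3 * (\<eta> * m ^ 3)"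
  proof -
    have "(\<Sum>(x, y, z)\<in>V \<times> V \<times> V. S x y z)
       = (\<Sum>(x, y, z)\<in>V \<times> V \<times> V. \<Sum>(a, b, c)\<in>V' \<times> V' \<times> V'. of_bool (p' a = p x \<and> p' b = p y \<and> p' c = p z) * e' a b c)"
    proof (intro sum.cong refl, clarify)
      fix x y z assume "x \<in> V" "y \<in> V" "z \<in> V"
      show "S x y z = (\<Sum>(a, b, c)\<in>V' \<times> V' \<times> V'. of_bool (p' a = p x \<and> p' b = p y \<and> p' c = p z) * e' a b c)"
        unfolding S_def using fin by (intro sum.mono_neutral_cong_left) (auto simp: B_def)
    qed
    also have "\<dots> = (\<Sum>q\<in>V' \<times> V' \<times> V'. \<Sum>r\<in>V \<times> V \<times> V. case q of (a, b, c) \<Rightarrow> case r of (x, y, z) \<Rightarrow>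
        of_bool (p' a = p x \<and> p' b = p y \<and> p' c = p z) * e' a b c)"
      by (subst sum.swap) (simp add: case_prod_unfold)
    also have "\<dots> \<le> (\<Sum>q\<in>V' \<times> V' \<times> V'. (2 * n / t) ^ 3 * (case q of (a, b, c) \<Rightarrow> e' a b c))"
    proof (rule sum_mono)
      fix q assume "q \<in> V' \<times> V' \<times> V'"
      then obtain a b c where q: "q = (a, b, c)" "a \<in> V'" "b \<in> V'" "c \<in> V'" by auto
      have "(\<Sum>r\<in>V \<times> V \<times> V. case r of (x, y, z) \<Rightarrow> of_bool (p' a = p x \<and> p' b = p y \<and> p' c = p z) * e' a b c)
        = (\<Sum>r\<in>V \<times> V \<times> V. of_bool (r \<in> cl (p' a) \<times> cl (p' b) \<times> cl (p' c)) * e' a b c)"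
        by (intro sum.cong refl) (auto simp: cl_def)
      also have "\<dots> = (\<Sum>r\<in>V \<times> V \<times> V. of_bool (r \<in> cl (p' a) \<times> cl (p' b) \<times> cl (p' c))) * e' a b c"
        by (rule sum_distrib_right[symmetric])
      also have "(\<Sum>r\<in>V \<times> V \<times> V. of_bool (r \<in> cl (p' a) \<times> cl (p' b) \<times> cl (p' c)) :: real)
         = card {r \<in> V \<times> V \<times> V. r \<in> cl (p' a) \<times> cl (p' b) \<times> cl (p' c)}"
        using fin by (intro sum_of_bool_eq_card) auto
      also have "{r \<in> V \<times> V \<times> V. r \<in> cl (p' a) \<times> cl (p' b) \<times> cl (p' c)} = cl (p' a) \<times> cl (p' b) \<times> cl (p' c)"
        by (auto simp: cl_def)
      also have "real (card (cl (p' a) \<times> cl (p' b) \<times> cl (p' c))) = card (cl (p' a)) * (card (cl (p' b)) * real (card (cl (p' c))))"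
        by (simp add: card_cartesian_product)
      also have "\<dots> * e' a b c \<le> (2 * n / t * (2 * n / t * (2 * n / t))) * e' a b c"
        using clle[OF pt'] q nm by (intro mult_right_mono mult_mono) (auto simp: e'_def)
      finally show "(\<Sum>r\<in>V \<times> V \<times> V. case q of (a, b, c) \<Rightarrow> case r of (x, y, z) \<Rightarrow>
        of_bool (p' a = p x \<and> p' b = p y \<and> p' c = p z) * e' a b c) \<le> (2 * n / t) ^ 3 * (case q of (a, b, c) \<Rightarrow> e' a b c)"
        by (simp add: q power3_eq_cube mult.assoc)
    qed
    also have "\<dots> = (2 * n / t) ^ 3 * (\<Sum>(a, b, c)\<in>V' \<times> V' \<times> V'. e' a b c)" by (rule sum_distrib_left[symmetric])
    also have "(\<Sum>(a, b, c)\<in>V' \<times> V' \<times> V'. e' a b c) = step_err G' p' h"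
      unfolding sum_triple e'_def step_err_def V'_def by simp
    also have "(2 * n / t) ^ 3 * step_err G' p' h \<le> (2 * n / t) ^ 3 * (\<eta> * m ^ 3)"
      using err(2) nm unfolding m_def by (intro mult_left_mono) auto
    finally show ?thesis .
  qed
  have "(\<Sum>\<pi>\<in>\<Omega>. \<Sum>(x, y, z)\<in>V \<times> V \<times> V. of_bool (({x, y, z} \<in> edges G) \<noteq> ({\<pi> x, \<pi> y, \<pi> z} \<in> edges G')))
    = (\<Sum>q\<in>V \<times> V \<times> V. \<Sum>\<pi>\<in>\<Omega>. case q of (x, y, z) \<Rightarrow> (of_bool (({x, y, z} \<in> edges G) \<noteq> ({\<pi> x, \<pi> y, \<pi> z} \<in> edges G')) :: real))"
    by (rule sum.swap)
  also have "\<dots> \<le> (\<Sum>q\<in>V \<times> V \<times> V. case q of (x, y, z) \<Rightarrow> card \<Omega> * (e x y z + u * S x y z))"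
    using pointwise by (intro sum_mono) auto
  also have "\<dots> = card \<Omega> * ((\<Sum>(x, y, z)\<in>V \<times> V \<times> V. e x y z) + u * (\<Sum>(x, y, z)\<in>V \<times> V \<times> V. S x y z))"
    by (simp add: sum.distrib sum_distrib_left case_prod_unfold distrib_left)
  also have "(\<Sum>(x, y, z)\<in>V \<times> V \<times> V. e x y z) = step_err G p h"
    unfolding sum_triple e_def step_err_def V_def by simp
  also have "card \<Omega> * (step_err G p h + u * (\<Sum>(x, y, z)\<in>V \<times> V \<times> V. S x y z))
     \<le> card \<Omega> * (\<eta> * n ^ 3 + u * ((2 * n / t) ^ 3 * (\<eta> * m ^ 3)))"
    using err(1) sumS nm unfolding n_def[symmetric] by (intro mult_left_mono add_mono) (auto simp: u_def)
  \<comment> \<open>A factor 8 because classes of \<open>G\<close> have at most twice the mean size,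
    another 8 because those of \<open>G'\<close> have at least half of it. With the error of
    \<open>G\<close> itself this gives 65.\<close>
  also have "u * ((2 * n / t) ^ 3 * (\<eta> * m ^ 3)) = 64 * \<eta> * n ^ 3"
  proof -
    have "2 * t / m * (2 * n / t) * m = 4 * n" using nm t(3) by simp
    then have "(2 * t / m * (2 * n / t) * m) ^ 3 = 64 * n ^ 3" by (simp add: power_mult_distrib)
    then have "u * (2 * n / t) ^ 3 * m ^ 3 = 64 * n ^ 3" by (simp only: u_def power_mult_distrib)
    then show ?thesis by (simp add: mult.assoc mult.left_commute)
  qed
  finally show ?thesis by (simp add: n_def algebra_simps)
qed

lemma hereditaryD:
  assumes "hereditary \<H>" "G \<in> \<H>"
  shows "finite (verts G)" "is_graph3 G"
  using assms unfolding hereditary_def by blast+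

text \<open>The order of choices matters. A pattern common to arbitrarily large counterexamples
  comes first; then one counterexample \<open>G\<close>, which determines the finite set \<N> of
  3-graphs on its vertices to be avoided; then the density \<open>c\<close>; and last a member
  \<open>G'\<close> so large that each element of \<N> has density below \<open>c\<close> in
  it.\<close>

lemma approximable_imp_close_to_positive_part:
  assumes her: "hereditary \<H>" and ap: "approximable \<H>"
  shows "close_to \<H> (positive_part \<H>)"
proof (rule ccontr)
  assume "\<not> close_to \<H> (positive_part \<H>)"
  then obtain \<delta> where \<delta>: "\<delta> > 0"
    and far: "\<And>N. \<exists>G\<in>\<H>. N \<le> card (verts G) \<and> \<not> (\<exists>G'\<in>positive_part \<H>. delta_close \<delta> G G')"
    unfolding close_to_def by blast
  \<comment> \<open>\<open>260 = 4 * 65\<close>: the mean error of the pullback is at most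
    \<open>65 * \<eta> * n ^ 3\<close>, and by Markov's inequality at most a quarter of the maps
    exceed four times this.\<close>
  define \<eta> where "\<eta> = \<delta> / 260"
  have \<eta>: "\<eta> > 0" using \<delta> by (simp add: \<eta>_def)
  from ap[unfolded approximable_def, rule_format, OF \<eta>, of 1] obtain T N\<^sub>1 where
    TN: "\<And>G. G \<in> \<H> \<Longrightarrow> N\<^sub>1 \<le> card (verts G) \<Longrightarrow> \<exists>t p h. 1 \<le> t \<and> t \<le> T \<and> equitable (verts G) p t \<and>
      step_err G p h \<le> \<eta> * real (card (verts G)) ^ 3" by blast
  define R where "R = (\<lambda>(t, h) G. G \<in> \<H> \<and> \<not> (\<exists>G'\<in>positive_part \<H>. delta_close \<delta> G G') \<and>
     (\<exists>p. equitable (verts G) p t \<and> step_err G p h \<le> \<eta> * real (card (verts G)) ^ 3))"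
  define K where "K = {1..T} \<times> Pow ({..<T} \<times> {..<T} \<times> {..<T})"
  have "\<exists>G. N \<le> card (verts G) \<and> (\<exists>\<kappa>\<in>K. R \<kappa> G)" for N
  proof -
    obtain G where G: "G \<in> \<H>" "max N N\<^sub>1 \<le> card (verts G)" "\<not> (\<exists>G'\<in>positive_part \<H>. delta_close \<delta> G G')"
      using far by blast
    obtain t p h where t: "1 \<le> t" "t \<le> T" and p: "equitable (verts G) p t"
      and h: "step_err G p h \<le> \<eta> * real (card (verts G)) ^ 3"
      using TN[OF G(1)] G(2) by auto
    \<comment> \<open>Only labels below \<open>T\<close> occur, so cutting \<open>h\<close> down
      leaves the error unchanged and makes the set of possible patterns finite.\<close>
    define h' where "h' = h \<inter> {..<T} \<times> {..<T} \<times> {..<T}"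
    have pT: "p x < T" if "x \<in> verts G" for x using p t(2) that by (auto simp: equitable_def intro: less_le_trans)
    have "step_err G p h' = step_err G p h"
      unfolding step_err_def by (intro sum.cong refl) (use pT in \<open>auto simp: h'_def\<close>)
    then have "R (t, h') G" using G p h by (auto simp: R_def)
    moreover have "(t, h') \<in> K" using t by (auto simp: K_def h'_def)
    ultimately show ?thesis using G(2) by (intro exI[of _ G] conjI bexI[of _ "(t, h')"]) simp_all
  qed
  moreover have "finite K" by (simp add: K_def)
  ultimately obtain \<kappa> where \<kappa>: "\<kappa> \<in> K" "\<And>N. \<exists>G. N \<le> card (verts G) \<and> R \<kappa> G"
    using infinite_pigeonhole[of K "\<lambda>G. card (verts G)" R] by blast
  obtain t h where th: "\<kappa> = (t, h)" by (cases \<kappa>)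
  have t: "1 \<le> t" "t \<le> T" using \<kappa>(1) by (auto simp: th K_def)
  obtain G where "2 * t \<le> card (verts G)" "R \<kappa> G" using \<kappa>(2) by blast
  then obtain p where G: "G \<in> \<H>" "2 * t \<le> card (verts G)" and no: "\<not> (\<exists>G'\<in>positive_part \<H>. delta_close \<delta> G G')"
    and p: "equitable (verts G) p t" and err: "step_err G p h \<le> \<eta> * real (card (verts G)) ^ 3"
    unfolding th R_def by auto
  define V where "V = verts G"
  define n where "n = card V"
  have fin: "finite V" and gG: "is_graph3 G" using hereditaryD[OF her G(1)] by (simp_all add: V_def)
  have n: "n > 0" using G(2) t(1) by (simp add: n_def V_def)
  define \<N> where "\<N> = {(V, F) | F. F \<subseteq> [V]\<^bsup>3\<^esup>} - positive_part \<H>"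
  have fin\<N>: "finite \<N>"
  proof -
    have "{(V, F) | F. F \<subseteq> [V]\<^bsup>3\<^esup>} = Pair V ` Pow ([V]\<^bsup>3\<^esup>)" by auto
    then show ?thesis using finite_imp_finite_nsets[OF fin, of 3] by (simp add: \<N>_def)
  qed
  \<comment> \<open>A lower bound for the proportion of label-preserving maps among all maps, since
    each class of \<open>G'\<close> contains at least a proportion \<open>1 / (2 * t)\<close> of the
    vertices.\<close>
  define q where "q = (1 / (2 * real t)) ^ n"
  have q: "q > 0" using t(1) by (simp add: q_def)
  \<comment> \<open>Chosen so that embeddings of elements of \<N> number at most
    \<open>q / 4 * m ^ n\<close>, a quarter of the label-preserving maps.\<close>
  define c where "c = q / (4 * (real (card \<N>) + 1))"
  have c: "c > 0" using q by (simp add: c_def add_nonneg_pos)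
  have "\<forall>\<Gamma>\<in>\<N>. \<exists>N. \<forall>G'\<in>\<H>. N \<le> card (verts G') \<longrightarrow> real (card (emb \<Gamma> G')) < c * real (card (verts G')) ^ n"
  proof
    fix \<Gamma> assume \<Gamma>: "\<Gamma> \<in> \<N>"
    then have "finite (verts \<Gamma>)" "is_graph3 \<Gamma>" "card (verts \<Gamma>) = n" "\<Gamma> \<notin> positive_part \<H>"
      using fin by (auto simp: \<N>_def is_graph3_def n_def)
    then have "\<not> (\<forall>N. \<exists>G\<in>\<H>. N \<le> card (verts G) \<and> c * real (card (verts G)) ^ n \<le> real (card (emb \<Gamma> G)))"
      using c unfolding positive_part_def by blast
    then show "\<exists>N. \<forall>G'\<in>\<H>. N \<le> card (verts G') \<longrightarrow> real (card (emb \<Gamma> G')) < c * real (card (verts G')) ^ n"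
      by (meson not_le)
  qed
  from bchoice[OF this] obtain M where
    M: "\<And>\<Gamma> G'. \<Gamma> \<in> \<N> \<Longrightarrow> G' \<in> \<H> \<Longrightarrow> M \<Gamma> \<le> card (verts G') \<Longrightarrow> real (card (emb \<Gamma> G')) < c * real (card (verts G')) ^ n"
    by blast
  define N\<^sub>2 where "N\<^sub>2 = max (\<Sum>\<Gamma>\<in>\<N>. M \<Gamma>) (max (2 * t) (4 * n ^ 2 * (2 * t) ^ n))"
  obtain G' where "N\<^sub>2 \<le> card (verts G')" "R \<kappa> G'" using \<kappa>(2) by blast
  then obtain p' where G': "G' \<in> \<H>" "N\<^sub>2 \<le> card (verts G')"
    and p': "equitable (verts G') p' t" and err': "step_err G' p' h \<le> \<eta> * real (card (verts G')) ^ 3"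
    unfolding th R_def by auto
  define V' where "V' = verts G'"
  define m where "m = real (card V')"
  have fin': "finite V'" and gG': "is_graph3 G'" using hereditaryD[OF her G'(1)] by (simp_all add: V'_def)
  have mt: "2 * t \<le> card V'" and m4: "4 * n ^ 2 * (2 * t) ^ n \<le> card V'" and mM: "(\<Sum>\<Gamma>\<in>\<N>. M \<Gamma>) \<le> card V'"
    using G'(2) by (auto simp: N\<^sub>2_def V'_def)
  have m: "m > 0" using mt t(1) by (simp add: m_def)
  define B where "B = (\<lambda>v. {w \<in> V'. p' w = p v})"
  define \<Omega> where "\<Omega> = PiE V B"
  have fin\<Omega>: "finite \<Omega>" unfolding \<Omega>_def B_def using fin fin' by (intro finite_PiE) auto
  have \<Omega>_sub: "\<Omega> \<subseteq> V \<rightarrow>\<^sub>E V'" unfolding \<Omega>_def B_def by (intro PiE_mono) auto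
  have c\<Omega>: "q * m ^ n \<le> card \<Omega>"
  proof -
    have "m / (2 * t) \<le> card (B v)" if "v \<in> V" for v
    proof -
      have "p v < t" using p that by (simp add: equitable_def V_def)
      then have "card V' \<le> t * card (B v) + t" using equitable_card(2)[OF fin', of p' t "p v"] p' by (simp add: B_def V'_def)
      then have "card V' \<le> 2 * t * card (B v)" using mt by linarith
      then have "real (card V') \<le> real (2 * t * card (B v))" by (simp only: of_nat_le_iff)
      then show ?thesis using t(1) by (simp add: m_def divide_le_eq mult.commute)
    qed
    then have "(\<Prod>v\<in>V. m / (2 * t)) \<le> (\<Prod>v\<in>V. real (card (B v)))"
      using m t(1) by (intro prod_mono) auto
    also have "\<dots> = card \<Omega>" unfolding \<Omega>_def using fin by (simp add: card_PiE)
    finally show ?thesis by (simp add: n_def q_def power_divide)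
  qed
  have c\<Omega>0: "real (card \<Omega>) > 0" using c\<Omega> q m by (smt (verit) mult_pos_pos zero_less_power)
  \<comment> \<open>There are at most \<open>n ^ 2 * m ^ (n - 1)\<close> maps with a collision; the
    last entry of \<open>N\<^sub>2\<close> makes this at most a quarter of \<Omega>.\<close>
  define NI where "NI = {\<pi> \<in> \<Omega>. \<not> inj_on \<pi> V}"
  have NI: "4 * real (card NI) \<le> card \<Omega>"
  proof -
    let ?C = "\<lambda>(x, y). {\<pi> \<in> V \<rightarrow>\<^sub>E V'. \<pi> x = \<pi> y}"
    define D where "D = {(x, y) \<in> V \<times> V. x \<noteq> y}"
    have finD: "finite D" by (rule finite_subset[of _ "V \<times> V"]) (use fin in \<open>auto simp: D_def\<close>)
    have "NI \<subseteq> (\<Union>d\<in>D. ?C d)"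
    proof
      fix \<pi> assume \<pi>: "\<pi> \<in> NI"
      then obtain x y where "x \<in> V" "y \<in> V" "x \<noteq> y" "\<pi> x = \<pi> y" by (auto simp: NI_def inj_on_def)
      then have "(x, y) \<in> D" "\<pi> \<in> ?C (x, y)" using \<pi> \<Omega>_sub by (auto simp: NI_def D_def)
      then show "\<pi> \<in> (\<Union>d\<in>D. ?C d)" by blast
    qed
    moreover have "finite (\<Union>d\<in>D. ?C d)"
      by (rule finite_subset[of _ "V \<rightarrow>\<^sub>E V'"]) (use fin fin' in \<open>auto intro!: finite_PiE\<close>)
    ultimately have "card NI \<le> card (\<Union>d\<in>D. ?C d)" by (rule card_mono[rotated])
    also have "\<dots> \<le> (\<Sum>d\<in>D. card (?C d))" by (rule card_UN_le[OF finD])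
    also have "\<dots> \<le> (\<Sum>d\<in>D. card V' ^ (n - 1))"
      using card_collisions_le[OF fin fin'] by (intro sum_mono) (auto simp: D_def n_def)
    also have "\<dots> = card D * card V' ^ (n - 1)" by simp
    also have "card D \<le> card (V \<times> V)" using fin by (intro card_mono) (auto simp: D_def)
    then have "card D * card V' ^ (n - 1) \<le> n ^ 2 * card V' ^ (n - 1)"
      by (intro mult_right_mono) (simp_all add: card_cartesian_product n_def power2_eq_square)
    finally have "real (card NI) \<le> real (n ^ 2 * card V' ^ (n - 1))" by (simp only: of_nat_le_iff)
    then have 1: "real (card NI) \<le> real n ^ 2 * m ^ (n - 1)" by (simp add: m_def)
    have "real (4 * n ^ 2 * (2 * t) ^ n) \<le> real (card V')" using m4 by (simp only: of_nat_le_iff)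
    then have le: "q * (4 * real n ^ 2 * (2 * real t) ^ n) \<le> q * m" using q by (simp add: m_def)
    have "q * (2 * real t) ^ n = 1" using t(1) by (simp add: q_def power_one_over)
    then have "4 * real n ^ 2 = 4 * real n ^ 2 * (q * (2 * real t) ^ n)" by (simp only: mult_1_right)
    also have "\<dots> = q * (4 * real n ^ 2 * (2 * real t) ^ n)" by (simp only: mult.left_commute)
    finally have "4 * real n ^ 2 \<le> q * m" using le by linarith
    then have "4 * real n ^ 2 * m ^ (n - 1) \<le> q * m * m ^ (n - 1)" using m by (intro mult_right_mono) auto
    also have "\<dots> = q * m ^ n" using n by (simp add: power_eq_if mult.assoc)
    finally show ?thesis using 1 c\<Omega> by linarith
  qed
  define BE where "BE = (\<Union>\<Gamma>\<in>\<N>. emb \<Gamma> G')"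
  have BE: "4 * real (card BE) \<le> card \<Omega>"
  proof -
    have "card BE \<le> (\<Sum>\<Gamma>\<in>\<N>. card (emb \<Gamma> G'))" unfolding BE_def by (rule card_UN_le[OF fin\<N>])
    then have "real (card BE) \<le> (\<Sum>\<Gamma>\<in>\<N>. real (card (emb \<Gamma> G')))" by (simp flip: of_nat_sum)
    also have "\<dots> \<le> (\<Sum>\<Gamma>\<in>\<N>. c * m ^ n)"
    proof (rule sum_mono)
      fix \<Gamma> assume \<Gamma>: "\<Gamma> \<in> \<N>"
      have "M \<Gamma> \<le> (\<Sum>\<Gamma>\<in>\<N>. M \<Gamma>)" using fin\<N> \<Gamma> by (intro member_le_sum) auto
      then have "M \<Gamma> \<le> card (verts G')" using mM by (simp add: V'_def)
      from M[OF \<Gamma> G'(1) this] show "real (card (emb \<Gamma> G')) \<le> c * m ^ n" by (simp add: m_def V'_def)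
    qed
    also have "\<dots> = real (card \<N>) * c * m ^ n" by simp
    also have "\<dots> \<le> q / 4 * m ^ n"
    proof (rule mult_right_mono)
      have "real (card \<N>) * c \<le> (real (card \<N>) + 1) * c" using c by (simp add: distrib_right)
      also have "\<dots> = q / 4"
      proof -
        have "y * (q / (4 * y)) = q / 4" if "y > 0" for y :: real using that by simp
        from this[of "real (card \<N>) + 1"] show ?thesis unfolding c_def by (simp add: add_nonneg_pos)
      qed
      finally show "real (card \<N>) * c \<le> q / 4" .
    qed (use m in simp)
    finally show ?thesis using c\<Omega> by simp
  qed
  define dif where "dif = (\<lambda>\<pi>. \<Sum>(x, y, z)\<in>V \<times> V \<times> V. (of_bool (({x, y, z} \<in> edges G) \<noteq> ({\<pi> x, \<pi> y, \<pi> z} \<in> edges G')) :: real))"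
  define ES where "ES = {\<pi> \<in> \<Omega>. 260 * \<eta> * real n ^ 3 < dif \<pi>}"
  have ES: "4 * real (card ES) \<le> card \<Omega>"
  proof -
    have "real (card ES) * (260 * \<eta> * real n ^ 3) = (\<Sum>\<pi>\<in>ES. 260 * \<eta> * real n ^ 3)" by simp
    also have "\<dots> \<le> (\<Sum>\<pi>\<in>ES. dif \<pi>)" by (intro sum_mono) (auto simp: ES_def)
    also have "\<dots> \<le> (\<Sum>\<pi>\<in>\<Omega>. dif \<pi>)"
      using fin\<Omega> by (intro sum_mono2) (auto simp: ES_def dif_def intro!: sum_nonneg)
    also have "\<dots> \<le> card \<Omega> * (65 * \<eta> * real n ^ 3)"
      unfolding dif_def n_def V_def
      by (rule pullback_error_sum_le[where p = p and p' = p' and t = t and h = h])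
        (use fin fin' gG gG' p p' G(2) mt t err err' in \<open>simp_all add: V_def V'_def \<Omega>_def B_def\<close>)
    finally have "(4 * real (card ES)) * (65 * \<eta> * real n ^ 3) \<le> real (card \<Omega>) * (65 * \<eta> * real n ^ 3)" by simp
    then show ?thesis using \<eta> n by simp
  qed
  \<comment> \<open>Three exceptional sets of at most a quarter each leave a map that is injective,
    avoids \<N> and has small error.\<close>
  have "\<not> \<Omega> \<subseteq> NI \<union> (BE \<union> ES)"
  proof
    assume "\<Omega> \<subseteq> NI \<union> (BE \<union> ES)"
    moreover have "finite (NI \<union> (BE \<union> ES))"
    proof -
      have "finite (emb \<Gamma> G')" if "\<Gamma> \<in> \<N>" for \<Gamma>
        using that fin fin' by (intro finite_emb) (auto simp: \<N>_def V'_def)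
      then show ?thesis using fin\<Omega> fin\<N> by (simp add: NI_def BE_def ES_def)
    qed
    ultimately have "card \<Omega> \<le> card (NI \<union> (BE \<union> ES))" by (rule card_mono[rotated])
    also have "\<dots> \<le> card NI + (card BE + card ES)" by (intro order_trans[OF card_Un_le] add_left_mono order_refl)
    finally have "real (card \<Omega>) \<le> real (card NI) + (real (card BE) + real (card ES))" by simp
    with NI BE ES c\<Omega>0 show False by linarith
  qed
  then obtain \<pi> where \<pi>: "\<pi> \<in> \<Omega>" "\<pi> \<notin> NI" "\<pi> \<notin> BE" "\<pi> \<notin> ES" by blast
  have inj: "inj_on \<pi> V" using \<pi> by (simp add: NI_def)
  define \<Gamma> where "\<Gamma> = (V, {s \<in> [V]\<^bsup>3\<^esup>. \<pi> ` s \<in> edges G'})"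
  have edge: "{x, y, z} \<in> edges \<Gamma> \<longleftrightarrow> {\<pi> x, \<pi> y, \<pi> z} \<in> edges G'" if "x \<in> V" "y \<in> V" "z \<in> V" for x y z
  proof
    assume *: "{\<pi> x, \<pi> y, \<pi> z} \<in> edges G'"
    from is_graph3_edge_distinct[OF gG' this] have "x \<noteq> y" "x \<noteq> z" "y \<noteq> z" by auto
    then have "{x, y, z} \<in> [V]\<^bsup>3\<^esup>" using that by (auto simp: nsets_def)
    with * show "{x, y, z} \<in> edges \<Gamma>" by (simp add: \<Gamma>_def)
  qed (simp add: \<Gamma>_def)
  have "\<pi> \<in> emb \<Gamma> G'"
  proof -
    have "\<pi> \<in> V \<rightarrow>\<^sub>E V'" using \<pi>(1) \<Omega>_sub by blast
    moreover have "verts \<Gamma> = V" by (simp add: \<Gamma>_def)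
    ultimately show ?thesis using inj edge by (simp add: emb_def V'_def)
  qed
  then have "\<Gamma> \<notin> \<N>" using \<pi>(3) by (auto simp: BE_def)
  then have "\<Gamma> \<in> positive_part \<H>" by (auto simp: \<N>_def \<Gamma>_def)
  moreover have "delta_close \<delta> G \<Gamma>"
  proof -
    let ?D = "sym_diff (edges G) (edges \<Gamma>)" and ?\<phi> = "\<lambda>(x, y, z). {x, y, z}"
    define Q where "Q = {r \<in> V \<times> V \<times> V. (case r of (x, y, z) \<Rightarrow> ({x, y, z} \<in> edges G) \<noteq> ({\<pi> x, \<pi> y, \<pi> z} \<in> edges G'))}"
    have finQ: "finite Q" using fin by (simp add: Q_def)
    have g\<Gamma>: "is_graph3 \<Gamma>" by (auto simp: is_graph3_def \<Gamma>_def)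
    have "?D \<subseteq> ?\<phi> ` Q"
    proof
      fix s assume s: "s \<in> ?D"
      then have "s \<in> [V]\<^bsup>3\<^esup>" using gG g\<Gamma> by (auto simp: is_graph3_def V_def \<Gamma>_def)
      then obtain x y z where xyz: "s = {x, y, z}" "x \<in> V" "y \<in> V" "z \<in> V"
        by (auto simp: nsets_def card_3_iff)
      then have "(x, y, z) \<in> Q" using s edge[of x y z] by (auto simp: Q_def)
      with xyz(1) show "s \<in> ?\<phi> ` Q" by force
    qed
    then have "card ?D \<le> card Q" by (rule surj_card_le[OF finQ])
    then have "real (card ?D) \<le> real (card Q)" by simp
    also have "\<dots> = dif \<pi>"
    proof -
      have "(\<Sum>r\<in>V \<times> V \<times> V. of_bool (case r of (x, y, z) \<Rightarrow> ({x, y, z} \<in> edges G) \<noteq> ({\<pi> x, \<pi> y, \<pi> z} \<in> edges G'))) = real (card Q)"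
        unfolding Q_def using fin by (intro sum_of_bool_eq_card) auto
      then show ?thesis by (simp add: dif_def case_prod_unfold)
    qed
    also have "\<dots> \<le> \<delta> * real n ^ 3" using \<pi>(1,4) by (simp add: ES_def \<eta>_def not_less)
    finally show ?thesis by (simp add: delta_close_def V_def \<Gamma>_def n_def)
  qed
  ultimately show False using no by blast
qed

section \<open>Transfer along closeness and the equivalences\<close>

lemma step_err_close:
  assumes fin: "finite (verts G)" and g: "is_graph3 G" "is_graph3 G'" and dc: "delta_close \<delta> G G'"
  shows "step_err G p h \<le> step_err G' p h + 27 * \<delta> * real (card (verts G)) ^ 3"
proof -
  define V where "V = verts G"
  let ?D = "sym_diff (edges G) (edges G')" and ?\<phi> = "\<lambda>(x, y, z). {x, y, z}"
  have V: "verts G' = V" and D: "real (card ?D) \<le> \<delta> * real (card V) ^ 3"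
    using dc by (auto simp: delta_close_def V_def)
  have D3: "?D \<subseteq> [V]\<^bsup>3\<^esup>" using g V by (auto simp: is_graph3_def V_def)
  have finD: "finite ?D" using finite_subset[OF D3] finite_imp_finite_nsets fin by (auto simp: V_def)
  have finV3: "finite (V \<times> V \<times> V)" using fin by (simp add: V_def)
  have "step_err G p h \<le> (\<Sum>x\<in>V. \<Sum>y\<in>V. \<Sum>z\<in>V. of_bool (({x, y, z} \<in> edges G') \<noteq> ((p x, p y, p z) \<in> h)) + of_bool ({x, y, z} \<in> ?D))"
    unfolding step_err_def V_def[symmetric] by (intro sum_mono) (auto simp: of_bool_def)
  also have "\<dots> = step_err G' p h + (\<Sum>x\<in>V. \<Sum>y\<in>V. \<Sum>z\<in>V. of_bool ({x, y, z} \<in> ?D))"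
    unfolding step_err_def V by (simp add: sum.distrib)
  also have "(\<Sum>x\<in>V. \<Sum>y\<in>V. \<Sum>z\<in>V. of_bool ({x, y, z} \<in> ?D) :: real) = (\<Sum>r\<in>V \<times> V \<times> V. of_bool (?\<phi> r \<in> ?D))"
    unfolding sum_triple by simp
  also have "\<dots> = card {r \<in> V \<times> V \<times> V. ?\<phi> r \<in> ?D}" by (rule sum_of_bool_eq_card[OF finV3])
  \<comment> \<open>An altered edge affects only triples of its three elements, crudely
    \<open>3 ^ 3\<close> of them.\<close>
  also have "real (card {r \<in> V \<times> V \<times> V. ?\<phi> r \<in> ?D}) \<le> 27 * real (card ?D)"
  proof -
    have "{r \<in> V \<times> V \<times> V. ?\<phi> r \<in> ?D} \<subseteq> (\<Union>s\<in>?D. s \<times> s \<times> s)" by auto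
    moreover have "finite (\<Union>s\<in>?D. s \<times> s \<times> s)"
      by (rule finite_subset[OF _ finV3]) (use D3 in \<open>auto simp: nsets_def\<close>)
    ultimately have "card {r \<in> V \<times> V \<times> V. ?\<phi> r \<in> ?D} \<le> card (\<Union>s\<in>?D. s \<times> s \<times> s)" by (rule card_mono[rotated])
    also have "\<dots> \<le> (\<Sum>s\<in>?D. card (s \<times> s \<times> s))" by (rule card_UN_le[OF finD])
    also have "\<dots> = (\<Sum>s\<in>?D. 27)"
    proof (rule sum.cong[OF refl])
      fix s assume "s \<in> ?D"
      then have "card s = 3" using D3 by (auto simp: nsets_def)
      then show "card (s \<times> s \<times> s) = 27" by (simp add: card_cartesian_product)
    qed
    finally have "card {r \<in> V \<times> V \<times> V. ?\<phi> r \<in> ?D} \<le> 27 * card ?D" by simp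
    then have "real (card {r \<in> V \<times> V \<times> V. ?\<phi> r \<in> ?D}) \<le> real (27 * card ?D)" by (simp only: of_nat_le_iff)
    then show ?thesis by simp
  qed
  finally show ?thesis using D by (simp add: V_def)
qed

text \<open>A nearby member of \<H>' has the same vertex set, so its labelling and pattern are kept
  for \<open>G\<close>. Closeness \<open>\<eta> / 54\<close> costs \<open>27 * \<eta> / 54\<close>,
  the remaining half of the allowed error.\<close>

lemma approximable_close:
  assumes her: "hereditary \<H>" "hereditary \<H>'" and close: "close_to \<H> \<H>'" and ap: "approximable \<H>'"
  shows "approximable \<H>"
  unfolding approximable_def
proof (intro allI impI)
  fix \<eta> :: real and t\<^sub>0 :: nat assume \<eta>: "\<eta> > 0"
  then have \<eta>': "\<eta> / 2 > 0" "\<eta> / 54 > 0" by auto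
  from ap[unfolded approximable_def, rule_format, OF \<eta>'(1), of t\<^sub>0] obtain T N where
    TN: "\<And>G. G \<in> \<H>' \<Longrightarrow> N \<le> card (verts G) \<Longrightarrow> \<exists>t p h. t\<^sub>0 \<le> t \<and> t \<le> T \<and> equitable (verts G) p t \<and>
      step_err G p h \<le> \<eta> / 2 * real (card (verts G)) ^ 3" by blast
  from close[unfolded close_to_def, rule_format, OF \<eta>'(2)] obtain N' where
    N': "\<And>G. G \<in> \<H> \<Longrightarrow> N' \<le> card (verts G) \<Longrightarrow> \<exists>G'\<in>\<H>'. delta_close (\<eta> / 54) G G'" by blast
  have "\<exists>t p h. t\<^sub>0 \<le> t \<and> t \<le> T \<and> equitable (verts G) p t \<and> step_err G p h \<le> \<eta> * real (card (verts G)) ^ 3"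
    if G: "G \<in> \<H>" "max N N' \<le> card (verts G)" for G
  proof -
    obtain G' where G': "G' \<in> \<H>'" "delta_close (\<eta> / 54) G G'" using N'[OF G(1)] G(2) by auto
    then have V: "verts G' = verts G" by (simp add: delta_close_def)
    have "N \<le> card (verts G')" using G(2) V by simp
    from TN[OF G'(1) this, unfolded V]
    obtain t p h where t: "t\<^sub>0 \<le> t" "t \<le> T" "equitable (verts G) p t"
      "step_err G' p h \<le> \<eta> / 2 * real (card (verts G)) ^ 3" by (elim exE conjE) (rule that)
    from step_err_close[OF hereditaryD[OF her(1) G(1)] hereditaryD(2)[OF her(2) G'(1)] G'(2), of p h] t(4)
    have "step_err G p h \<le> \<eta> * real (card (verts G)) ^ 3" by simp
    with t show ?thesis by (intro exI[of _ t] exI[of _ p] exI[of _ h]) simp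
  qed
  then show "\<exists>T N. \<forall>G\<in>\<H>. N \<le> card (verts G) \<longrightarrow>
     (\<exists>t p h. t\<^sub>0 \<le> t \<and> t \<le> T \<and> equitable (verts G) p t \<and> step_err G p h \<le> \<eta> * real (card (verts G)) ^ 3)" by blast
qed

lemma bounded_SVC_imp_approximable:
  assumes her: "hereditary \<H>" and k: "\<forall>H\<in>\<H>. SVC H \<le> k"
  shows "approximable \<H>"
proof (rule no_config_imp_approximable[where k = "Suc k"])
  show fin: "finite (verts G)" if "G \<in> \<H>" for G using her that by (rule hereditaryD)
  show "\<not> ubar_config G (Suc k)" if "G \<in> \<H>" for G
  proof
    assume "ubar_config G (Suc k)"
    then have "slice_shatters G (Suc k)" by (intro ubar_config_imp_slice_shatters) auto
    moreover have "SVC G \<le> k" using k that by blast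
    ultimately show False using SVC_le_iff[OF fin[OF that]] by force
  qed
qed

lemma Trip_omits_Ubar_iff_no_config:
  "(\<exists>k\<ge>1. Trip_omits \<H> (Ubar k)) \<longleftrightarrow> (\<exists>k\<ge>1. \<forall>H\<in>\<H>. \<not> ubar_config H k)"
proof
  assume "\<exists>k\<ge>1. Trip_omits \<H> (Ubar k)"
  then show "\<exists>k\<ge>1. \<forall>H\<in>\<H>. \<not> ubar_config H k" using ubar_config_imp_not_omits by blast
next
  assume "\<exists>k\<ge>1. \<forall>H\<in>\<H>. \<not> ubar_config H k"
  then obtain k where "\<forall>H\<in>\<H>. \<not> ubar_config H k" by blast
  then have "Trip_omits \<H> (Ubar (Suc k))" using not_omits_imp_ubar_config[of \<H> k] by blast
  then show "\<exists>k\<ge>1. Trip_omits \<H> (Ubar k)" by (intro exI[of _ "Suc k"]) simp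
qed

theorem theorem2p34:
  fixes \<H> :: "nat graph3 set"
  assumes "hereditary \<H>"
  shows "(vdisc3_homogeneous \<H> \<longleftrightarrow> (\<exists>k\<ge>1. Trip_omits \<H> (Ubar k))) \<and>
         ((\<exists>k\<ge>1. Trip_omits \<H> (Ubar k)) \<longleftrightarrow>
          (\<exists>\<H>'. hereditary \<H>' \<and> (\<exists>k. \<forall>H'\<in>\<H>'. SVC H' \<le> k) \<and> prop_sim \<H> \<H>'))"
proof -
  have fin: "finite (verts G)" and graph: "is_graph3 G" if "G \<in> \<H>" for G
    using hereditaryD[OF assms that] .
  have approx_hom: "vdisc3_homogeneous \<H>" if "approximable \<H>"
    using fin graph that by (rule approximable_imp_homogeneous)
  have hom_omits: "\<exists>k\<ge>1. Trip_omits \<H> (Ubar k)" if "vdisc3_homogeneous \<H>"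
    using homogeneous_imp_no_config[OF assms that] Trip_omits_Ubar_iff_no_config by blast
  have omits: "approximable \<H>" "\<exists>\<H>'. hereditary \<H>' \<and> (\<exists>k. \<forall>H'\<in>\<H>'. SVC H' \<le> k) \<and> prop_sim \<H> \<H>'"
    if "\<exists>k\<ge>1. Trip_omits \<H> (Ubar k)"
  proof -
    from that[unfolded Trip_omits_Ubar_iff_no_config] obtain k where "\<forall>H\<in>\<H>. \<not> ubar_config H k"
      by blast
    then have k: "\<not> ubar_config H k" if "H \<in> \<H>" for H using that by blast
    show ap: "approximable \<H>" using fin k by (rule no_config_imp_approximable)
    have "prop_sim \<H> (positive_part \<H>)"
      unfolding prop_sim_def
      using approximable_imp_close_to_positive_part[OF assms ap]
        close_to_superset[OF positive_part_subset[OF assms]] by blast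
    moreover have "\<forall>H'\<in>positive_part \<H>. SVC H' \<le> k"
      using SVC_positive_part_le[OF assms k] by blast
    ultimately show "\<exists>\<H>'. hereditary \<H>' \<and> (\<exists>k. \<forall>H'\<in>\<H>'. SVC H' \<le> k) \<and> prop_sim \<H> \<H>'"
      using hereditary_positive_part[OF assms] by blast
  qed
  have "approximable \<H>"
    if "\<exists>\<H>'. hereditary \<H>' \<and> (\<exists>k. \<forall>H'\<in>\<H>'. SVC H' \<le> k) \<and> prop_sim \<H> \<H>'"
  proof -
    from that obtain \<H>' k where H': "hereditary \<H>'" "\<forall>H'\<in>\<H>'. SVC H' \<le> k" and "close_to \<H> \<H>'"
      unfolding prop_sim_def by blast
    then show ?thesis using approximable_close[OF assms] bounded_SVC_imp_approximable[OF H'] by blast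
  qed
  with approx_hom hom_omits omits show ?thesis by blast
qed

end
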